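(* If $D$ is a symmetric union knot diagram, then $W_D$ is a Laurent polynomial in $s$ and $t$, i.e. $W_D\in\mathbb{Z}[s^{\pm1},t^{\pm1}]$. More generally, if $D$ is a symmetric union diagram with $n$ components, then $$W_D\in\mathbb{Z}[s^{\pm1},t^{\pm1}]\cdot(s^{1/2}+s^{-1/2})^{n-1}.$$
   Context: Diagrams: we consider planar link diagrams in $\mathbb{R}^2$ transverse to the axis $\{0\}\times\mathbb{R}$; crossings may lie on the axis. Let $\rho(x,y)=(-x,y)$. A diagram is symmetric if $\rho(D)=D$ (including over/under information) except for crossings on the axis, which are necessarily reversed by $\rho$. A symmetric union is a symmetric diagram such that each component is mapped to itself by $\rho$ with reversed orientation; equivalently each component perpendicularly traverses the axis in exactly two points that are not crossings. A symmetric union knot diagram is a symmetric union with one component. Crossings on the axis: such a crossing has two ends on the left and two on the right. It is of type $X_o$ if the overstrand runs from upper left to lower right, $X_u$ if it runs from lower left to upper right. The horizontal smoothing $h$ joins upper left to upper right and lower left to lower right; the vertical smoothing $v$ joins the two left ends to each other and the two right ends to each other (without meeting the axis). $W$: the bracket $\langle D\rangle\in\mathbb{Z}(A,B)$ is defined (forgetting orientations) by: (A) for a crossing off the axis, $\langle D\rangle=A\langle D_A\rangle+A^{-1}\langle D_B\rangle$, where $D_A$ is the smoothing joining the two regions swept out when the overstrand is turned counterclockwise to the understrand, $D_B$ the other smoothing; (B) on the axis, $\langle X_o\rangle=B\langle h\rangle+B^{-1}\langle v\rangle$ and $\langle X_u\rangle=B^{-1}\langle h\rangle+B\langle v\rangle$;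 (C) for $n$ disjoint circles without crossings meeting the axis in $2m$ points, $\langle C\rangle=(-A^2-A^{-2})^{n-m}(-B^2-B^{-2})^{m-1}$. For oriented $D$ let $\alpha(D)$ (resp. $\beta(D)$) be the sum of crossing signs off (resp. on) the axis, and $W_D=\langle D\rangle(-A^{-3})^{\alpha(D)}(-B^{-3})^{\beta(D)}\in\mathbb{Z}(s^{1/2},t^{1/2})$, rewritten via $A^2=t^{-1/2}$, $B^2=s^{-1/2}$. For symmetric unions $W_D$ does not depend on the chosen orientations. *)

theory Defs
  imports "HOL-Computational_Algebra.Computational_Algebra"
begin

section \<open>Planar link diagrams transverse to the axis\<close>

text \<open>
  A planar link diagram transverse to the axis \<open>{0} \<times> \<real>\<close> is encoded, up to planar isotopy
  respecting the axis, by cutting the plane along horizontal lines between the critical points of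
  the height function, the crossings and the points on the axis. This gives a list of layers, read
  from bottom to top. A horizontal cutting line meets the diagram in finitely many points off the
  axis; they are numbered on either side by \<open>0, 1, 2, \<dots>\<close> from the axis outwards, so that the
  reflection \<open>\<rho>\<close> just exchanges the two sides.

  A layer contains at most one event on each side of the axis, or else exactly one event on the
  axis. Two events off the axis may share a layer because in a symmetric diagram an event and its
  mirror image have the same height.
\<close>

datatype side = Lft | Rgt

text \<open>
  The over/under information of a crossing of two strands that run upwards through the layer:
  the overstrand goes from lower left to upper right (\<open>Asc\<close>) or from upper left to lower right
  (\<open>Desc\<close>). On the axis, \<open>Desc\<close> is the type \<open>X\<^sub>o\<close> and \<open>Asc\<close> is the type \<open>X\<^sub>u\<close>.
\<close>

datatype over = Asc | Desc

text \<open>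
  What happens on one side of the axis. \<open>Cup i\<close> is a local minimum, whose two upper ends get the
  numbers \<open>i\<close> and \<open>i + 1\<close>; \<open>Cap i\<close> is a local maximum joining the points \<open>i\<close> and \<open>i + 1\<close>;
  \<open>Turn i\<close> is \<open>Cap i\<close> followed, further up, by \<open>Cup i\<close> (the horizontal smoothing of a crossing);
  \<open>Cross i x\<close> is a crossing of the strands \<open>i\<close> and \<open>i + 1\<close>.
\<close>

datatype event = Idle | Cup nat | Cap nat | Turn nat | Cross nat over

text \<open>
  \<open>Ax_cup\<close> and \<open>Ax_cap\<close> are a local minimum and a local maximum on the axis; \<open>Ax_turn\<close> is
  \<open>Ax_cap\<close> followed, further up, by \<open>Ax_cup\<close>; \<open>Ax_pass Lft\<close>
  (\<open>Ax_pass Rgt\<close>) is a strand without critical point that traverses the axis and whose lower end is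
  on the left (on the right); \<open>Ax_cross\<close> is a crossing on the axis.
\<close>

datatype layer =
    Off event event
  | Ax_cup
  | Ax_cap
  | Ax_turn
  | Ax_pass side
  | Ax_cross over

type_synonym diagram = "layer list"

text \<open>A point on a cutting line, and a point of the diagram on the \<open>k\<close>-th cutting line.\<close>

type_synonym pos = "side \<times> nat"
type_synonym point = "nat \<times> pos"

fun event_fits :: "event \<Rightarrow> nat \<Rightarrow> bool" where
  "event_fits Idle n \<longleftrightarrow> True"
| "event_fits (Cup i) n \<longleftrightarrow> i \<le> n"
| "event_fits (Cap i) n \<longleftrightarrow> i + 2 \<le> n"
| "event_fits (Turn i) n \<longleftrightarrow> i + 2 \<le> n"
| "event_fits (Cross i x) n \<longleftrightarrow> i + 2 \<le> n"

fun event_width :: "event \<Rightarrow> nat \<Rightarrow> nat" where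
  "event_width Idle n = n"
| "event_width (Cup i) n = n + 2"
| "event_width (Cap i) n = n - 2"
| "event_width (Turn i) n = n"
| "event_width (Cross i x) n = n"

text \<open>
  \<open>w s\<close> is the number of points on the side \<open>s\<close> of the cutting line below the layer;
  \<open>layer_width l w\<close> describes the cutting line above it.
\<close>

fun layer_fits :: "layer \<Rightarrow> (side \<Rightarrow> nat) \<Rightarrow> bool" where
  "layer_fits (Off e f) w \<longleftrightarrow> event_fits e (w Lft) \<and> event_fits f (w Rgt)"
| "layer_fits Ax_cup w \<longleftrightarrow> True"
| "layer_fits Ax_cap w \<longleftrightarrow> 0 < w Lft \<and> 0 < w Rgt"
| "layer_fits Ax_turn w \<longleftrightarrow> 0 < w Lft \<and> 0 < w Rgt"
| "layer_fits (Ax_pass s) w \<longleftrightarrow> 0 < w s"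
| "layer_fits (Ax_cross x) w \<longleftrightarrow> 0 < w Lft \<and> 0 < w Rgt"

fun layer_width :: "layer \<Rightarrow> (side \<Rightarrow> nat) \<Rightarrow> side \<Rightarrow> nat" where
  "layer_width (Off e f) w s = (case s of Lft \<Rightarrow> event_width e (w Lft) | Rgt \<Rightarrow> event_width f (w Rgt))"
| "layer_width Ax_cup w s = w s + 1"
| "layer_width Ax_cap w s = w s - 1"
| "layer_width Ax_turn w s = w s"
| "layer_width (Ax_pass s') w s = (if s = s' then w s - 1 else w s + 1)"
| "layer_width (Ax_cross x) w s = w s"

definition width :: "diagram \<Rightarrow> nat \<Rightarrow> side \<Rightarrow> nat" where
  "width D k = fold layer_width (take k D) (\<lambda>_. 0)"

definition link_diagram :: "diagram \<Rightarrow> bool" where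
  "link_diagram D \<longleftrightarrow>
     (\<forall>k<length D. layer_fits (D ! k) (width D k)) \<and> (\<forall>s. width D (length D) s = 0)"

definition points :: "diagram \<Rightarrow> point set" where
  "points D = {(k, s, i). k \<le> length D \<and> i < width D k s}"


section \<open>Strands, components and orientations\<close>

text \<open>
  The arcs inside a layer. \<open>runs l p q\<close>: an arc joins the lower point \<open>p\<close> to the upper point \<open>q\<close>
  (through a crossing, this follows the strand). \<open>cups l p q\<close> and \<open>caps l p q\<close>: an arc with
  a local minimum (maximum) joins the two upper (lower) points \<open>p\<close> and \<open>q\<close>.
\<close>

fun event_runs :: "event \<Rightarrow> nat \<Rightarrow> nat \<Rightarrow> bool" where
  "event_runs Idle i j \<longleftrightarrow> j = i"
| "event_runs (Cup c) i j \<longleftrightarrow> j = (if i < c then i else i + 2)"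
| "event_runs (Cap c) i j \<longleftrightarrow> i < c \<and> j = i \<or> c + 2 \<le> i \<and> j = i - 2"
| "event_runs (Turn c) i j \<longleftrightarrow> i \<noteq> c \<and> i \<noteq> c + 1 \<and> j = i"
| "event_runs (Cross c x) i j \<longleftrightarrow> j = (if i = c then c + 1 else if i = c + 1 then c else i)"

fun other :: "side \<Rightarrow> side" where
  "other Lft = Rgt"
| "other Rgt = Lft"

fun runs :: "layer \<Rightarrow> pos \<Rightarrow> pos \<Rightarrow> bool" where
  "runs (Off e f) (s, i) (s', j) \<longleftrightarrow>
     s' = s \<and> event_runs (case s of Lft \<Rightarrow> e | Rgt \<Rightarrow> f) i j"
| "runs Ax_cup (s, i) (s', j) \<longleftrightarrow> s' = s \<and> j = i + 1"
| "runs Ax_cap (s, i) (s', j) \<longleftrightarrow> s' = s \<and> i = j + 1"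
| "runs Ax_turn (s, i) (s', j) \<longleftrightarrow> i \<noteq> 0 \<and> s' = s \<and> j = i"
| "runs (Ax_pass t) (s, i) (s', j) \<longleftrightarrow>
     (if s = t then if i = 0 then s' = other t \<and> j = 0 else s' = s \<and> j = i - 1
      else s' = s \<and> j = i + 1)"
| "runs (Ax_cross x) (s, i) (s', j) \<longleftrightarrow> s' = (if i = 0 then other s else s) \<and> j = i"

fun cups :: "layer \<Rightarrow> pos \<Rightarrow> pos \<Rightarrow> bool" where
  "cups (Off e f) (s, i) (s', j) \<longleftrightarrow>
     s' = s \<and> j = i + 1 \<and> (case s of Lft \<Rightarrow> e | Rgt \<Rightarrow> f) \<in> {Cup i, Turn i}"
| "cups Ax_cup p q \<longleftrightarrow> p = (Lft, 0) \<and> q = (Rgt, 0)"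
| "cups Ax_turn p q \<longleftrightarrow> p = (Lft, 0) \<and> q = (Rgt, 0)"
| "cups _ p q \<longleftrightarrow> False"

fun caps :: "layer \<Rightarrow> pos \<Rightarrow> pos \<Rightarrow> bool" where
  "caps (Off e f) (s, i) (s', j) \<longleftrightarrow>
     s' = s \<and> j = i + 1 \<and> (case s of Lft \<Rightarrow> e | Rgt \<Rightarrow> f) \<in> {Cap i, Turn i}"
| "caps Ax_cap p q \<longleftrightarrow> p = (Lft, 0) \<and> q = (Rgt, 0)"
| "caps Ax_turn p q \<longleftrightarrow> p = (Lft, 0) \<and> q = (Rgt, 0)"
| "caps _ p q \<longleftrightarrow> False"

inductive adjacent :: "diagram \<Rightarrow> point \<Rightarrow> point \<Rightarrow> bool" for D where
  adjacent_run: "\<lbrakk>k < length D; runs (D ! k) p q; (k, p) \<in> points D\<rbrakk> \<Longrightarrow> adjacent D (k, p) (Suc k, q)"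
| adjacent_cup: "\<lbrakk>k < length D; cups (D ! k) p q\<rbrakk> \<Longrightarrow> adjacent D (Suc k, p) (Suc k, q)"
| adjacent_cap: "\<lbrakk>k < length D; caps (D ! k) p q\<rbrakk> \<Longrightarrow> adjacent D (k, p) (k, q)"

definition joined :: "diagram \<Rightarrow> (point \<times> point) set" where
  "joined D = {(p, q). p \<in> points D \<and> q \<in> points D \<and> (symclp (adjacent D))\<^sup>*\<^sup>* p q}"

text \<open>
  The components of the link, each given by its points on the cutting lines. (For a diagram without
  crossings these are its circles.) Every closed curve meets some cutting line between its minimum
  and its maximum.
\<close>

definition link_components :: "diagram \<Rightarrow> point set set" where
  "link_components D = points D // joined D"

text \<open>
  An orientation tells for each point on a cutting line whether the strand through it is directed
  upwards there.
\<close>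

definition orientation :: "diagram \<Rightarrow> (point \<Rightarrow> bool) \<Rightarrow> bool" where
  "orientation D up \<longleftrightarrow>
     (\<forall>k<length D. \<forall>p q.
        (runs (D ! k) p q \<and> (k, p) \<in> points D \<longrightarrow> (up (Suc k, q) \<longleftrightarrow> up (k, p))) \<and>
        (cups (D ! k) p q \<longrightarrow> (up (Suc k, q) \<longleftrightarrow> \<not> up (Suc k, p))) \<and>
        (caps (D ! k) p q \<longrightarrow> (up (k, q) \<longleftrightarrow> \<not> up (k, p))))"


section \<open>Symmetric diagrams and symmetric unions\<close>

fun opposite :: "over \<Rightarrow> over" where
  "opposite Asc = Desc"
| "opposite Desc = Asc"

text \<open>
  The reflection \<open>\<rho>(x, y) = (-x, y)\<close>. It keeps the information which of two strands is the
  overstrand, but exchanges left and right, hence the labels \<open>Asc\<close> and \<open>Desc\<close>.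
\<close>

fun reflect_event :: "event \<Rightarrow> event" where
  "reflect_event (Cross i x) = Cross i (opposite x)"
| "reflect_event e = e"

fun reflect_layer :: "layer \<Rightarrow> layer" where
  "reflect_layer (Off e f) = Off (reflect_event f) (reflect_event e)"
| "reflect_layer Ax_cup = Ax_cup"
| "reflect_layer Ax_cap = Ax_cap"
| "reflect_layer Ax_turn = Ax_turn"
| "reflect_layer (Ax_pass s) = Ax_pass (other s)"
| "reflect_layer (Ax_cross x) = Ax_cross (opposite x)"

definition reflect :: "diagram \<Rightarrow> diagram" where
  "reflect D = map reflect_layer D"

fun reflect_point :: "point \<Rightarrow> point" where
  "reflect_point (k, s, i) = (k, other s, i)"

fun reverse_axis_crossing :: "layer \<Rightarrow> layer" where
  "reverse_axis_crossing (Ax_cross x) = Ax_cross (opposite x)"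
| "reverse_axis_crossing l = l"

definition symmetric :: "diagram \<Rightarrow> bool" where
  "symmetric D \<longleftrightarrow> link_diagram D \<and> reflect D = map reverse_axis_crossing D"

text \<open>
  As \<open>\<rho>\<close> preserves the vertical direction, it reverses the orientation of a component iff the
  orientations at \<open>p\<close> and at its mirror image, compared with the upward direction, are opposite
  to each other. If each component is mapped to itself, this does not depend on the choice of the
  orientation.
\<close>

definition symmetric_union :: "diagram \<Rightarrow> bool" where
  "symmetric_union D \<longleftrightarrow>
     symmetric D \<and>
     (\<forall>C\<in>link_components D. reflect_point ` C = C) \<and>
     (\<exists>up. orientation D up \<and> (\<forall>p\<in>points D. up (reflect_point p) \<longleftrightarrow> \<not> up p))"


section \<open>The bracket\<close>

text \<open>The field \<open>\<int>(A,B)\<close>, as fractions of polynomials in \<open>B\<close> over polynomials in \<open>A\<close>.\<close>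

type_synonym ratfun = "int poly poly fract"

definition var_A :: ratfun where
  "var_A = Fract [:[:0, 1:]:] 1"

definition var_B :: ratfun where
  "var_B = Fract [:0, 1:] 1"

definition circle_A :: ratfun where
  "circle_A = - (var_A ^ 2) - inverse (var_A ^ 2)"

definition circle_B :: ratfun where
  "circle_B = - (var_B ^ 2) - inverse (var_B ^ 2)"

fun axis_points :: "layer \<Rightarrow> nat" where
  "axis_points (Off e f) = 0"
| "axis_points Ax_cup = 1"
| "axis_points Ax_cap = 1"
| "axis_points Ax_turn = 2"
| "axis_points (Ax_pass s) = 1"
| "axis_points (Ax_cross x) = 0"

text \<open>Rule (C), for a diagram \<open>C\<close> without crossings. The exponents may be negative.\<close>

definition circles_value :: "diagram \<Rightarrow> ratfun" where
  "circles_value C =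
     (let n = int (card (link_components C)); m = int (sum_list (map axis_points C) div 2)
      in circle_A powi (n - m) * circle_B powi (m - 1))"

text \<open>
  Rule (A). The smoothings of \<open>Cross i x\<close> are \<open>Idle\<close> (two vertical arcs) and \<open>Turn i\<close> (two
  horizontal arcs). Turning an ascending overstrand counterclockwise to the understrand sweeps out
  the upper and the lower region, so \<open>D\<^sub>A\<close> is \<open>Idle\<close>; turning a descending one sweeps out the left
  and the right region, so \<open>D\<^sub>A\<close> is \<open>Turn i\<close>.
\<close>

fun coeff_idle :: "over \<Rightarrow> ratfun" where
  "coeff_idle Asc = var_A"
| "coeff_idle Desc = inverse var_A"

fun coeff_turn :: "over \<Rightarrow> ratfun" where
  "coeff_turn Asc = inverse var_A"
| "coeff_turn Desc = var_A"

text \<open>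
  Rule (B). The horizontal smoothing \<open>h\<close> is \<open>Ax_turn\<close>; the vertical smoothing \<open>v\<close> is \<open>Off Idle Idle\<close>.
\<close>

fun coeff_h :: "over \<Rightarrow> ratfun" where
  "coeff_h Desc = var_B"
| "coeff_h Asc = inverse var_B"

fun coeff_v :: "over \<Rightarrow> ratfun" where
  "coeff_v Desc = inverse var_B"
| "coeff_v Asc = var_B"

fun event_crossings :: "event \<Rightarrow> nat" where
  "event_crossings (Cross i x) = 1"
| "event_crossings _ = 0"

fun layer_crossings :: "layer \<Rightarrow> nat" where
  "layer_crossings (Off e f) = event_crossings e + event_crossings f"
| "layer_crossings (Ax_cross x) = 1"
| "layer_crossings _ = 0"

text \<open>
  \<open>resolve P Q\<close> is the bracket of \<open>P @ Q\<close>, where \<open>P\<close> is without crossings: the rules are applied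
  to the first crossing. By the lemmas below they hold for every crossing.
\<close>

function (sequential) resolve :: "diagram \<Rightarrow> diagram \<Rightarrow> ratfun" where
  "resolve P [] = circles_value P"
| "resolve P (Off (Cross i x) f # Q) =
     coeff_idle x * resolve P (Off Idle f # Q) + coeff_turn x * resolve P (Off (Turn i) f # Q)"
| "resolve P (Off e (Cross i x) # Q) =
     coeff_idle x * resolve P (Off e Idle # Q) + coeff_turn x * resolve P (Off e (Turn i) # Q)"
| "resolve P (Ax_cross x # Q) =
     coeff_h x * resolve P (Ax_turn # Q) + coeff_v x * resolve P (Off Idle Idle # Q)"
| "resolve P (l # Q) = resolve (P @ [l]) Q"
  by pat_completeness auto
termination
  by (relation "measures [\<lambda>(P, Q). sum_list (map layer_crossings Q), \<lambda>(P, Q). length Q]") auto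

definition bracket :: "diagram \<Rightarrow> ratfun" where
  "bracket D = resolve [] D"

lemma resolve_no_crossings:
  "\<forall>l\<in>set Q. layer_crossings l = 0 \<Longrightarrow> resolve P Q = circles_value (P @ Q)"
  by (induction P Q rule: resolve.induct) auto

lemma resolve_left:
  "resolve P (U @ Off (Cross i x) f # V) =
     coeff_idle x * resolve P (U @ Off Idle f # V) + coeff_turn x * resolve P (U @ Off (Turn i) f # V)"
  by (induction P U rule: resolve.induct) (auto simp: algebra_simps)

lemma resolve_right:
  "resolve P (U @ Off e (Cross i x) # V) =
     coeff_idle x * resolve P (U @ Off e Idle # V) + coeff_turn x * resolve P (U @ Off e (Turn i) # V)"
proof (induction P U rule: resolve.induct)
  case (1 P)
  then show ?case by (cases e) (auto simp: algebra_simps)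
qed (auto simp: algebra_simps)

lemma resolve_axis:
  "resolve P (U @ Ax_cross x # V) =
     coeff_h x * resolve P (U @ Ax_turn # V) + coeff_v x * resolve P (U @ Off Idle Idle # V)"
  by (induction P U rule: resolve.induct) (auto simp: algebra_simps)

lemma bracket_off_axis:
  "bracket (U @ Off (Cross i x) f # V) =
     coeff_idle x * bracket (U @ Off Idle f # V) + coeff_turn x * bracket (U @ Off (Turn i) f # V)"
  "bracket (U @ Off e (Cross i x) # V) =
     coeff_idle x * bracket (U @ Off e Idle # V) + coeff_turn x * bracket (U @ Off e (Turn i) # V)"
  by (simp_all add: bracket_def resolve_left resolve_right)

lemma bracket_on_axis:
  "bracket (U @ Ax_cross x # V) =
     coeff_h x * bracket (U @ Ax_turn # V) + coeff_v x * bracket (U @ Off Idle Idle # V)"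
  by (simp add: bracket_def resolve_axis)

lemma bracket_circles:
  "\<forall>l\<in>set C. layer_crossings l = 0 \<Longrightarrow> bracket C = circles_value C"
  by (simp add: bracket_def resolve_no_crossings)


section \<open>The polynomial \<open>W\<close>\<close>

text \<open>
  If both strands are directed upwards, or both downwards, then a crossing is positive iff
  the overstrand goes from lower left to upper right. Reversing one strand changes the sign.
\<close>

definition crossing_sign :: "over \<Rightarrow> bool \<Rightarrow> bool \<Rightarrow> int" where
  "crossing_sign x up1 up2 = (if (x = Asc) = (up1 = up2) then 1 else -1)"

fun event_sign :: "event \<Rightarrow> (nat \<Rightarrow> bool) \<Rightarrow> int" where
  "event_sign (Cross i x) up = crossing_sign x (up i) (up (i + 1))"
| "event_sign _ up = 0"

fun off_axis_sign :: "layer \<Rightarrow> (pos \<Rightarrow> bool) \<Rightarrow> int" where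
  "off_axis_sign (Off e f) up = event_sign e (\<lambda>i. up (Lft, i)) + event_sign f (\<lambda>i. up (Rgt, i))"
| "off_axis_sign _ up = 0"

fun on_axis_sign :: "layer \<Rightarrow> (pos \<Rightarrow> bool) \<Rightarrow> int" where
  "on_axis_sign (Ax_cross x) up = crossing_sign x (up (Lft, 0)) (up (Rgt, 0))"
| "on_axis_sign _ up = 0"

definition alpha :: "diagram \<Rightarrow> (point \<Rightarrow> bool) \<Rightarrow> int" where
  "alpha D up = (\<Sum>k<length D. off_axis_sign (D ! k) (\<lambda>p. up (k, p)))"

definition beta :: "diagram \<Rightarrow> (point \<Rightarrow> bool) \<Rightarrow> int" where
  "beta D up = (\<Sum>k<length D. on_axis_sign (D ! k) (\<lambda>p. up (k, p)))"

definition W :: "diagram \<Rightarrow> (point \<Rightarrow> bool) \<Rightarrow> ratfun" where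
  "W D up = bracket D * (- (var_A powi (-3))) powi alpha D up * (- (var_B powi (-3))) powi beta D up"

text \<open>
  The substitution \<open>A\<^sup>2 = t\<^sup>-\<^sup>1\<^sup>/\<^sup>2\<close>, \<open>B\<^sup>2 = s\<^sup>-\<^sup>1\<^sup>/\<^sup>2\<close> identifies \<open>\<int>(s\<^sup>1\<^sup>/\<^sup>2, t\<^sup>1\<^sup>/\<^sup>2)\<close> with a subfield of \<open>\<int>(A,B)\<close>.
\<close>

definition sqrt_s :: ratfun where
  "sqrt_s = var_B powi (-2)"

definition sqrt_t :: ratfun where
  "sqrt_t = var_A powi (-2)"

definition var_s :: ratfun where
  "var_s = sqrt_s ^ 2"

definition var_t :: ratfun where
  "var_t = sqrt_t ^ 2"

definition laurent_polys :: "ratfun set" where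
  "laurent_polys =
     {(\<Sum>(i, j)\<in>S. of_int (c i j) * var_s powi i * var_t powi j) | S c. finite (S :: (int \<times> int) set)}"

end

theory Submission
  imports Defs
begin

text \<open>
  The bracket of a diagram without axis crossings is read as a partition function. With
  \<open>q = -A\<^sup>2\<close>, cups and caps act on functions of boolean configurations of a cutting line by the
  Temperley-Lieb relations with loop value \<open>q + q\<^sup>-\<^sup>1 = \<delta> = -A\<^sup>2 - A\<^sup>-\<^sup>2\<close>, and a closed diagram gets the
  value \<open>\<delta>\<^bsup>n\<^esup>\<close> for \<open>n\<close> circles; that the exponent is the number of circles is seen at \<open>q = 1\<close>, where
  the partition function counts orientations.

  In a symmetric diagram the configurations of the two halves index the rows and columns of an
  operator on \<open>(\<complex>\<^sup>2)\<^bsup>\<otimes>w\<^esup>\<close>, where \<open>w\<close> is the width of one half, and a crossing together with its mirror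
  image acts on it as a conjugation. Expand this operator in normally ordered monomials in the
  Jordan-Wigner creation and annihilation operators. The expansions in which a monomial with \<open>r\<close>
  creation operators has a coefficient in \<open>(1 + A\<^sup>4)\<^sup>r \<int>[A\<^bsup>4\<^esup>, A\<^bsup>-4\<^esup>]\<close>, up to powers of \<open>A\<^sup>2\<close> given by the
  positions, form a lattice preserved by symmetric pairs of crossings, whereas cups and caps off the
  axis map it to \<open>\<delta>\<^bsup>-1\<^esup>\<close> and \<open>\<delta>\<close> times itself, and cups and caps on the axis to \<open>1\<close> and \<open>\<delta>\<close> times
  itself. Hence the partition function of a closed diagram lies in \<open>\<delta>\<^sup>m \<int>[A\<^bsup>4\<^esup>, A\<^bsup>-4\<^esup>]\<close>, so that the bracket lies in
  \<open>\<delta>\<^sub>B\<^bsup>m-1\<^esup> \<int>[A\<^bsup>4\<^esup>, A\<^bsup>-4\<^esup>]\<close>, where \<open>\<delta>\<^sub>B = -B\<^sup>2 - B\<^sup>-\<^sup>2\<close> and \<open>2m\<close> is the number of points on the axis.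
  Axis crossings are removed by rule (B): the smoothing \<open>h\<close> raises \<open>m\<close> by one and \<open>v\<close> keeps it.

  In a symmetric union each component has exactly two points on the axis since the reflection
  reverses its orientation; hence \<open>m\<close> is the number of components. The signs off the axis cancel, and
  the type of a crossing on the axis determines its sign.
\<close>

section \<open>The Temperley-Lieb action\<close>

type_synonym config = "nat \<Rightarrow> bool"

definition del :: "nat \<Rightarrow> config \<Rightarrow> config" where
  "del i c = (\<lambda>j. c (if j < i then j else j + 2))"

definition ins :: "nat \<Rightarrow> bool \<Rightarrow> bool \<Rightarrow> config \<Rightarrow> config" where
  "ins i a b c = (\<lambda>j. if j < i then c j else if j = i then a else if j = i + 1 then b else c (j - 2))"

text \<open>In the symmetric normalisation, cups and caps carry square roots of \<open>q\<close> and
  its inverse. Rescaling cups by the root and caps by its inverse leaves only integral powers of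
  \<open>q\<close>; at \<open>q = 1\<close> all nonzero weights are 1.\<close>

definition cup_weight :: "'a::field \<Rightarrow> bool \<Rightarrow> bool \<Rightarrow> 'a" where
  "cup_weight q a b = (if a = b then 0 else if a then q else 1)"

definition row_cup :: "'a::field \<Rightarrow> nat \<Rightarrow> (config \<Rightarrow> 'a) \<Rightarrow> config \<Rightarrow> 'a" where
  "row_cup q i f c = cup_weight q (c i) (c (i + 1)) * f (del i c)"

definition row_cap :: "'a::field \<Rightarrow> nat \<Rightarrow> (config \<Rightarrow> 'a) \<Rightarrow> config \<Rightarrow> 'a" where
  "row_cap q i f c = inverse q * f (ins i False True c) + f (ins i True False c)"

lemma ins_at [simp]: "ins i a b c i = a" "ins i a b c (Suc i) = b"
  by (auto simp: ins_def)

lemma ins_less: "j < i \<Longrightarrow> ins i a b c j = c j"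
  by (simp add: ins_def)

lemma ins_greater: "i + 2 \<le> j \<Longrightarrow> ins i a b c j = c (j - 2)"
  by (simp add: ins_def)

lemma del_ins [simp]: "del i (ins i a b c) = c"
  by (auto simp: del_def ins_def fun_eq_iff)

lemma del_Suc_ins [simp]: "del (Suc i) (ins i a b c) = c(i := a)"
  by (auto simp: del_def ins_def fun_eq_iff)

lemma del_ins_Suc [simp]: "del i (ins (Suc i) a b c) = c(i := b)"
proof
  fix j show "del i (ins (Suc i) a b c) j = (c(i := b)) j"
    by (cases "j < i"; cases "j = i") (auto simp: del_def ins_def)
qed

lemma del_ins_far_right:
  "i + 2 \<le> j \<Longrightarrow> del j (ins i a b c) = ins i a b (del (j - 2) c)"
  by (auto simp: del_def ins_def fun_eq_iff Suc_diff_le intro!: arg_cong[of _ _ c])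

lemma del_ins_far_left:
  assumes "j + 2 \<le> i"
  shows "del j (ins i a b c) = ins (i - 2) a b (del j c)"
proof -
  define k where "k = i - 2"
  then have "i = k + 2" "j \<le> k" using assms by simp_all
  then show ?thesis
    by (simp add: del_def ins_def fun_eq_iff Suc_diff_le numeral_2_eq_2 diff_Suc split: nat.split)
qed

lemma row_cap_cup_same:
  assumes "q \<noteq> 0"
  shows "row_cap q i (row_cup q i f) = (\<lambda>c. (q + inverse q) * f c)"
  by (rule ext) (simp add: row_cap_def row_cup_def cup_weight_def algebra_simps)

text \<open>Pulling a zigzag straight: of the two summands of the cap only the one that matches the
  free end \<open>c i\<close> survives the cup weight, and its weights cancel.\<close>

lemma row_cap_cup_right:
  assumes "q \<noteq> 0"
  shows "row_cap q i (row_cup q (Suc i) f) = f"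
proof
  fix c :: config
  have c: "c = c(i := c i)" by simp
  have [simp]: "ins i a b c (Suc (Suc i)) = c i" for a b by (simp add: ins_def)
  show "row_cap q i (row_cup q (Suc i) f) c = f c"
    using assms fun_upd_triv[of c i]
    by (cases "c i") (simp_all add: row_cap_def row_cup_def cup_weight_def)
qed

lemma row_cap_cup_left:
  assumes "q \<noteq> 0"
  shows "row_cap q (Suc i) (row_cup q i f) = f"
proof
  fix c :: config
  have [simp]: "ins (Suc i) a b c i = c i" for a b by (simp add: ins_def)
  show "row_cap q (Suc i) (row_cup q i f) c = f c"
    using assms fun_upd_triv[of c i]
    by (cases "c i") (simp_all add: row_cap_def row_cup_def cup_weight_def)
qed

lemma row_cap_cup_far_right:
  assumes "i + 2 \<le> j"
  shows "row_cap q i (row_cup q j f) = row_cup q (j - 2) (row_cap q i f)"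
proof -
  define k where "k = j - 2"
  then have "j = k + 2" "i \<le> k" using assms by simp_all
  then show ?thesis
    by (intro ext)
       (simp add: row_cap_def row_cup_def del_ins_far_right ins_greater algebra_simps)
qed

lemma row_cap_cup_far_left:
  "j + 2 \<le> i \<Longrightarrow> row_cap q i (row_cup q j f) = row_cup q j (row_cap q (i - 2) f)"
  by (rule ext)
     (simp add: row_cap_def row_cup_def del_ins_far_left ins_less algebra_simps)

lemma row_cup_scale: "row_cup q i (\<lambda>c. a * f c) = (\<lambda>c. a * row_cup q i f c)"
  by (auto simp: row_cup_def)

lemma row_cap_scale: "row_cap q i (\<lambda>c. a * f c) = (\<lambda>c. a * row_cap q i f c)"
  by (auto simp: row_cap_def algebra_simps)

text \<open>A list of cups, the last one first, presents a crossingless matching, and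
  \<open>cups_vector\<close> is the vector of this matching.\<close>

fun valid_cups :: "nat list \<Rightarrow> nat \<Rightarrow> bool" where
  "valid_cups [] n \<longleftrightarrow> n = 0"
| "valid_cups (i # is) n \<longleftrightarrow> (\<exists>m. n = m + 2 \<and> i \<le> m \<and> valid_cups is m)"

fun cups_vector :: "'a::field \<Rightarrow> nat list \<Rightarrow> config \<Rightarrow> 'a" where
  "cups_vector q [] = (\<lambda>c. 1)"
| "cups_vector q (i # is) = row_cup q i (cups_vector q is)"

text \<open>The cap is moved down through the cups: it closes a cup to a circle, straightens with a
  neighbouring cup, or commutes past a distant one. \<open>N\<close> and \<open>js\<close> are
  chosen before \<open>q\<close>, so that \<open>N\<close> can be determined later at
  \<open>q = 1\<close>.\<close>

lemma cap_cups_vector: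
  assumes "valid_cups is (n + 2)" "i \<le> n"
  shows "\<exists>N js. valid_cups js n \<and> (\<forall>q::'a::field. q \<noteq> 0 \<longrightarrow>
    row_cap q i (cups_vector q is) = (\<lambda>c. (q + inverse q) ^ N * cups_vector q js c))"
  using assms
proof (induction "is" arbitrary: n i)
  case (Cons j "is")
  then have j: "j \<le> n" "valid_cups is n" by auto
  consider "j = i" | "j = Suc i" | "i = Suc j" | "i + 2 \<le> j" | "j + 2 \<le> i" by linarith
  then show ?case
  proof cases
    case 1
    then show ?thesis using j by (intro exI[of _ 1] exI[of _ "is"]) (simp add: row_cap_cup_same)
  next
    case 2
    then show ?thesis using j by (intro exI[of _ 0] exI[of _ "is"]) (simp add: row_cap_cup_right)
  next
    case 3
    then show ?thesis using j by (intro exI[of _ 0] exI[of _ "is"]) (simp add: row_cap_cup_left)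
  next
    case 4
    define m where "m = n - 2"
    have m: "n = m + 2" "i \<le> m" "j - 2 \<le> m" using 4 j by (simp_all add: m_def)
    from j m(1) have "valid_cups is (m + 2)" by simp
    from Cons.IH[OF this m(2)] obtain N js where *: "valid_cups js m"
      "\<And>q::'a. q \<noteq> 0 \<Longrightarrow>
        row_cap q i (cups_vector q is) = (\<lambda>c. (q + inverse q) ^ N * cups_vector q js c)" by blast
    show ?thesis
    proof (intro exI conjI allI impI)
      show "valid_cups ((j - 2) # js) n" using * m by simp
      show "row_cap q i (cups_vector q (j # is)) =
          (\<lambda>c. (q + inverse q) ^ N * cups_vector q ((j - 2) # js) c)" if "q \<noteq> 0" for q :: 'a
        using * that 4 by (simp add: row_cap_cup_far_right row_cup_scale)
    qed
  next
    case 5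
    define m where "m = n - 2"
    have m: "n = m + 2" "i - 2 \<le> m" "j \<le> m" using 5 Cons.prems by (simp_all add: m_def)
    from j m(1) have "valid_cups is (m + 2)" by simp
    from Cons.IH[OF this m(2)] obtain N js where *: "valid_cups js m"
      "\<And>q::'a. q \<noteq> 0 \<Longrightarrow>
        row_cap q (i - 2) (cups_vector q is) = (\<lambda>c. (q + inverse q) ^ N * cups_vector q js c)"
      by blast
    show ?thesis
    proof (intro exI conjI allI impI)
      show "valid_cups (j # js) n" using * m by simp
      show "row_cap q i (cups_vector q (j # is)) =
          (\<lambda>c. (q + inverse q) ^ N * cups_vector q (j # js) c)" if "q \<noteq> 0" for q :: 'a
        using * that 5 by (simp add: row_cap_cup_far_left row_cup_scale)
    qed
  qed
qed simp

section \<open>Words in cups and caps\<close>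

datatype move = Row_cup nat | Row_cap nat

fun valid_moves :: "move list \<Rightarrow> nat \<Rightarrow> nat \<Rightarrow> bool" where
  "valid_moves [] m n \<longleftrightarrow> n = m"
| "valid_moves (Row_cup i # ms) m n \<longleftrightarrow> i \<le> m \<and> valid_moves ms (m + 2) n"
| "valid_moves (Row_cap i # ms) m n \<longleftrightarrow> i + 2 \<le> m \<and> valid_moves ms (m - 2) n"

fun move_op :: "'a::field \<Rightarrow> move \<Rightarrow> (config \<Rightarrow> 'a) \<Rightarrow> config \<Rightarrow> 'a" where
  "move_op q (Row_cup i) = row_cup q i"
| "move_op q (Row_cap i) = row_cap q i"

lemma move_op_scale: "move_op q m (\<lambda>c. a * f c) = (\<lambda>c. a * move_op q m f c)"
  by (cases m) (auto simp: row_cup_scale row_cap_scale)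

lemma fold_move_op_scale:
  "fold (move_op q) ms (\<lambda>c. a * f c) = (\<lambda>c. a * fold (move_op q) ms f c)"
  by (induction ms arbitrary: f) (auto simp: move_op_scale)

lemma valid_moves_append:
  "valid_moves (ms @ ms') m n \<longleftrightarrow> (\<exists>k. valid_moves ms m k \<and> valid_moves ms' k n)"
  by (induction ms m n rule: valid_moves.induct) auto

lemma moves_cups_vector:
  assumes "valid_moves ms m n" "valid_cups is m"
  shows "\<exists>N js. valid_cups js n \<and> (\<forall>q::'a::field. q \<noteq> 0 \<longrightarrow>
    fold (move_op q) ms (cups_vector q is) = (\<lambda>c. (q + inverse q) ^ N * cups_vector q js c))"
  using assms
proof (induction ms m n arbitrary: "is" rule: valid_moves.induct)
  case (1 m n)
  then show ?case by (intro exI[of _ 0] exI[of _ "is"]) auto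
next
  case (2 i ms m n)
  from 2(2,3) 2(1)[of "i # is"] show ?case by simp
next
  case (3 i ms m n)
  define k where "k = m - 2"
  have k: "m = k + 2" using 3(2) by (auto simp: k_def)
  from 3(2,3) k cap_cups_vector[of "is" k i] obtain N js where 1: "valid_cups js k"
    "\<forall>q::'a. q \<noteq> 0 \<longrightarrow>
      row_cap q i (cups_vector q is) = (\<lambda>c. (q + inverse q) ^ N * cups_vector q js c)" by auto
  from 3(1)[of js] 3(2) 1 k obtain M ks where 2: "valid_cups ks n" "\<forall>q::'a. q \<noteq> 0 \<longrightarrow>
      fold (move_op q) ms (cups_vector q js) = (\<lambda>c. (q + inverse q) ^ M * cups_vector q ks c)"
    by auto
  show ?case
    by (rule exI[of _ "N + M"], rule exI[of _ ks])
       (use 1 2 in \<open>auto simp: fold_move_op_scale power_add mult.assoc\<close>)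
qed

lemma closed_moves:
  assumes "valid_moves ms 0 0"
  shows "\<exists>N. \<forall>q::'a::field. q \<noteq> 0 \<longrightarrow> fold (move_op q) ms (\<lambda>c. 1) = (\<lambda>c. (q + inverse q) ^ N)"
proof -
  from moves_cups_vector[OF assms, of "[]"] obtain N js where
    *: "valid_cups js 0" "\<forall>q::'a. q \<noteq> 0 \<longrightarrow>
      fold (move_op q) ms (\<lambda>c. 1) = (\<lambda>c. (q + inverse q) ^ N * cups_vector q js c)" by auto
  from *(1) have "js = []" by (cases js) auto
  with *(2) show ?thesis by auto
qed

section \<open>States of a diagram\<close>

text \<open>
  Positions on a side are counted from the axis. On the left this reverses their order along the
  cutting line; on the right a configuration \<open>r\<close> stands for its pointwise negation. With these
  conventions one formula serves for both sides.
\<close>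

definition side_cup :: "'a::field \<Rightarrow> nat \<Rightarrow> (config \<Rightarrow> 'a) \<Rightarrow> config \<Rightarrow> 'a" where
  "side_cup q i g l = cup_weight q (l (Suc i)) (l i) * g (del i l)"

definition side_cap :: "'a::field \<Rightarrow> nat \<Rightarrow> (config \<Rightarrow> 'a) \<Rightarrow> config \<Rightarrow> 'a" where
  "side_cap q i g l = inverse q * g (ins i True False l) + g (ins i False True l)"

fun event_op :: "ratfun \<Rightarrow> event \<Rightarrow> (config \<Rightarrow> ratfun) \<Rightarrow> config \<Rightarrow> ratfun" where
  "event_op q Idle g = g"
| "event_op q (Cup i) g = side_cup q i g"
| "event_op q (Cap i) g = side_cap q i g"
| "event_op q (Turn i) g = side_cup q i (side_cap q i g)"
| "event_op q (Cross i x) g =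
     (\<lambda>l. coeff_idle x * g l + coeff_turn x * side_cup q i (side_cap q i g) l)"

definition axis_cup :: "'a::field \<Rightarrow> (config \<Rightarrow> config \<Rightarrow> 'a) \<Rightarrow> config \<Rightarrow> config \<Rightarrow> 'a" where
  "axis_cup q F l r = cup_weight q (l 0) (\<not> r 0) * F (l \<circ> Suc) (r \<circ> Suc)"

definition axis_cap :: "'a::field \<Rightarrow> (config \<Rightarrow> config \<Rightarrow> 'a) \<Rightarrow> config \<Rightarrow> config \<Rightarrow> 'a" where
  "axis_cap q F l r =
     inverse q * F (case_nat False l) (case_nat False r) + F (case_nat True l) (case_nat True r)"

text \<open>The last two values are irrelevant: those layers never occur when states are evaluated.\<close>

fun layer_op :: "ratfun \<Rightarrow> layer \<Rightarrow> (config \<Rightarrow> config \<Rightarrow> ratfun) \<Rightarrow> config \<Rightarrow> config \<Rightarrow> ratfun" where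
  "layer_op q (Off e f) F = (\<lambda>l r. event_op q e (\<lambda>l'. event_op q f (F l') r) l)"
| "layer_op q Ax_cup F = axis_cup q F"
| "layer_op q Ax_cap F = axis_cap q F"
| "layer_op q Ax_turn F = axis_cup q (axis_cap q F)"
| "layer_op q (Ax_pass s) F = (\<lambda>l r. 0)"
| "layer_op q (Ax_cross x) F = (\<lambda>l r. 0)"

definition state :: "ratfun \<Rightarrow> diagram \<Rightarrow> config \<Rightarrow> config \<Rightarrow> ratfun" where
  "state q D = fold (layer_op q) D (\<lambda>l r. 1)"

lemma state_Nil [simp]: "state q [] = (\<lambda>l r. 1)"
  by (simp add: state_def)

lemma state_append [simp]: "state q (D @ E) = fold (layer_op q) E (state q D)"
  by (simp add: state_def)

section \<open>Widths of initial pieces of a diagram\<close>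

definition fits :: "diagram \<Rightarrow> bool" where
  "fits D \<longleftrightarrow> (\<forall>k<length D. layer_fits (D ! k) (width D k))"

definition top_width :: "diagram \<Rightarrow> side \<Rightarrow> nat" where
  "top_width D = width D (length D)"

lemma width_append: "k \<le> length D \<Longrightarrow> width (D @ E) k = width D k"
  by (simp add: width_def)

lemma fits_Nil [simp]: "fits []"
  by (simp add: fits_def)

lemma fits_snoc: "fits (D @ [x]) \<longleftrightarrow> fits D \<and> layer_fits x (top_width D)"
  by (auto simp: fits_def top_width_def nth_append less_Suc_eq width_append)

lemma top_width_Nil [simp]: "top_width [] s = 0"
  by (simp add: top_width_def width_def)

lemma top_width_snoc: "top_width (D @ [x]) = layer_width x (top_width D)"
  by (simp add: top_width_def width_def)

lemma link_diagram_iff: "link_diagram D \<longleftrightarrow> fits D \<and> (\<forall>s. top_width D s = 0)"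
  by (simp add: link_diagram_def fits_def top_width_def)

definition plain :: "layer \<Rightarrow> bool" where
  "plain x \<longleftrightarrow> layer_crossings x = 0 \<and> (\<forall>s. x \<noteq> Ax_pass s)"

text \<open>The configuration of a whole cutting line, read from left to right.\<close>

definition join :: "nat \<Rightarrow> config \<Rightarrow> config \<Rightarrow> config" where
  "join a l r j = (if j < a then l (a - 1 - j) else \<not> r (j - a))"

section \<open>Events on one side or on the axis as moves on a whole cutting line\<close>

lemma del_join_left:
  assumes "i \<le> a"
  shows "del (a - i) (join (a + 2) l r) = join a (del i l) r"
proof
  fix j
  obtain e where a: "a = i + e" using assms by (auto simp: le_iff_add)
  consider d where "e = Suc (j + d)" | d g where "j = e + d" "i = Suc (d + g)" | d where "j = a + d"
    by (metis a add.commute add_less_cancel_left le_iff_add less_iff_Suc_add not_less)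
  then show "del (a - i) (join (a + 2) l r) j = join a (del i l) r j"
    by cases (simp_all add: a del_def join_def)
qed

lemma join_ins_left:
  assumes "i + 2 \<le> a"
  shows "join a (ins i x y l) r = ins (a - i - 2) y x (join (a - 2) l r)"
proof
  fix j
  obtain e where a: "a = i + 2 + e" using assms by (metis le_iff_add)
  consider d where "e = Suc (j + d)" | "j = e" | "j = Suc e"
    | d g where "j = e + 2 + d" "i = Suc (d + g)" | d where "j = a + d"
  proof -
    consider "j < e" | "j = e" | "j = Suc e" | "e + 2 \<le> j" "j < a" | "a \<le> j" by linarith
    then show ?thesis
    proof cases
      case 1
      then show ?thesis using that(1) by (auto simp: less_iff_Suc_add)
    next
      case 4
      then obtain d where d: "j = e + 2 + d" by (metis le_iff_add)
      with 4 a have "d < i" by simp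
      with d show ?thesis using that(4) by (auto simp: less_iff_Suc_add)
    next
      case 5
      then show ?thesis using that(5) by (auto simp: le_iff_add)
    qed (use that in auto)
  qed
  then show "join a (ins i x y l) r j = ins (a - i - 2) y x (join (a - 2) l r) j"
    by cases (simp_all add: a ins_def join_def)
qed

lemma del_join_right: "del (a + i) (join a l r) = join a l (del i r)"
proof
  fix j
  consider "j < a" | d where "j = a + d" by (metis le_iff_add not_less)
  then show "del (a + i) (join a l r) j = join a l (del i r) j"
    by cases (simp_all add: del_def join_def)
qed

lemma join_ins_right: "join a l (ins i x y r) = ins (a + i) (\<not> x) (\<not> y) (join a l r)"
proof
  fix j
  consider "j < a" | d where "j = a + d" by (metis le_iff_add not_less)
  then show "join a l (ins i x y r) j = ins (a + i) (\<not> x) (\<not> y) (join a l r) j"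
    by cases (auto simp add: ins_def join_def)
qed

lemma del_join_axis: "del a (join (Suc a) l r) = join a (l \<circ> Suc) (r \<circ> Suc)"
proof
  fix j
  consider d where "a = Suc (j + d)" | d where "j = a + d"
    by (metis le_iff_add less_iff_Suc_add not_less)
  then show "del a (join (Suc a) l r) j = join a (l \<circ> Suc) (r \<circ> Suc) j"
    by cases (simp_all add: del_def join_def)
qed

lemma join_ins_axis:
  "join (Suc a) (case_nat x l) (case_nat y r) = ins a x (\<not> y) (join a l r)"
proof
  fix j
  show "join (Suc a) (case_nat x l) (case_nat y r) j = ins a x (\<not> y) (join a l r) j"
  proof (cases "j < a")
    case True
    then obtain d where "a = Suc (j + d)" by (metis less_iff_Suc_add)
    then show ?thesis by (simp add: join_def ins_def)
  next
    case False
    then obtain d where "j = a + d" by (metis le_Suc_ex not_less)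
    then show ?thesis by (cases d; cases "d - 1") (auto simp: join_def ins_def)
  qed
qed

lemma side_cup_left:
  "i \<le> a \<Longrightarrow> side_cup q i (\<lambda>l. f (join a l r)) = (\<lambda>l. row_cup q (a - i) f (join (a + 2) l r))"
  by (rule ext)
     (auto simp: side_cup_def row_cup_def del_join_left[symmetric],
      simp add: join_def Suc_diff_le less_Suc_eq_le le_SucI)

lemma side_cap_left:
  "i + 2 \<le> a \<Longrightarrow>
    side_cap q i (\<lambda>l. f (join a l r)) = (\<lambda>l. row_cap q (a - i - 2) f (join (a - 2) l r))"
  by (rule ext) (simp add: side_cap_def row_cap_def join_ins_left)

lemma side_cup_right:
  "side_cup q i (\<lambda>r. f (join a l r)) = (\<lambda>r. row_cup q (a + i) f (join a l r))"
  by (rule ext)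
     (simp add: side_cup_def row_cup_def del_join_right, simp add: join_def cup_weight_def)

lemma side_cap_right:
  "side_cap q i (\<lambda>r. f (join a l r)) = (\<lambda>r. row_cap q (a + i) f (join a l r))"
  by (rule ext) (simp add: side_cap_def row_cap_def join_ins_right)

lemma axis_cup_row:
  "axis_cup q (\<lambda>l r. f (join a l r)) = (\<lambda>l r. row_cup q a f (join (Suc a) l r))"
  by (intro ext) (simp add: axis_cup_def row_cup_def del_join_axis, simp add: join_def)

lemma axis_cap_row:
  "axis_cap q (\<lambda>l r. f (join (Suc a) l r)) = (\<lambda>l r. row_cap q a f (join a l r))"
  by (intro ext) (simp add: axis_cap_def row_cap_def join_ins_axis)

text \<open>The left half is an initial segment of the line, read backwards. So the moves sit at
  positions counted from \<open>a\<close>, and one word serves for every width \<open>b\<close> of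
  the right half.\<close>

lemma event_op_left:
  assumes "event_fits e a" "event_crossings e = 0"
  shows "\<exists>ms. (\<forall>b. valid_moves ms (a + b) (event_width e a + b)) \<and>
    (\<forall>q f r. event_op q e (\<lambda>l. f (join a l r)) =
      (\<lambda>l. fold (move_op q) ms f (join (event_width e a) l r)))"
proof (cases e)
  case Idle
  then show ?thesis by (intro exI[of _ "[]"]) simp
next
  case (Cup i)
  then show ?thesis using assms
    by (intro exI[of _ "[Row_cup (a - i)]"]) (auto simp: side_cup_left)
next
  case (Cap i)
  then show ?thesis using assms
    by (intro exI[of _ "[Row_cap (a - i - 2)]"]) (simp add: side_cap_left, arith)
next
  case (Turn i)
  then obtain d where a: "a = i + 2 + d" using assms by (auto simp: le_iff_add)
  have "side_cup q i (side_cap q i (\<lambda>l. f (join (Suc (Suc (i + d))) l r))) =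
      (\<lambda>l. row_cup q d (row_cap q d f) (join (Suc (Suc (i + d))) l r))"
    for q :: ratfun and f :: "config \<Rightarrow> ratfun" and r
    using side_cap_left[of i a q f r] side_cup_left[of i "i + d" q "row_cap q d f" r]
    by (simp add: a)
  then show ?thesis
    by (intro exI[of _ "[Row_cap d, Row_cup d]"]) (auto simp: a Turn)
qed (use assms in auto)

lemma event_op_right:
  assumes "event_fits e b" "event_crossings e = 0"
  shows "\<exists>ms. valid_moves ms (a + b) (a + event_width e b) \<and>
    (\<forall>q f l. event_op q e (\<lambda>r. f (join a l r)) = (\<lambda>r. fold (move_op q) ms f (join a l r)))"
proof (cases e)
  case Idle
  then show ?thesis by (intro exI[of _ "[]"]) simp
next
  case (Cup i)
  then show ?thesis using assms
    by (intro exI[of _ "[Row_cup (a + i)]"]) (simp add: side_cup_right)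
next
  case (Cap i)
  then show ?thesis using assms
    by (intro exI[of _ "[Row_cap (a + i)]"]) (simp add: side_cap_right)
next
  case (Turn i)
  then show ?thesis using assms
    by (intro exI[of _ "[Row_cap (a + i), Row_cup (a + i)]"]) (auto simp: side_cap_right side_cup_right)
qed (use assms in auto)

lemma layer_op_row:
  assumes "layer_fits x w" "plain x"
  shows "\<exists>ms. valid_moves ms (w Lft + w Rgt) (layer_width x w Lft + layer_width x w Rgt) \<and>
    (\<forall>q f. layer_op q x (\<lambda>l r. f (join (w Lft) l r)) =
      (\<lambda>l r. fold (move_op q) ms f (join (layer_width x w Lft) l r)))"
proof (cases x)
  case (Off e f)
  then obtain ms ms' where
    "\<forall>b. valid_moves ms (w Lft + b) (event_width e (w Lft) + b)"
    "\<forall>q f r. event_op q e (\<lambda>l. f (join (w Lft) l r)) =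
      (\<lambda>l. fold (move_op q) ms f (join (event_width e (w Lft)) l r))"
    "valid_moves ms' (w Lft + w Rgt) (w Lft + event_width f (w Rgt))"
    "\<forall>q g l. event_op q f (\<lambda>r. g (join (w Lft) l r)) =
      (\<lambda>r. fold (move_op q) ms' g (join (w Lft) l r))"
    using assms event_op_left[of e "w Lft"] event_op_right[of f "w Rgt" "w Lft"]
    by (auto simp: plain_def)
  then show ?thesis using Off
    by (intro exI[of _ "ms' @ ms"]) (auto simp: valid_moves_append)
next
  case Ax_cup
  then show ?thesis by (intro exI[of _ "[Row_cup (w Lft)]"]) (simp add: axis_cup_row)
next
  case Ax_cap
  then obtain a b where "w Lft = Suc a" "w Rgt = Suc b" using assms by (auto simp: gr0_conv_Suc)
  then show ?thesis using Ax_cap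
    by (intro exI[of _ "[Row_cap a]"]) (simp add: axis_cap_row)
next
  case Ax_turn
  then obtain a b where "w Lft = Suc a" "w Rgt = Suc b" using assms by (auto simp: gr0_conv_Suc)
  then show ?thesis using Ax_turn
    by (intro exI[of _ "[Row_cap a, Row_cup a]"]) (simp add: axis_cap_row axis_cup_row)
qed (use assms in \<open>auto simp: plain_def\<close>)

lemma state_row:
  assumes "fits D" "\<forall>x\<in>set D. plain x"
  shows "\<exists>ms. valid_moves ms 0 (top_width D Lft + top_width D Rgt) \<and>
    (\<forall>q. state q D = (\<lambda>l r. fold (move_op q) ms (\<lambda>c. 1) (join (top_width D Lft) l r)))"
  using assms
proof (induction D rule: rev_induct)
  case Nil
  show ?case by (intro exI[of _ "[]"]) simp
next
  case (snoc x D)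
  then obtain ms where ms: "valid_moves ms 0 (top_width D Lft + top_width D Rgt)"
    "\<forall>q. state q D = (\<lambda>l r. fold (move_op q) ms (\<lambda>c. 1) (join (top_width D Lft) l r))"
    by (auto simp: fits_snoc)
  from snoc.prems layer_op_row[of x "top_width D"] obtain ms' where
    "valid_moves ms' (top_width D Lft + top_width D Rgt)
       (layer_width x (top_width D) Lft + layer_width x (top_width D) Rgt)"
    "\<forall>q f. layer_op q x (\<lambda>l r. f (join (top_width D Lft) l r)) =
      (\<lambda>l r. fold (move_op q) ms' f (join (layer_width x (top_width D) Lft) l r))"
    by (auto simp: fits_snoc)
  with ms show ?case
    by (intro exI[of _ "ms @ ms'"]) (auto simp: valid_moves_append top_width_snoc)
qed

lemma closed_state:
  assumes "link_diagram D" "\<forall>x\<in>set D. plain x"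
  shows "\<exists>N. \<forall>q. q \<noteq> 0 \<longrightarrow> state q D = (\<lambda>l r. (q + inverse q) ^ N)"
proof -
  obtain ms where "valid_moves ms 0 0"
    "\<forall>q. state q D = (\<lambda>l r. fold (move_op q) ms (\<lambda>c. 1) (join 0 l r))"
    using state_row[of D] assms by (auto simp: link_diagram_iff)
  with closed_moves[of ms, where 'a=ratfun] show ?thesis by auto
qed

section \<open>Laurent polynomials\<close>

lemma var_A_nonzero [simp]: "var_A \<noteq> 0"
  by (simp add: var_A_def Zero_fract_def eq_fract)

lemma var_B_nonzero [simp]: "var_B \<noteq> 0"
  by (simp add: var_B_def Zero_fract_def eq_fract)

lemma var_A_power: "var_A ^ n = Fract [:monom 1 n:] 1"
proof (induction n)
  case (Suc n)
  have "[:[:0, 1:]:] * [:monom 1 n:] = [:monom (1::int) (Suc n):]"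
    by (simp add: monom_Suc)
  then show ?case using Suc by (simp add: var_A_def mult.commute)
qed (simp add: One_fract_def flip: one_pCons)

lemma var_B_power: "var_B ^ n = Fract (monom 1 n) 1"
  by (induction n) (simp_all add: One_fract_def var_B_def monom_Suc mult.commute)

lemma one_plus_A4: "1 + var_A ^ 4 \<noteq> 0"
proof
  assume "1 + var_A ^ 4 = 0"
  then have "1 + [:monom (1::int) 4:] = 0"
    by (simp add: var_A_power One_fract_def Zero_fract_def eq_fract)
  then have "coeff (coeff (1 + [:monom (1::int) 4:]) 0) 0 = 0" by simp
  then show False by simp
qed

lemma one_plus_B4: "1 + var_B ^ 4 \<noteq> 0"
proof
  assume "1 + var_B ^ 4 = 0"
  then have "1 + monom (1::int poly) 4 = 0"
    by (simp add: var_B_power One_fract_def Zero_fract_def eq_fract)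
  then have "coeff (1 + monom (1::int poly) 4) 0 = 0" by simp
  then show False by simp
qed

text \<open>The loop value \<open>circle_A\<close> up to sign and a power of \<open>A\<close>. Its
  powers grade the lattice below.\<close>

definition eta :: ratfun where
  "eta = 1 + var_A ^ 4"

lemma eta_nonzero [simp]: "eta \<noteq> 0"
  using one_plus_A4 by (simp add: eta_def)

lemma circle_A_eq: "circle_A = - eta / var_A ^ 2"
  by (simp add: circle_A_def eta_def field_simps flip: power_add)

lemma circle_B_eq: "circle_B = - (1 + var_B ^ 4) / var_B ^ 2"
  by (simp add: circle_B_def field_simps flip: power_add)

lemma circle_A_nonzero [simp]: "circle_A \<noteq> 0"
  by (simp add: circle_A_eq)

lemma circle_B_nonzero [simp]: "circle_B \<noteq> 0"
  using one_plus_B4 by (simp add: circle_B_eq)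

lemma var_s_eq: "var_s = inverse (var_B ^ 4)"
  by (simp add: var_s_def sqrt_s_def power_int_minus power_inverse flip: power_mult)

lemma var_t_eq: "var_t = inverse (var_A ^ 4)"
  by (simp add: var_t_def sqrt_t_def power_int_minus power_inverse flip: power_mult)

lemma laurent_monom: "of_int a * var_s powi i * var_t powi j \<in> laurent_polys"
  unfolding laurent_polys_def
  by (rule CollectI, rule exI[of _ "{(i, j)}"], rule exI[of _ "\<lambda>_ _. a"]) simp

lemma laurent_add:
  assumes "x \<in> laurent_polys" "y \<in> laurent_polys"
  shows "x + y \<in> laurent_polys"
proof -
  obtain S c where S: "finite S" "x = (\<Sum>(i, j)\<in>S. of_int (c i j) * var_s powi i * var_t powi j)"
    using assms(1) unfolding laurent_polys_def by blast
  obtain S' c' where S': "finite S'"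
    "y = (\<Sum>(i, j)\<in>S'. of_int (c' i j) * var_s powi i * var_t powi j)"
    using assms(2) unfolding laurent_polys_def by blast
  define d where "d = (\<lambda>i j. if (i, j) \<in> S then c i j else 0)"
  define d' where "d' = (\<lambda>i j. if (i, j) \<in> S' then c' i j else 0)"
  have "x = (\<Sum>(i, j)\<in>S \<union> S'. of_int (d i j) * var_s powi i * var_t powi j)"
    unfolding S(2) using S(1) S'(1)
    by (intro sum.mono_neutral_cong_left) (auto simp: d_def)
  moreover have "y = (\<Sum>(i, j)\<in>S \<union> S'. of_int (d' i j) * var_s powi i * var_t powi j)"
    unfolding S'(2) using S(1) S'(1)
    by (intro sum.mono_neutral_cong_left) (auto simp: d'_def)
  ultimately have "x + y =
      (\<Sum>(i, j)\<in>S \<union> S'. of_int (d i j + d' i j) * var_s powi i * var_t powi j)"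
    by (simp add: sum.distrib[symmetric] split_def algebra_simps)
  then show ?thesis
    unfolding laurent_polys_def using S(1) S'(1)
    by (intro CollectI exI[of _ "S \<union> S'"] exI[of _ "\<lambda>i j. d i j + d' i j"]) auto
qed

lemma laurent_0: "0 \<in> laurent_polys"
  using laurent_monom[of 0 0 0] by simp

lemma laurent_sum: "(\<And>x. x \<in> S \<Longrightarrow> f x \<in> laurent_polys) \<Longrightarrow> sum f S \<in> laurent_polys"
  by (induction S rule: infinite_finite_induct) (auto intro: laurent_0 laurent_add)

lemma laurent_mult:
  assumes "x \<in> laurent_polys" "y \<in> laurent_polys"
  shows "x * y \<in> laurent_polys"
proof -
  obtain S c where S: "finite S" "x = (\<Sum>(i, j)\<in>S. of_int (c i j) * var_s powi i * var_t powi j)"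
    using assms(1) unfolding laurent_polys_def by blast
  obtain S' c' where S': "finite S'"
    "y = (\<Sum>(i, j)\<in>S'. of_int (c' i j) * var_s powi i * var_t powi j)"
    using assms(2) unfolding laurent_polys_def by blast
  have [simp]: "var_s \<noteq> 0" "var_t \<noteq> 0" by (simp_all add: var_s_eq var_t_eq)
  have "(of_int a * var_s powi i * var_t powi j) * (of_int b * var_s powi k * var_t powi l) =
      of_int (a * b) * var_s powi (i + k) * var_t powi (j + l)" for a b i j k l
    by (simp add: power_int_add)
  then have "(of_int a * var_s powi i * var_t powi j) * (of_int b * var_s powi k * var_t powi l)
      \<in> laurent_polys" for a b i j k l
    by (metis laurent_monom)
  then show ?thesis
    unfolding S(2) S'(2) by (auto simp: sum_product split_def intro!: laurent_sum)
qed

lemma laurent_const: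
  "1 \<in> laurent_polys" "-1 \<in> laurent_polys" "numeral n \<in> laurent_polys"
  using laurent_monom[of 1 0 0] laurent_monom[of "-1" 0 0] laurent_monom[of "numeral n" 0 0]
  by simp_all

lemma laurent_uminus: "x \<in> laurent_polys \<Longrightarrow> - x \<in> laurent_polys"
  using laurent_mult[OF laurent_const(2), of x] by simp

lemma laurent_diff: "x \<in> laurent_polys \<Longrightarrow> y \<in> laurent_polys \<Longrightarrow> x - y \<in> laurent_polys"
  using laurent_add[of x "- y"] laurent_uminus[of y] by simp

lemma laurent_vars:
  "var_A ^ 4 \<in> laurent_polys" "inverse (var_A ^ 4) \<in> laurent_polys"
  "var_B ^ 4 \<in> laurent_polys" "inverse (var_B ^ 4) \<in> laurent_polys"
  using laurent_monom[of 1 0 "-1"] laurent_monom[of 1 0 1] laurent_monom[of 1 "-1" 0]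
    laurent_monom[of 1 1 0]
  by (simp_all add: var_s_eq var_t_eq power_int_minus)

lemmas laurent_intros = laurent_0 laurent_const laurent_vars laurent_add laurent_mult
  laurent_uminus laurent_diff

section \<open>The fermionic lattice\<close>

text \<open>
  The four normally ordered words in one fermionic mode: identity, creation operator, annihilation
  operator and their product.
\<close>

datatype mode = Vac | Cre | Ann | Num

definition odd_mode :: "mode \<Rightarrow> bool" where
  "odd_mode p \<longleftrightarrow> p = Cre \<or> p = Ann"

definition sgn_of :: "bool \<Rightarrow> ratfun" where
  "sgn_of s = (if s then -1 else 1)"

text \<open>A weight \<open>A^(2 i)\<close> at position \<open>i\<close>, reduced modulo the units
  \<open>A^4\<close> of the Laurent polynomials; hence only the parity of the position
  enters.\<close>

definition grade :: "bool \<Rightarrow> ratfun" where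
  "grade j = (if j then var_A ^ 2 else 1)"

type_synonym vector = "config \<Rightarrow> config \<Rightarrow> ratfun"

definition slice :: "bool \<Rightarrow> bool \<Rightarrow> vector \<Rightarrow> vector" where
  "slice a b F = (\<lambda>l r. F (case_nat a l) (case_nat b r))"

text \<open>
  \<open>F l r\<close> is the matrix entry in row \<open>l\<close> and column \<open>r\<close>. \<open>part s j p F\<close> is the coefficient of the word \<open>p\<close>
  in the mode next to the axis, an operator in the remaining modes, divided by the weight of \<open>p\<close>. The
  Jordan-Wigner sign \<open>s\<close> is the parity of the odd words met so far, and \<open>j\<close> is the parity of the
  position.
\<close>

fun part :: "bool \<Rightarrow> bool \<Rightarrow> mode \<Rightarrow> vector \<Rightarrow> vector" where
  "part s j Vac F = slice False False F"
| "part s j Cre F = (\<lambda>l r. inverse (grade j * eta) * slice True False F l r)"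
| "part s j Ann F = (\<lambda>l r. - inverse (grade j * var_A ^ 2) * slice False True F l r)"
| "part s j Num F = (\<lambda>l r. inverse eta *
     (- sgn_of s * inverse (var_A ^ 2) * slice True True F l r - slice False False F l r))"

fun lat :: "nat \<Rightarrow> bool \<Rightarrow> bool \<Rightarrow> vector \<Rightarrow> bool" where
  "lat 0 s j F \<longleftrightarrow> (\<forall>l r. F l r \<in> laurent_polys \<and> (s \<longrightarrow> F l r = 0))"
| "lat (Suc w) s j F \<longleftrightarrow> (\<forall>p. lat w (s \<noteq> odd_mode p) (\<not> j) (part s j p F))"

lemma part_add: "part s j p (\<lambda>l r. F l r + G l r) = (\<lambda>l r. part s j p F l r + part s j p G l r)"
  by (cases p) (auto simp: slice_def algebra_simps)

lemma part_scale: "part s j p (\<lambda>l r. c * F l r) = (\<lambda>l r. c * part s j p F l r)"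
  by (cases p) (auto simp: slice_def algebra_simps)

lemma lat_add: "lat w s j F \<Longrightarrow> lat w s j G \<Longrightarrow> lat w s j (\<lambda>l r. F l r + G l r)"
  by (induction w arbitrary: s j F G) (auto simp: part_add intro: laurent_add)

lemma lat_scale: "c \<in> laurent_polys \<Longrightarrow> lat w s j F \<Longrightarrow> lat w s j (\<lambda>l r. c * F l r)"
  by (induction w arbitrary: s j F) (auto simp: part_scale intro: laurent_mult)

lemma lat_0: "lat w s j (\<lambda>l r. 0)"
proof (induction w arbitrary: s j)
  case (Suc w)
  have "part s j p (\<lambda>l r. 0) = (\<lambda>l r. 0)" for p by (cases p) (auto simp: slice_def)
  with Suc show ?case by simp
qed (auto intro: laurent_0)

text \<open>Shifting the positions by one multiplies the coefficient of a monomial with \<open>d\<close> odd modes by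
  \<open>A\<^bsup>2d\<^esup>\<close>, and the parity of \<open>d\<close> is determined by the sign.\<close>

lemma lat_shift: "lat w s j F \<Longrightarrow> lat w s (\<not> j) (\<lambda>l r. grade s * F l r)"
proof (induction w arbitrary: s j F)
  case 0
  then show ?case by (cases s) (auto simp: grade_def intro: laurent_0)
next
  case (Suc w)
  have "lat w (s \<noteq> odd_mode p) j (\<lambda>l r. grade s * part s (\<not> j) p F l r)" for p
  proof -
    from Suc have IH: "lat w (s \<noteq> odd_mode p) j
        (\<lambda>l r. grade (s \<noteq> odd_mode p) * part s j p F l r)" by fastforce
    \<comment> \<open>The quotient of the weights for the two parities; it is \<open>1\<close>,
      \<open>A^4\<close> or the inverse of \<open>A^4\<close>.\<close>
    define c where "c = (if odd_mode p then grade s * grade j / (grade (\<not> s) * grade (\<not> j)) else 1)"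
    have "c \<in> laurent_polys"
      by (cases s; cases j)
         (auto simp: c_def grade_def laurent_intros inverse_eq_divide[symmetric] simp flip: power_add)
    from lat_scale[OF this IH]
    have "lat w (s \<noteq> odd_mode p) j (\<lambda>l r. c * (grade (s \<noteq> odd_mode p) * part s j p F l r))" .
    moreover have "c * (grade (s \<noteq> odd_mode p) * part s j p F l r) = grade s * part s (\<not> j) p F l r"
      for l r
      by (cases p; cases s; cases j) (simp_all add: c_def odd_mode_def grade_def field_simps)
    ultimately show ?thesis by simp
  qed
  then show ?case by (simp add: part_scale)
qed

lemma del_0_case_nat [simp]: "del 0 (case_nat a (case_nat b l)) = l"
  by (auto simp: del_def)

lemma ins_0: "ins 0 a b l = case_nat a (case_nat b l)"
  by (auto simp: ins_def fun_eq_iff split: nat.split)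

lemma del_Suc_case_nat [simp]: "del (Suc i) (case_nat a l) = case_nat a (del i l)"
  by (auto simp: del_def fun_eq_iff split: nat.split)

lemma ins_Suc_case_nat [simp]: "ins (Suc i) a b (case_nat c l) = case_nat c (ins i a b l)"
proof
  fix j
  show "ins (Suc i) a b (case_nat c l) j = case_nat c (ins i a b l) j"
  proof (cases j)
    case (Suc k)
    then show ?thesis
      by (cases "k < i"; cases "k = i"; cases "k = Suc i"; cases k; cases "k - 1")
         (auto simp: ins_def)
  qed (simp add: ins_def)
qed

section \<open>Symmetric events next to the axis\<close>

abbreviation "q0 \<equiv> - (var_A ^ 2) :: ratfun"

definition crossing_pair :: "over \<Rightarrow> nat \<Rightarrow> layer" where
  "crossing_pair x i = Off (Cross i x) (Cross i (opposite x))"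

definition parts :: "bool \<Rightarrow> bool \<Rightarrow> mode \<Rightarrow> mode \<Rightarrow> vector \<Rightarrow> vector" where
  "parts s j p p' F = part (s \<noteq> odd_mode p) (\<not> j) p' (part s j p F)"

definition side_turn :: "ratfun \<Rightarrow> (config \<Rightarrow> ratfun) \<Rightarrow> config \<Rightarrow> ratfun" where
  "side_turn q g = side_cup q 0 (side_cap q 0 g)"

lemma event_cross_0: "event_op q (Cross 0 x) g = (\<lambda>l. coeff_idle x * g l + coeff_turn x * side_turn q g l)"
  by (simp add: side_turn_def)

lemma side_turn_scale: "side_turn q (\<lambda>l. a * g l + b * h l) = (\<lambda>l. a * side_turn q g l + b * side_turn q h l)"
  by (rule ext) (simp add: side_turn_def side_cup_def side_cap_def algebra_simps)

text \<open>The idle coefficients of a crossing and its mirror image are inverse to each other, and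
  so are the turn coefficients. Thus only even powers of \<open>A\<close> remain.\<close>

lemma crossing_pair_eq:
  fixes F :: vector
  defines "L \<equiv> \<lambda>l r. side_turn q0 (\<lambda>l'. F l' r) l" and "R \<equiv> \<lambda>l r. side_turn q0 (F l) r"
    and "LR \<equiv> \<lambda>l r. side_turn q0 (\<lambda>l'. side_turn q0 (F l') r) l"
  shows "layer_op q0 (crossing_pair Asc 0) F l r =
      F l r + LR l r + inverse (var_A ^ 2) * L l r + var_A ^ 2 * R l r"
    "layer_op q0 (crossing_pair Desc 0) F l r =
      F l r + LR l r + var_A ^ 2 * L l r + inverse (var_A ^ 2) * R l r"
  unfolding crossing_pair_def layer_op.simps event_cross_0 side_turn_scale assms
  by (simp_all add: distrib_left mult.assoc[symmetric] power2_eq_square inverse_mult_distrib add_ac)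

lemma side_turn_case_nat:
  "side_turn q0 g (case_nat a (case_nat b l)) = (if a = b then 0 else if a
    then - inverse (var_A ^ 2) * g (case_nat True (case_nat False l)) + g (case_nat False (case_nat True l))
    else g (case_nat True (case_nat False l)) - var_A ^ 2 * g (case_nat False (case_nat True l)))"
  by (simp add: side_turn_def side_cup_def side_cap_def ins_0 cup_weight_def field_simps)

definition eta_inv :: ratfun where
  "eta_inv = inverse eta"

definition sq_A :: ratfun where
  "sq_A = var_A ^ 2"

definition sq_A_inv :: ratfun where
  "sq_A_inv = inverse sq_A"

lemma fold_powers:
  "var_A ^ 2 = sq_A" "var_A ^ 4 = sq_A * sq_A" "inverse sq_A = sq_A_inv" "inverse eta = eta_inv"
  "circle_A = - sq_A - sq_A_inv" "inverse circle_A = - (eta_inv * sq_A)"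
proof -
  show "inverse circle_A = - (eta_inv * sq_A)"
    unfolding circle_A_eq by (simp add: sq_A_def eta_inv_def divide_inverse)
qed (simp_all add: sq_A_def sq_A_inv_def eta_inv_def circle_A_def flip: power_add)

text \<open>Rewriting to normal form in the ring generated by \<open>A\<^sup>2\<close>, \<open>A\<^sup>-\<^sup>2\<close> and \<open>(1 + A\<^sup>4)\<^sup>-\<^sup>1\<close>. The
  rules rely on the alphabetic order of the names of these constants in ordered rewriting.\<close>

lemma normal_form:
  "sq_A * sq_A_inv = 1" "eta_inv * (sq_A * sq_A) = 1 - eta_inv"
  "eta_inv * sq_A_inv = sq_A_inv - eta_inv * sq_A" "sq_A * (sq_A_inv * x) = x"
  "eta_inv * (sq_A * (sq_A * x)) = x - eta_inv * x"
  "eta_inv * (sq_A_inv * x) = sq_A_inv * x - eta_inv * (sq_A * x)"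
proof -
  show 1: "sq_A * sq_A_inv = 1" by (simp add: sq_A_def sq_A_inv_def)
  have "eta_inv * (1 + sq_A * sq_A) = 1" by (simp add: eta_inv_def flip: eta_def fold_powers)
  then show 2: "eta_inv * (sq_A * sq_A) = 1 - eta_inv" by (simp add: algebra_simps eq_diff_eq)
  have "eta_inv * sq_A_inv = sq_A_inv * (eta_inv * (1 + sq_A * sq_A)) - eta_inv * sq_A * (sq_A * sq_A_inv)"
    by (simp add: algebra_simps)
  then show 3: "eta_inv * sq_A_inv = sq_A_inv - eta_inv * sq_A"
    using \<open>eta_inv * (1 + sq_A * sq_A) = 1\<close> 1 by simp
  show "sq_A * (sq_A_inv * x) = x" "eta_inv * (sq_A * (sq_A * x)) = x - eta_inv * x"
    "eta_inv * (sq_A_inv * x) = sq_A_inv * x - eta_inv * (sq_A * x)"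
    using arg_cong[OF 1, of "\<lambda>z. z * x"] arg_cong[OF 2, of "\<lambda>z. z * x"]
      arg_cong[OF 3, of "\<lambda>z. z * x"]
    by (simp_all add: left_diff_distrib mult.assoc)
qed

lemmas crossing_simps = parts_def sgn_of_def grade_def odd_mode_def slice_def crossing_pair_eq
  side_turn_case_nat

lemmas crossing_norm = fold_powers normal_form side_turn_case_nat[unfolded fold_powers]
  slice_def grade_def sgn_of_def odd_mode_def

text \<open>A pair of crossings mixes only words with the same difference between the numbers of
  creation and annihilation operators. Once the weights are divided out, the mixing coefficients are
  Laurent polynomials in \<open>A^4\<close>, since \<open>k\<close> is \<open>1\<close> or
  \<open>A^4\<close>; this is why the lattice is preserved. The next lemma is the same table for the
  other type of crossing.\<close>

lemma crossing_parts_Asc: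
  fixes s j F l r
  defines "Z \<equiv> \<lambda>p p'. parts s j p p' F l r"
    and "Y \<equiv> \<lambda>p p'. parts s j p p' (layer_op q0 (crossing_pair Asc 0) F) l r"
    and "T \<equiv> var_A ^ 4" and "T' \<equiv> inverse (var_A ^ 4)"
    and "k \<equiv> (grade j)\<^sup>2" and "k' \<equiv> inverse ((grade j)\<^sup>2)" and "\<sigma> \<equiv> sgn_of s"
  shows
    "Y Vac Vac = Z Vac Vac"
    "Y Vac Cre = T' * k * Z Cre Vac"
    "Y Vac Ann = (1 - T) * Z Vac Ann + k * Z Ann Vac"
    "Y Vac Num = \<sigma> * (1 - T) * Z Cre Ann + Z Num Vac"
    "Y Cre Vac = k' * Z Vac Cre + (1 - T') * Z Cre Vac"
    "Y Cre Cre = Z Cre Cre"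
    "Y Cre Ann = \<sigma> * (T' - 1) * Z Vac Num + Z Ann Cre + (2 - T - T') * Z Cre Ann + \<sigma> * (1 - T') * Z Num Vac"
    "Y Cre Num = (1 - T) * Z Cre Num + (T' - 1) * Z Cre Vac + (- T * k') * Z Num Cre + (- k') * Z Vac Cre"
    "Y Ann Vac = T * k' * Z Vac Ann"
    "Y Ann Cre = Z Cre Ann"
    "Y Ann Ann = Z Ann Ann"
    "Y Ann Num = (- k') * Z Num Ann + (- k') * Z Vac Ann"
    "Y Num Vac = Z Vac Num + \<sigma> * (T - 1) * Z Cre Ann"
    "Y Num Cre = (- k) * Z Cre Num + (- T' * k) * Z Cre Vac"
    "Y Num Ann = (- T' * k) * Z Ann Num + (- T' * k) * Z Ann Vac + (1 - T') * Z Num Ann + (1 - T') * Z Vac Ann"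
    "Y Num Num = Z Num Num"
  unfolding assms crossing_simps
  by (cases s; cases j; simp add: crossing_norm power2_eq_square[of sq_A] algebra_simps)+

lemma crossing_parts_Desc:
  fixes s j F l r
  defines "Z \<equiv> \<lambda>p p'. parts s j p p' F l r"
    and "Y \<equiv> \<lambda>p p'. parts s j p p' (layer_op q0 (crossing_pair Desc 0) F) l r"
    and "T \<equiv> var_A ^ 4" and "T' \<equiv> inverse (var_A ^ 4)"
    and "k \<equiv> (grade j)\<^sup>2" and "k' \<equiv> inverse ((grade j)\<^sup>2)" and "\<sigma> \<equiv> sgn_of s"
  shows
    "Y Vac Vac = Z Vac Vac"
    "Y Vac Cre = (1 - T) * Z Vac Cre + k * Z Cre Vac"
    "Y Vac Ann = T' * k * Z Ann Vac"
    "Y Vac Num = \<sigma> * (1 - T) * Z Ann Cre + Z Num Vac"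
    "Y Cre Vac = T * k' * Z Vac Cre"
    "Y Cre Cre = Z Cre Cre"
    "Y Cre Ann = Z Ann Cre"
    "Y Cre Num = (- k') * Z Num Cre + (- k') * Z Vac Cre"
    "Y Ann Vac = k' * Z Vac Ann + (1 - T') * Z Ann Vac"
    "Y Ann Cre = \<sigma> * (T' - 1) * Z Vac Num + (2 - T - T') * Z Ann Cre + Z Cre Ann + \<sigma> * (1 - T') * Z Num Vac"
    "Y Ann Ann = Z Ann Ann"
    "Y Ann Num = (1 - T) * Z Ann Num + (T' - 1) * Z Ann Vac + (- T * k') * Z Num Ann + (- k') * Z Vac Ann"
    "Y Num Vac = Z Vac Num + \<sigma> * (T - 1) * Z Ann Cre"
    "Y Num Cre = (- T' * k) * Z Cre Num + (- T' * k) * Z Cre Vac + (1 - T') * Z Num Cre + (1 - T') * Z Vac Cre"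
    "Y Num Ann = (- k) * Z Ann Num + (- T' * k) * Z Ann Vac"
    "Y Num Num = Z Num Num"
  unfolding assms crossing_simps
  by (cases s; cases j; simp add: crossing_norm power2_eq_square[of sq_A] algebra_simps)+

lemma lat_cong: "(\<And>l r. F l r = G l r) \<Longrightarrow> lat w s j G \<Longrightarrow> lat w s j F"
  by (metis ext)

lemma lat_Suc_Suc:
  "lat (Suc (Suc w)) s j F \<longleftrightarrow>
    (\<forall>p p'. lat w (s \<noteq> (odd_mode p \<noteq> odd_mode p')) j (parts s j p p' F))"
proof -
  have "((s \<noteq> odd_mode p) \<noteq> odd_mode p') = (s \<noteq> (odd_mode p \<noteq> odd_mode p'))" for p p'
    by auto
  then show ?thesis by (simp only: lat.simps parts_def not_not)
qed

lemma laurent_coeffs: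
  "(grade j)\<^sup>2 \<in> laurent_polys" "inverse ((grade j)\<^sup>2) \<in> laurent_polys" "sgn_of s \<in> laurent_polys"
  by (auto simp: grade_def sgn_of_def laurent_intros)

lemma lat_crossing_0:
  assumes "lat (Suc (Suc w)) s j F"
  shows "lat (Suc (Suc w)) s j (layer_op q0 (crossing_pair x 0) F)"
proof -
  have even: "lat w s j (parts s j p p' F)" if "odd_mode p = odd_mode p'" for p p'
    using spec[OF spec[OF assms[unfolded lat_Suc_Suc], of p], of p'] that by simp
  have odd: "lat w (\<not> s) j (parts s j p p' F)" if "odd_mode p \<noteq> odd_mode p'" for p p'
    using spec[OF spec[OF assms[unfolded lat_Suc_Suc], of p], of p'] that by simp
  have "lat w (s \<noteq> (odd_mode p \<noteq> odd_mode p')) j (parts s j p p' (layer_op q0 (crossing_pair x 0) F))"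
    for p p'
    by (cases x; cases p; cases p'; simp add: odd_mode_def; rule lat_cong,
        (rule crossing_parts_Asc crossing_parts_Desc),
        (intro lat_add lat_scale even odd laurent_intros laurent_coeffs; simp add: odd_mode_def))
  then show ?thesis unfolding lat_Suc_Suc by blast
qed

text \<open>A pair of cups is an operator of rank one on two modes. This is its expansion after
  multiplication by the loop value, which makes all coefficients integral; words of odd total parity
  do not occur.\<close>

fun cup_coeff :: "bool \<Rightarrow> mode \<Rightarrow> mode \<Rightarrow> ratfun" where
  "cup_coeff s Num Vac = sgn_of s * inverse (var_A ^ 4)"
| "cup_coeff s Vac Num = sgn_of s"
| "cup_coeff s Num Num = - (sgn_of s * inverse (var_A ^ 4))"
| "cup_coeff s Cre Ann = - inverse (var_A ^ 4)"
| "cup_coeff s Ann Cre = - inverse (var_A ^ 4)"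
| "cup_coeff s _ _ = 0"

lemma cup_parts:
  "parts s j p p' (\<lambda>l r. circle_A * layer_op q0 (Off (Cup 0) (Cup 0)) F l r) =
     (\<lambda>l r. cup_coeff s p p' * F l r)"
proof (intro ext)
  fix l r
  show "parts s j p p' (\<lambda>l r. circle_A * layer_op q0 (Off (Cup 0) (Cup 0)) F l r) l r =
     cup_coeff s p p' * F l r"
    by (cases p; cases p'; cases s; cases j; simp add: parts_def slice_def side_cup_def cup_weight_def
        sgn_of_def grade_def odd_mode_def fold_powers normal_form algebra_simps)
qed

lemma lat_cup_0:
  assumes "lat w s j F"
  shows "lat (Suc (Suc w)) s j (\<lambda>l r. circle_A * layer_op q0 (Off (Cup 0) (Cup 0)) F l r)"
proof -
  have "lat w (s \<noteq> (odd_mode p \<noteq> odd_mode p')) j (\<lambda>l r. cup_coeff s p p' * F l r)" for p p'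
  proof (cases "odd_mode p = odd_mode p'")
    case True
    have "cup_coeff s p p' \<in> laurent_polys"
      by (cases p; cases p'; simp add: laurent_intros laurent_coeffs)
    from lat_scale[OF this assms] True show ?thesis by simp
  next
    case False
    then have "cup_coeff s p p' = 0" by (cases p; cases p'; simp add: odd_mode_def)
    then show ?thesis by (simp add: lat_0)
  qed
  then show ?thesis unfolding lat_Suc_Suc cup_parts by blast
qed

text \<open>Contracting two modes kills the words of odd total parity, and from the other words a
  loop value splits off. This factor gained at a pair of caps compensates the one lost at a pair of
  cups.\<close>

lemma cap_parts:
  fixes s j F l r
  defines "Z \<equiv> \<lambda>p p'. parts s j p p' F l r"
  shows "inverse circle_A * layer_op q0 (Off (Cap 0) (Cap 0)) F l r =
    sgn_of s * Z Num Vac + sgn_of s * var_A ^ 4 * Z Vac Num + (- (var_A ^ 4)) * Z Cre Ann +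
      (- (var_A ^ 4)) * Z Ann Cre + sgn_of s * Z Vac Vac"
proof -
  show ?thesis
    unfolding assms fold_powers(6)
    by (cases s; cases j; simp add: parts_def slice_def side_cap_def ins_0 sgn_of_def grade_def
        odd_mode_def fold_powers normal_form algebra_simps)
qed

lemma lat_cap_0:
  assumes "lat (Suc (Suc w)) s j F"
  shows "lat w s j (\<lambda>l r. inverse circle_A * layer_op q0 (Off (Cap 0) (Cap 0)) F l r)"
proof -
  have even: "lat w s j (parts s j p p' F)" if "odd_mode p = odd_mode p'" for p p'
    using spec[OF spec[OF assms[unfolded lat_Suc_Suc], of p], of p'] that by simp
  show ?thesis
    by (rule lat_cong, rule cap_parts[where s = s and j = j], intro lat_add lat_scale even laurent_intros laurent_coeffs)
       (simp_all add: odd_mode_def)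
qed

text \<open>On the new mode the cup is the diagonal matrix with entries \<open>1\<close> and
  \<open>-A^2\<close>. When no odd word precedes, the word \<open>Vac\<close> is normalised to be
  exactly this matrix, so the cup costs no factor. The other modes move outwards by one
  position.\<close>

lemma lat_axis_cup:
  assumes "lat w False False F"
  shows "lat (Suc w) False False (axis_cup q0 F)"
proof -
  have "part False False p (axis_cup q0 F) = (if p = Vac then F else (\<lambda>l r. 0))" for p
    by (cases p) (auto simp: fun_eq_iff slice_def axis_cup_def cup_weight_def sgn_of_def o_def)
  moreover have "lat w False True F"
    using lat_shift[OF assms] by (simp add: grade_def)
  ultimately show ?thesis by (auto simp: odd_mode_def lat_0)
qed

text \<open>The cap is a twisted trace over the innermost mode: odd words have trace zero, while
  \<open>Vac\<close> and \<open>Num\<close> contribute \<open>circle_A\<close> times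
  \<open>1\<close> and \<open>A^4\<close>.\<close>

lemma lat_axis_cap:
  assumes "lat (Suc w) False False F"
  shows "lat w False False (\<lambda>l r. inverse circle_A * axis_cap q0 F l r)"
proof -
  have P: "lat w False True (part False False p F)" if "\<not> odd_mode p" for p
    using assms that by (auto dest!: spec[of _ p])
  have "lat w False True (\<lambda>l r. part False False Vac F l r + var_A ^ 4 * part False False Num F l r)"
    by (intro lat_add lat_scale laurent_intros P) (simp_all add: odd_mode_def)
  from lat_shift[OF this]
  have *: "lat w False False (\<lambda>l r. part False False Vac F l r + var_A ^ 4 * part False False Num F l r)"
    by (simp add: grade_def)
  have "inverse circle_A * axis_cap q0 F l r =
      part False False Vac F l r + var_A ^ 4 * part False False Num F l r" for l r
    unfolding fold_powers(6) by (simp add: slice_def axis_cap_def sgn_of_def fold_powers normal_form algebra_simps)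
  with * show ?thesis by simp
qed

section \<open>Symmetric events away from the axis\<close>

fun shift_event :: "event \<Rightarrow> event" where
  "shift_event Idle = Idle"
| "shift_event (Cup i) = Cup (Suc i)"
| "shift_event (Cap i) = Cap (Suc i)"
| "shift_event (Turn i) = Turn (Suc i)"
| "shift_event (Cross i x) = Cross (Suc i) x"

lemma event_op_linear:
  "event_op q e (\<lambda>l. a * g l + b * h l) = (\<lambda>l. a * event_op q e g l + b * event_op q e h l)"
  by (cases e) (auto simp: side_cup_def side_cap_def algebra_simps)

lemma layer_op_linear:
  "layer_op q (Off e f) (\<lambda>l r. a * F l r + b * G l r) =
    (\<lambda>l r. a * layer_op q (Off e f) F l r + b * layer_op q (Off e f) G l r)"
  by (simp add: event_op_linear)

lemma event_op_shift: "event_op q (shift_event e) g (case_nat a l) = event_op q e (\<lambda>l. g (case_nat a l)) l"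
  by (cases e) (auto simp: side_cup_def side_cap_def)

lemma slice_shift:
  "slice a b (layer_op q (Off (shift_event e) (shift_event f)) F) = layer_op q (Off e f) (slice a b F)"
  by (intro ext) (simp add: slice_def event_op_shift)

lemma part_shift:
  "part s j p (layer_op q (Off (shift_event e) (shift_event f)) F) = layer_op q (Off e f) (part s j p F)"
proof -
  have scale: "layer_op q (Off e f) (\<lambda>l r. a * G l r) = (\<lambda>l r. a * layer_op q (Off e f) G l r)" for a G
    using layer_op_linear[of q e f a G 0 G] by simp
  have diff: "layer_op q (Off e f) (\<lambda>l r. a * G l r - H l r) =
      (\<lambda>l r. a * layer_op q (Off e f) G l r - layer_op q (Off e f) H l r)" for a G H
    using layer_op_linear[of q e f a G "-1" H] by simp
  show ?thesis
    by (cases p; simp only: part.simps slice_shift scale diff)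
qed

text \<open>An event away from the innermost mode commutes with \<open>part\<close>. Peeling off
  that mode flips the position parity and may flip the sign, so the hypothesis is required for all
  \<open>s\<close> and \<open>j\<close>.\<close>

lemma lat_shift_event:
  assumes "\<And>s j F. lat w s j F \<Longrightarrow> lat w' s j (\<lambda>l r. c * layer_op q (Off e f) F l r)"
    and "lat (Suc w) s j F"
  shows "lat (Suc w') s j (\<lambda>l r. c * layer_op q (Off (shift_event e) (shift_event f)) F l r)"
  using assms by (auto simp: part_scale part_shift simp del: layer_op.simps)

lemma lat_cup:
  "i \<le> w \<Longrightarrow> lat w s j F \<Longrightarrow>
    lat (Suc (Suc w)) s j (\<lambda>l r. circle_A * layer_op q0 (Off (Cup i) (Cup i)) F l r)"
proof (induction i arbitrary: w s j F)
  case (Suc i)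
  then obtain v where w: "w = Suc v" by (cases w) auto
  from lat_shift_event[of v "Suc (Suc v)" circle_A q0 "Cup i" "Cup i" s j F] Suc w
  show ?case by simp
qed (rule lat_cup_0)

lemma lat_cap:
  "i \<le> w \<Longrightarrow> lat (Suc (Suc w)) s j F \<Longrightarrow>
    lat w s j (\<lambda>l r. inverse circle_A * layer_op q0 (Off (Cap i) (Cap i)) F l r)"
proof (induction i arbitrary: w s j F)
  case (Suc i)
  then obtain v where w: "w = Suc v" by (cases w) auto
  from lat_shift_event[of "Suc (Suc v)" v "inverse circle_A" q0 "Cap i" "Cap i" s j F] Suc w
  show ?case by simp
qed (rule lat_cap_0)

lemma lat_crossing:
  "i \<le> w \<Longrightarrow> lat (Suc (Suc w)) s j F \<Longrightarrow> lat (Suc (Suc w)) s j (layer_op q0 (crossing_pair x i) F)"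
proof (induction i arbitrary: w s j F)
  case (Suc i)
  then obtain v where w: "w = Suc v" by (cases w) auto
  from lat_shift_event[of "Suc (Suc v)" "Suc (Suc v)" 1 q0 "Cross i x" "Cross i (opposite x)" s j F] Suc w
  show ?case by (simp add: crossing_pair_def)
qed (rule lat_crossing_0)

lemma layer_op_turns:
  "layer_op q (Off (Turn i) (Turn i)) F = layer_op q (Off (Cup i) (Cup i)) (layer_op q (Off (Cap i) (Cap i)) F)"
  by (intro ext) (simp add: side_cup_def side_cap_def algebra_simps)

section \<open>The lattice along a symmetric diagram\<close>

definition symmetric_layer :: "layer \<Rightarrow> bool" where
  "symmetric_layer x \<longleftrightarrow> reflect_layer x = reverse_axis_crossing x"

lemma other_neq [simp]: "other s \<noteq> s" "s \<noteq> other s"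
  by (cases s; simp)+

lemma symmetric_layer_cases:
  assumes "symmetric_layer x"
  obtains "x = Off Idle Idle" | i where "x = Off (Cup i) (Cup i)" | i where "x = Off (Cap i) (Cap i)"
    | i where "x = Off (Turn i) (Turn i)" | i y where "x = crossing_pair y i"
    | "x = Ax_cup" | "x = Ax_cap" | "x = Ax_turn" | y where "x = Ax_cross y"
proof (cases x)
  case (Off e f)
  then have f: "f = reflect_event e" using assms by (simp add: symmetric_layer_def)
  show ?thesis
  proof (cases e)
    case Idle
    then show ?thesis using that(1) Off f by simp
  next
    case (Cup i)
    then show ?thesis using that(2) Off f by simp
  next
    case (Cap i)
    then show ?thesis using that(3) Off f by simp
  next
    case (Turn i)
    then show ?thesis using that(4) Off f by simp
  next
    case (Cross i y)
    then show ?thesis using that(5) Off f by (simp add: crossing_pair_def)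
  qed
next
  case (Ax_pass s)
  then show ?thesis using assms by (simp add: symmetric_layer_def)
qed (use that(6-9) in simp_all)

lemma layer_op_scale:
  assumes "symmetric_layer x" "\<And>y. x \<noteq> Ax_cross y"
  shows "layer_op q x (\<lambda>l r. c * F l r) = (\<lambda>l r. c * layer_op q x F l r)"
proof (cases x)
  case (Off e f)
  then show ?thesis using layer_op_linear[of q e f c F 0 F] by simp
qed (use assms in \<open>auto simp: axis_cup_def axis_cap_def fun_eq_iff algebra_simps\<close>)

text \<open>\<open>E\<close> counts the factors \<open>circle_A\<close> gained: \<open>-1\<close> at
  a pair of cups, \<open>1\<close> at a pair of caps, on the axis \<open>0\<close> at a cup and
  \<open>1\<close> at a cap. Expressed by widths and axis points it can be summed over the layers;
  for a closed diagram the total is half the number of axis points.\<close>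

lemma lat_layer:
  assumes "symmetric_layer x" "\<And>y. x \<noteq> Ax_cross y" "layer_fits x v" "v Rgt = v Lft"
    and F: "lat (v Lft) False False F"
  shows "\<exists>E :: int. 2 * E + int (layer_width x v Lft) = int (axis_points x) + int (v Lft) \<and>
    layer_width x v Rgt = layer_width x v Lft \<and>
    lat (layer_width x v Lft) False False (\<lambda>l r. circle_A powi (- E) * layer_op q0 x F l r)"
  using assms(1)
proof (cases rule: symmetric_layer_cases)
  case 1
  then show ?thesis using assms by (intro exI[of _ 0]) simp
next
  case (2 i)
  then show ?thesis using assms lat_cup[of i "v Lft"] by (intro exI[of _ "-1"]) (simp del: layer_op.simps lat.simps)
next
  case (3 i)
  then obtain w where "v Lft = Suc (Suc w)" "i \<le> w"
    using assms(3) by (auto simp: le_iff_add)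
  then show ?thesis using assms 3 lat_cap[of i w]
    by (intro exI[of _ 1]) (simp add: power_int_minus del: layer_op.simps lat.simps)
next
  case (4 i)
  then obtain w where w: "v Lft = Suc (Suc w)" "i \<le> w"
    using assms(3) by (auto simp: le_iff_add)
  from lat_cup[OF w(2) lat_cap[OF w(2) F[unfolded w]]]
  have "lat (v Lft) False False (layer_op q0 x F)"
    by (simp add: w 4 layer_op_turns layer_op_scale symmetric_layer_def del: layer_op.simps lat.simps
        flip: mult.assoc)
  then show ?thesis using 4 assms by (intro exI[of _ 0]) (simp del: layer_op.simps lat.simps)
next
  case (5 i y)
  then obtain w where w: "v Lft = Suc (Suc w)" "i \<le> w"
    using assms(3) by (auto simp: le_iff_add crossing_pair_def)
  then show ?thesis using assms 5 lat_crossing[of i w]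
    by (intro exI[of _ 0]) (auto simp: crossing_pair_def simp del: layer_op.simps lat.simps)
next
  case 6
  then show ?thesis using assms lat_axis_cup[of "v Lft" F] by (intro exI[of _ 0]) (simp del: lat.simps)
next
  case 7
  then obtain w where "v Lft = Suc w"
    using assms(3) by (auto simp: gr0_conv_Suc)
  then show ?thesis using assms 7 lat_axis_cap[of w F] by (intro exI[of _ 1]) (simp add: power_int_minus del: lat.simps)
next
  case 8
  then obtain w where w: "v Lft = Suc w"
    using assms(3) by (auto simp: gr0_conv_Suc)
  from lat_axis_cup[OF lat_axis_cap[OF F[unfolded w]]]
  have "lat (v Lft) False False (\<lambda>l r. inverse circle_A * layer_op q0 x F l r)"
    using layer_op_scale[of Ax_cup q0] by (simp add: w 8 symmetric_layer_def del: lat.simps)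
  then show ?thesis using assms 8 by (intro exI[of _ 1]) (simp add: power_int_minus del: lat.simps)
qed (use assms in auto)

lemma lat_state:
  assumes "fits D" "\<forall>x\<in>set D. symmetric_layer x \<and> (\<forall>y. x \<noteq> Ax_cross y)"
  shows "\<exists>E :: int. 2 * E + int (top_width D Lft) = int (sum_list (map axis_points D)) \<and>
    top_width D Rgt = top_width D Lft \<and>
    lat (top_width D Lft) False False (\<lambda>l r. circle_A powi (- E) * state q0 D l r)"
  using assms
proof (induction D rule: rev_induct)
  case Nil
  show ?case by (intro exI[of _ 0]) (simp add: laurent_intros)
next
  case (snoc x D)
  then obtain E where E: "2 * E + int (top_width D Lft) = int (sum_list (map axis_points D))"
    "top_width D Rgt = top_width D Lft"
    "lat (top_width D Lft) False False (\<lambda>l r. circle_A powi (- E) * state q0 D l r)"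
    by (auto simp: fits_snoc)
  from snoc.prems have x: "symmetric_layer x" "\<And>y. x \<noteq> Ax_cross y" "layer_fits x (top_width D)"
    by (auto simp: fits_snoc)
  from lat_layer[OF x E(2,3)] obtain E' where E':
    "2 * E' + int (layer_width x (top_width D) Lft) = int (axis_points x) + int (top_width D Lft)"
    "layer_width x (top_width D) Rgt = layer_width x (top_width D) Lft"
    "lat (layer_width x (top_width D) Lft) False False
      (\<lambda>l r. circle_A powi (- E') * layer_op q0 x (\<lambda>l r. circle_A powi (- E) * state q0 D l r) l r)"
    by blast
  have "circle_A powi (- E') * circle_A powi (- E) = circle_A powi (- (E + E'))"
    by (simp add: add.commute flip: power_int_add)
  with E'(3) have "lat (layer_width x (top_width D) Lft) False False
      (\<lambda>l r. circle_A powi (- (E + E')) * state q0 (D @ [x]) l r)"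
    by (simp add: layer_op_scale[OF x(1,2)] flip: mult.assoc)
  with E E' show ?case by (intro exI[of _ "E + E'"]) (simp add: top_width_snoc)
qed

section \<open>Components of the link\<close>

lemma mem_points: "(k, s, i) \<in> points D \<longleftrightarrow> k \<le> length D \<and> i < width D k s"
  by (simp add: points_def)

lemma finite_points: "finite (points D)"
proof -
  have "(UNIV :: side set) = {Lft, Rgt}"
    by (metis (full_types) UNIV_eq_I insertCI side.exhaust)
  then have "finite (UNIV :: side set)"
    by (metis finite.emptyI finite.insertI)
  moreover have "points D = (SIGMA k:{..length D}. SIGMA s:UNIV. {..<width D k s})"
    by (auto simp: points_def)
  ultimately show ?thesis by simp
qed

lemma width_Suc: "k < length D \<Longrightarrow> width D (Suc k) = layer_width (D ! k) (width D k)"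
  by (simp add: width_def take_Suc_conv_app_nth)

lemma runs_in_range:
  assumes "layer_fits x w" "runs x (s, i) (s', j)" "i < w s"
  shows "j < layer_width x w s'"
proof (cases x)
  case (Off e f)
  then show ?thesis using assms
    by (cases s; cases e; cases f) (auto split: if_splits)
qed (use assms in \<open>cases s; auto split: if_splits; cases s'; auto\<close>)+

lemma cups_in_range:
  assumes "layer_fits x w" "cups x (s, i) (s', j)"
  shows "i < layer_width x w s" "j < layer_width x w s'"
proof -
  have "i < layer_width x w s \<and> j < layer_width x w s'"
  proof (cases x)
    case (Off e f)
    then show ?thesis using assms by (cases s) auto
  qed (use assms in auto)
  then show "i < layer_width x w s" "j < layer_width x w s'" by auto
qed

lemma caps_in_range:
  assumes "layer_fits x w" "caps x (s, i) (s', j)"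
  shows "i < w s" "j < w s'"
proof -
  have "i < w s \<and> j < w s'"
  proof (cases x)
    case (Off e f)
    then show ?thesis using assms by (cases s) auto
  qed (use assms in auto)
  then show "i < w s" "j < w s'" by auto
qed

lemma adjacent_points:
  assumes "fits D" "adjacent D p q"
  shows "p \<in> points D" "q \<in> points D"
proof -
  from assms(2) have "p \<in> points D \<and> q \<in> points D"
  proof cases
    case (adjacent_run k p' q')
    obtain s i s' j where "p' = (s, i)" "q' = (s', j)" by fastforce
    then show ?thesis using adjacent_run assms(1) runs_in_range[of "D ! k" "width D k" s i s' j]
      by (auto simp: mem_points fits_def width_Suc)
  next
    case (adjacent_cup k p' q')
    obtain s i s' j where "p' = (s, i)" "q' = (s', j)" by fastforce
    then show ?thesis using adjacent_cup assms(1) cups_in_range[of "D ! k" "width D k" s i s' j]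
      by (auto simp: mem_points fits_def width_Suc)
  next
    case (adjacent_cap k p' q')
    obtain s i s' j where "p' = (s, i)" "q' = (s', j)" by fastforce
    then show ?thesis using adjacent_cap assms(1) caps_in_range[of "D ! k" "width D k" s i s' j]
      by (auto simp: mem_points fits_def)
  qed
  then show "p \<in> points D" "q \<in> points D" by auto
qed

text \<open>Every arc transports both orientations by the same rule, so their agreement is constant
  along a component.\<close>

lemma orientation_adjacent:
  assumes "fits D" "orientation D u" "orientation D v" "(symclp (adjacent D))\<^sup>*\<^sup>* p q"
  shows "(u q \<longleftrightarrow> v q) \<longleftrightarrow> (u p \<longleftrightarrow> v p)"
proof -
  have 1: "(u q \<longleftrightarrow> v q) \<longleftrightarrow> (u p \<longleftrightarrow> v p)" if "adjacent D p q" for p q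
    using that assms(2,3) by cases (auto simp: orientation_def)
  have 2: "(u q \<longleftrightarrow> v q) \<longleftrightarrow> (u p \<longleftrightarrow> v p)" if "symclp (adjacent D) p q" for p q
    using that 1[of p q] 1[of q p] unfolding symclp_def by blast
  from assms(4) show ?thesis
  proof (induction rule: rtranclp_induct)
    case (step y z)
    then show ?case using 2[of y z] by blast
  qed simp
qed

lemma equiv_joined: "equiv (points D) (joined D)"
proof (rule equivI)
  show "joined D \<subseteq> points D \<times> points D" by (auto simp: joined_def)
  show "refl_on (points D) (joined D)" by (auto simp: refl_on_def joined_def)
  have s: "symp ((symclp (adjacent D))\<^sup>*\<^sup>*)" by (simp add: symp_rtranclp)
  show "sym (joined D)" using sympD[OF s] unfolding sym_def joined_def by blast
  show "trans (joined D)" by (auto simp: trans_def joined_def)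
qed

lemma Union_components: "\<Union> (link_components D) = points D"
  unfolding link_components_def by (rule Union_quotient[OF equiv_joined])

lemma component_joined:
  assumes "C \<in> link_components D" "p \<in> C" "q \<in> C"
  shows "(symclp (adjacent D))\<^sup>*\<^sup>* p q"
proof -
  have "(p, q) \<in> joined D"
    using quotient_eq_iff[OF equiv_joined] assms unfolding link_components_def by blast
  then show ?thesis by (simp add: joined_def)
qed

lemma components_disjoint:
  "C \<in> link_components D \<Longrightarrow> C' \<in> link_components D \<Longrightarrow> p \<in> C \<Longrightarrow> p \<in> C' \<Longrightarrow> C = C'"
  using quotient_disj[OF equiv_joined] unfolding link_components_def by blast

lemma component_nonempty: "C \<in> link_components D \<Longrightarrow> C \<noteq> {}"
  unfolding link_components_def by (rule in_quotient_imp_non_empty[OF equiv_joined])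

lemma component_closed:
  assumes "fits D" "C \<in> link_components D" "adjacent D p q"
  shows "p \<in> C \<longleftrightarrow> q \<in> C"
proof -
  have "(p, q) \<in> joined D"
    using adjacent_points[OF assms(1,3)] assms(3) by (auto simp: joined_def symclp_def)
  then show ?thesis
    using assms(2) unfolding link_components_def
    by (meson equiv_joined in_quotient_imp_closed equivE symD)
qed

section \<open>Orientations, encoded by their sets of upward points\<close>

definition labelings :: "diagram \<Rightarrow> point set set" where
  "labelings D = {U. U \<subseteq> points D \<and> orientation D (\<lambda>p. p \<in> U)}"

lemma orientation_flip:
  assumes "fits D" "orientation D u" "\<And>p q. adjacent D p q \<Longrightarrow> p \<in> X \<longleftrightarrow> q \<in> X"
  shows "orientation D (\<lambda>p. u p \<noteq> (p \<in> X))"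
  unfolding orientation_def
proof (intro allI impI conjI)
  fix k p q assume k: "k < length D"
  note u = assms(2)[unfolded orientation_def, rule_format, OF k]
  note X = assms(3)[OF adjacent_run[OF k]] assms(3)[OF adjacent_cup[OF k]] assms(3)[OF adjacent_cap[OF k]]
  show "(u (Suc k, q) \<noteq> ((Suc k, q) \<in> X)) = (u (k, p) \<noteq> ((k, p) \<in> X))"
    if "runs (D ! k) p q \<and> (k, p) \<in> points D"
    using that u[of p q] X(1)[of p q] by blast
  show "(u (Suc k, q) \<noteq> ((Suc k, q) \<in> X)) = (\<not> (u (Suc k, p) \<noteq> ((Suc k, p) \<in> X)))"
    if "cups (D ! k) p q" using that u[of p q] X(2)[of p q] by blast
  show "(u (k, q) \<noteq> ((k, q) \<in> X)) = (\<not> (u (k, p) \<noteq> ((k, p) \<in> X)))"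
    if "caps (D ! k) p q" using that u[of p q] X(3)[of p q] by blast
qed

lemma orientation_cong:
  assumes "fits D" "\<And>p. p \<in> points D \<Longrightarrow> u p = v p" "orientation D u"
  shows "orientation D v"
  unfolding orientation_def
proof (intro allI impI conjI)
  fix k p q assume k: "k < length D"
  note u = assms(3)[unfolded orientation_def, rule_format, OF k]
  note X = adjacent_points[OF assms(1) adjacent_run[OF k]]
    adjacent_points[OF assms(1) adjacent_cup[OF k]] adjacent_points[OF assms(1) adjacent_cap[OF k]]
  show "v (Suc k, q) = v (k, p)" if "runs (D ! k) p q \<and> (k, p) \<in> points D"
    using that u[of p q] X(1,2)[of p q] assms(2) by metis
  show "v (Suc k, q) = (\<not> v (Suc k, p))" if "cups (D ! k) p q"
    using that u[of p q] X(3,4)[of p q] assms(2) by metis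
  show "v (k, q) = (\<not> v (k, p))" if "caps (D ! k) p q"
    using that u[of p q] X(5,6)[of p q] assms(2) by metis
qed

text \<open>An orientation may be reversed on any set of components, and two orientations differ
  exactly on a union of components. Given one of them, all correspond to the sets of
  components.\<close>

lemma card_labelings:
  assumes "fits D" "U\<^sub>0 \<in> labelings D"
  shows "card (labelings D) = 2 ^ card (link_components D)"
proof -
  define f where "f S = {p \<in> points D. (p \<in> U\<^sub>0) \<noteq> (p \<in> \<Union> S)}" for S
  have "bij_betw f (Pow (link_components D)) (labelings D)"
    unfolding bij_betw_def
  proof
    show "inj_on f (Pow (link_components D))"
    proof (rule inj_onI)
      fix S S' assume S: "S \<in> Pow (link_components D)" "S' \<in> Pow (link_components D)" and eq: "f S = f S'"
      have "p \<in> \<Union> S \<longleftrightarrow> p \<in> \<Union> S'" if "p \<in> points D" for p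
      proof -
        have "p \<in> f S \<longleftrightarrow> p \<in> f S'" using eq by simp
        with that show ?thesis unfolding f_def by blast
      qed
      then have "\<Union> S = \<Union> S'"
        using S Union_components[of D] by blast
      moreover have "S \<subseteq> S'" if S: "S \<subseteq> link_components D" "S' \<subseteq> link_components D"
        and eq: "\<Union> S = \<Union> S'" for S S'
      proof
        fix C assume C: "C \<in> S"
        then obtain p where p: "p \<in> C" using S(1) component_nonempty by blast
        then obtain C' where C': "C' \<in> S'" "p \<in> C'" using C eq by blast
        then have "C = C'" using components_disjoint[of C D C' p] C p S by blast
        with C' show "C \<in> S'" by simp
      qed
      ultimately show "S = S'" using S by (simp add: subset_antisym)
    qed
    show "f ` Pow (link_components D) = labelings D"
    proof (intro equalityI subsetI)
      fix U assume "U \<in> f ` Pow (link_components D)"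
      then obtain S where S: "S \<subseteq> link_components D" "U = f S" by auto
      have "p \<in> \<Union> S \<longleftrightarrow> q \<in> \<Union> S" if "adjacent D p q" for p q
        using that S(1) component_closed[OF assms(1)] by blast
      from orientation_flip[OF assms(1) _ this, of "\<lambda>p. p \<in> U\<^sub>0"] assms(2)
      have "orientation D (\<lambda>p. (p \<in> U\<^sub>0) \<noteq> (p \<in> \<Union> S))" by (auto simp: labelings_def)
      then have "orientation D (\<lambda>p. p \<in> f S)"
        by (rule orientation_cong[OF assms(1), rotated]) (auto simp: f_def)
      then show "U \<in> labelings D" using S by (auto simp: labelings_def f_def)
    next
      fix U assume U: "U \<in> labelings D"
      define S where "S = {C \<in> link_components D. \<exists>p\<in>C. (p \<in> U) \<noteq> (p \<in> U\<^sub>0)}"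
      have "(p \<in> \<Union> S) \<longleftrightarrow> (p \<in> U) \<noteq> (p \<in> U\<^sub>0)" if p: "p \<in> points D" for p
      proof
        assume "p \<in> \<Union> S"
        then obtain C q where C: "C \<in> link_components D" "p \<in> C" "q \<in> C" "(q \<in> U) \<noteq> (q \<in> U\<^sub>0)"
          by (auto simp: S_def)
        show "(p \<in> U) \<noteq> (p \<in> U\<^sub>0)"
          using orientation_adjacent[OF assms(1) _ _ component_joined[OF C(1-3)],
              of "\<lambda>p. p \<in> U" "\<lambda>p. p \<in> U\<^sub>0"] U assms(2) C(4) by (auto simp: labelings_def)
      next
        assume "(p \<in> U) \<noteq> (p \<in> U\<^sub>0)"
        then show "p \<in> \<Union> S" using p Union_components[of D] by (fastforce simp: S_def)
      qed
      then have "p \<in> U \<longleftrightarrow> p \<in> f S" if "p \<in> points D" for p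
        using that unfolding f_def by blast
      moreover have "U \<subseteq> points D" "f S \<subseteq> points D" using U by (auto simp: labelings_def f_def)
      ultimately have "U = f S" by blast
      then show "U \<in> f ` Pow (link_components D)" by (auto simp: S_def)
    qed
  qed
  then have "card (labelings D) = card (Pow (link_components D))"
    by (simp add: bij_betw_same_card)
  moreover have "finite (link_components D)"
    unfolding link_components_def
    by (rule finite_quotient) (use finite_points equiv_joined in \<open>auto simp: equiv_def\<close>)
  ultimately show ?thesis by (simp add: card_Pow)
qed

section \<open>Circles of a crossingless diagram\<close>

text \<open>
  For \<open>q = 1\<close> the operators \<open>event_op\<close> and \<open>layer_op\<close> sum over the configurations below that extend
  the given one to an orientation of the arcs.
\<close>

fun event_below :: "event \<Rightarrow> config \<Rightarrow> config set" where
  "event_below Idle l = {l}"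
| "event_below (Cup i) l = (if l i \<noteq> l (Suc i) then {del i l} else {})"
| "event_below (Cap i) l = {ins i True False l, ins i False True l}"
| "event_below (Turn i) l =
    (if l i \<noteq> l (Suc i) then {ins i True False (del i l), ins i False True (del i l)} else {})"
| "event_below (Cross i x) l = {}"

lemma ins_eq_iff: "ins i a b c = ins i a' b' c \<longleftrightarrow> a = a' \<and> b = b'"
  by (auto dest: fun_cong[of _ _ i] fun_cong[of _ _ "Suc i"])

lemma event_op_1:
  "event_crossings e = 0 \<Longrightarrow> event_op 1 e g l = (\<Sum>m\<in>event_below e l. g m)"
  by (cases e) (auto simp: side_cup_def side_cap_def cup_weight_def ins_eq_iff)

lemma finite_event_below: "finite (event_below e l)"
  by (cases e) auto

definition event_compatible :: "event \<Rightarrow> nat \<Rightarrow> config \<Rightarrow> config \<Rightarrow> bool" where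
  "event_compatible e n a b \<longleftrightarrow>
    (\<forall>i j. i < n \<longrightarrow> event_runs e i j \<longrightarrow> (b j \<longleftrightarrow> a i)) \<and>
    (\<forall>i. e = Cup i \<or> e = Turn i \<longrightarrow> (b (Suc i) \<longleftrightarrow> \<not> b i)) \<and>
    (\<forall>i. e = Cap i \<or> e = Turn i \<longrightarrow> (a (Suc i) \<longleftrightarrow> \<not> a i))"

lemma eq_ins_iff:
  assumes "i + 2 \<le> n"
  shows "(\<forall>k<n. a k = ins i x y c k) \<longleftrightarrow>
    a i = x \<and> a (Suc i) = y \<and> (\<forall>k<i. a k = c k) \<and> (\<forall>k. i + 2 \<le> k \<and> k < n \<longrightarrow> a k = c (k - 2))"
  (is "?L \<longleftrightarrow> ?R")
proof
  assume ?L
  with assms show ?R by (auto simp: ins_less ins_greater)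
next
  assume R: ?R
  show ?L
  proof (intro allI impI)
    fix k assume "k < n"
    consider "k < i" | "k = i" | "k = Suc i" | "i + 2 \<le> k" by linarith
    then show "a k = ins i x y c k"
      by cases (use R \<open>k < n\<close> in \<open>simp_all add: ins_less ins_greater\<close>)
  qed
qed

lemma event_compatible_iff:
  assumes "event_fits e n" "event_crossings e = 0"
  shows "event_compatible e n a b \<longleftrightarrow> (\<exists>m\<in>event_below e b. \<forall>i<n. a i = m i)"
proof (cases e)
  case Idle
  then show ?thesis by (auto simp: event_compatible_def)
next
  case (Cup i)
  then show ?thesis using assms by (auto simp: event_compatible_def del_def)
next
  case (Cap i)
  have "(\<forall>k j. k < n \<longrightarrow> event_runs (Cap i) k j \<longrightarrow> (b j \<longleftrightarrow> a k)) \<longleftrightarrow>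
      (\<forall>k<i. a k = b k) \<and> (\<forall>k. i + 2 \<le> k \<and> k < n \<longrightarrow> a k = b (k - 2))"
    using assms Cap by auto
  moreover have "(\<exists>m\<in>event_below e b. \<forall>i<n. a i = m i) \<longleftrightarrow>
      (\<forall>k<n. a k = ins i True False b k) \<or> (\<forall>k<n. a k = ins i False True b k)"
    by (simp add: Cap)
  ultimately show ?thesis using assms Cap
    by (auto simp: event_compatible_def eq_ins_iff)
next
  case (Turn i)
  have "(\<forall>k j. k < n \<longrightarrow> event_runs (Turn i) k j \<longrightarrow> (b j \<longleftrightarrow> a k)) \<longleftrightarrow>
      (\<forall>k<i. a k = del i b k) \<and> (\<forall>k. i + 2 \<le> k \<and> k < n \<longrightarrow> a k = del i b (k - 2))"
  proof -
    have "del i b k = b k" if "k < i" for k using that by (simp add: del_def)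
    moreover have "del i b (k - 2) = b k" if "i + 2 \<le> k" for k
      using that by (auto simp: del_def le_iff_add)
    ultimately show ?thesis using assms Turn
      by (auto simp: less_Suc_eq not_less_eq_eq) (metis Suc_leI le_neq_implies_less not_less add_2_eq_Suc')+
  qed
  moreover have "(\<exists>m\<in>event_below e b. \<forall>i<n. a i = m i) \<longleftrightarrow> b i \<noteq> b (Suc i) \<and>
      ((\<forall>k<n. a k = ins i True False (del i b) k) \<or> (\<forall>k<n. a k = ins i False True (del i b) k))"
    by (simp add: Turn)
  ultimately show ?thesis using assms Turn
    by (auto simp: event_compatible_def eq_ins_iff)
qed (use assms in auto)

lemma event_below_unique:
  assumes "event_fits e n" "m \<in> event_below e b" "m' \<in> event_below e b" "\<forall>i<n. m i = m' i"
  shows "m = m'"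
proof (cases e)
  case (Cap i)
  then have "m i = m' i" using assms by simp
  then show ?thesis using assms(2,3) Cap by auto
next
  case (Turn i)
  then have "m i = m' i" using assms by simp
  then show ?thesis using assms(2,3) Turn by (auto split: if_splits)
qed (use assms in \<open>auto split: if_splits\<close>)

fun layer_below :: "layer \<Rightarrow> config \<Rightarrow> config \<Rightarrow> (config \<times> config) set" where
  "layer_below (Off e f) l r = event_below e l \<times> event_below f r"
| "layer_below Ax_cup l r = (if l 0 = r 0 then {(l \<circ> Suc, r \<circ> Suc)} else {})"
| "layer_below Ax_cap l r = (\<lambda>b. (case_nat b l, case_nat b r)) ` UNIV"
| "layer_below Ax_turn l r =
    (if l 0 = r 0 then (\<lambda>b. (case_nat b (l \<circ> Suc), case_nat b (r \<circ> Suc))) ` UNIV else {})"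
| "layer_below _ l r = {}"

lemma case_nat_inject: "inj (\<lambda>b. (case_nat b l, case_nat b r))"
  by (rule injI) (metis Pair_inject old.nat.simps(4))

lemma layer_op_1:
  assumes "plain x"
  shows "layer_op 1 x F l r = (\<Sum>(l', r')\<in>layer_below x l r. F l' r')"
proof (cases x)
  case (Off e f)
  then show ?thesis using assms
    by (simp add: plain_def event_op_1 sum.cartesian_product)
next
  case Ax_cap
  then show ?thesis
    by (simp only: layer_below.simps layer_op.simps sum.reindex[OF case_nat_inject])
       (simp add: axis_cap_def UNIV_bool)
next
  case Ax_turn
  then show ?thesis
    by (cases "l 0 = r 0"; simp only: layer_below.simps layer_op.simps simp_thms if_True if_False
          sum.reindex[OF case_nat_inject])
       (simp_all add: axis_cup_def axis_cap_def cup_weight_def UNIV_bool)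
qed (use assms in \<open>auto simp: plain_def axis_cup_def cup_weight_def\<close>)

lemma finite_layer_below: "finite (layer_below x l r)"
  by (cases x) (auto simp: finite_event_below)

definition compatible :: "layer \<Rightarrow> (side \<Rightarrow> nat) \<Rightarrow> (pos \<Rightarrow> bool) \<Rightarrow> (pos \<Rightarrow> bool) \<Rightarrow> bool" where
  "compatible x w a b \<longleftrightarrow> (\<forall>p q.
     (runs x p q \<and> snd p < w (fst p) \<longrightarrow> (b q \<longleftrightarrow> a p)) \<and>
     (cups x p q \<longrightarrow> (b q \<longleftrightarrow> \<not> b p)) \<and> (caps x p q \<longrightarrow> (a q \<longleftrightarrow> \<not> a p)))"

text \<open>Configurations are infinite, cutting lines finite: only entries below the width are
  compared. The negation on the right is the convention made for states.\<close>

definition agrees :: "(side \<Rightarrow> nat) \<Rightarrow> (pos \<Rightarrow> bool) \<Rightarrow> config \<Rightarrow> config \<Rightarrow> bool" where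
  "agrees w a l r \<longleftrightarrow> (\<forall>i<w Lft. a (Lft, i) = l i) \<and> (\<forall>i<w Rgt. (\<not> a (Rgt, i)) = r i)"

lemma Bex_Times: "(\<exists>(x, y)\<in>A \<times> B. P x \<and> Q y) \<longleftrightarrow> (\<exists>x\<in>A. P x) \<and> (\<exists>y\<in>B. Q y)"
  by auto

lemma all_pos: "(\<forall>p::pos. P p) \<longleftrightarrow> (\<forall>i. P (Lft, i)) \<and> (\<forall>i. P (Rgt, i))"
  by (metis side.exhaust surj_pair)

lemma compatible_Off:
  "compatible (Off e f) w a b \<longleftrightarrow>
    event_compatible e (w Lft) (\<lambda>i. a (Lft, i)) (\<lambda>i. b (Lft, i)) \<and>
    event_compatible f (w Rgt) (\<lambda>i. \<not> a (Rgt, i)) (\<lambda>i. \<not> b (Rgt, i))"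
  unfolding compatible_def event_compatible_def all_pos by auto

lemma event_compatible_cong:
  assumes "event_fits e n" "\<forall>i<event_width e n. b i = b' i"
  shows "event_compatible e n a b \<longleftrightarrow> event_compatible e n a b'"
proof -
  have "j < event_width e n" if "event_runs e i j" "i < n" for i j
    using that assms(1) by (cases e) (auto split: if_splits)
  then have runs: "b j = b' j" if "event_runs e i j" "i < n" for i j
    using that assms(2) by blast
  have "Suc i < event_width e n" if "e = Cup i \<or> e = Turn i" for i
    using that assms(1) by auto
  then have cups: "b i = b' i \<and> b (Suc i) = b' (Suc i)" if "e = Cup i \<or> e = Turn i" for i
    using that assms(2) by (simp add: Suc_lessD)
  have "(\<forall>i j. i < n \<longrightarrow> event_runs e i j \<longrightarrow> (b j \<longleftrightarrow> a i)) \<longleftrightarrow>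
      (\<forall>i j. i < n \<longrightarrow> event_runs e i j \<longrightarrow> (b' j \<longleftrightarrow> a i))"
    by (intro iff_allI imp_cong refl) (simp add: runs)
  moreover have "(\<forall>i. e = Cup i \<or> e = Turn i \<longrightarrow> (b (Suc i) \<longleftrightarrow> \<not> b i)) \<longleftrightarrow>
      (\<forall>i. e = Cup i \<or> e = Turn i \<longrightarrow> (b' (Suc i) \<longleftrightarrow> \<not> b' i))"
    by (intro iff_allI imp_cong refl) (simp add: cups)
  ultimately show ?thesis unfolding event_compatible_def by (simp only:)
qed

lemma compatible_iff:
  assumes "layer_fits x w" "plain x" "agrees (layer_width x w) b l r"
  shows "compatible x w a b \<longleftrightarrow> (\<exists>(l', r')\<in>layer_below x l r. agrees w a l' r')"
proof (cases x)
  case (Off e f)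
  have "event_compatible e (w Lft) (\<lambda>i. a (Lft, i)) (\<lambda>i. b (Lft, i)) \<longleftrightarrow>
      event_compatible e (w Lft) (\<lambda>i. a (Lft, i)) l"
    using assms Off by (intro event_compatible_cong) (auto simp: agrees_def)
  moreover have "event_compatible f (w Rgt) (\<lambda>i. \<not> a (Rgt, i)) (\<lambda>i. \<not> b (Rgt, i)) \<longleftrightarrow>
      event_compatible f (w Rgt) (\<lambda>i. \<not> a (Rgt, i)) r"
    using assms Off by (intro event_compatible_cong) (auto simp: agrees_def)
  moreover have "event_compatible e (w Lft) (\<lambda>i. a (Lft, i)) l \<longleftrightarrow>
      (\<exists>l'\<in>event_below e l. \<forall>i<w Lft. a (Lft, i) = l' i)"
    using assms Off by (intro event_compatible_iff) (auto simp: plain_def)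
  moreover have "event_compatible f (w Rgt) (\<lambda>i. \<not> a (Rgt, i)) r \<longleftrightarrow>
      (\<exists>r'\<in>event_below f r. \<forall>i<w Rgt. (\<not> a (Rgt, i)) = r' i)"
    using assms Off by (intro event_compatible_iff) (auto simp: plain_def)
  ultimately have "compatible x w a b \<longleftrightarrow> (\<exists>l'\<in>event_below e l. \<forall>i<w Lft. a (Lft, i) = l' i) \<and>
      (\<exists>r'\<in>event_below f r. \<forall>i<w Rgt. (\<not> a (Rgt, i)) = r' i)"
    by (simp only: Off compatible_Off)
  then show ?thesis unfolding Off layer_below.simps agrees_def Bex_Times .
next
  case Ax_cup
  then show ?thesis using assms(3)
    unfolding compatible_def all_pos by (auto simp: agrees_def)
next
  case Ax_cap
  then obtain m n where w: "w Lft = Suc m" "w Rgt = Suc n"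
    using assms(1) by (auto simp: gr0_conv_Suc)
  have "compatible x w a b \<longleftrightarrow> (\<forall>i<m. b (Lft, i) = a (Lft, Suc i)) \<and>
      (\<forall>i<n. b (Rgt, i) = a (Rgt, Suc i)) \<and> (\<not> a (Rgt, 0)) = a (Lft, 0)"
    unfolding compatible_def all_pos by (simp add: Ax_cap w) blast
  also have "\<dots> \<longleftrightarrow> (\<forall>i<m. a (Lft, Suc i) = l i) \<and>
      (\<forall>i<n. (\<not> a (Rgt, Suc i)) = r i) \<and> (\<not> a (Rgt, 0)) = a (Lft, 0)"
  proof -
    have "b (Lft, i) = l i" if "i < m" for i
      using assms(3) that by (simp add: Ax_cap w agrees_def)
    moreover have "b (Rgt, i) \<longleftrightarrow> \<not> r i" if "i < n" for i
      using assms(3) that by (auto simp add: Ax_cap w agrees_def)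
    ultimately show ?thesis by auto
  qed
  also have "\<dots> \<longleftrightarrow> (\<exists>(l', r')\<in>layer_below x l r. agrees w a l' r')"
    by (simp add: Ax_cap w agrees_def All_less_Suc2 bex_UNIV ex_bool_eq) blast
  finally show ?thesis .
next
  case Ax_turn
  then obtain m n where w: "w Lft = Suc m" "w Rgt = Suc n"
    using assms(1) by (auto simp: gr0_conv_Suc)
  have b: "b (Lft, 0) = l 0" "(\<not> b (Rgt, 0)) = r 0"
    using assms(3) by (auto simp: agrees_def w Ax_turn)
  have "compatible x w a b \<longleftrightarrow> (\<forall>i<m. b (Lft, Suc i) = a (Lft, Suc i)) \<and>
      (\<forall>i<n. b (Rgt, Suc i) = a (Rgt, Suc i)) \<and> (\<not> a (Rgt, 0)) = a (Lft, 0) \<and>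
      (\<not> b (Rgt, 0)) = b (Lft, 0)"
    unfolding compatible_def all_pos by (simp add: Ax_turn w gr0_conv_Suc) blast
  also have "\<dots> \<longleftrightarrow> (\<forall>i<m. a (Lft, Suc i) = l (Suc i)) \<and>
      (\<forall>i<n. (\<not> a (Rgt, Suc i)) = r (Suc i)) \<and> (\<not> a (Rgt, 0)) = a (Lft, 0) \<and> l 0 = r 0"
  proof -
    have "b (Lft, Suc i) = l (Suc i)" if "i < m" for i
      using assms(3) that by (simp add: Ax_turn w agrees_def)
    moreover have "b (Rgt, Suc i) \<longleftrightarrow> \<not> r (Suc i)" if "i < n" for i
      using assms(3) that by (auto simp add: Ax_turn w agrees_def)
    ultimately show ?thesis using b by auto
  qed
  also have "\<dots> \<longleftrightarrow> (\<exists>(l', r')\<in>layer_below x l r. agrees w a l' r')"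
    by (simp add: Ax_turn w agrees_def All_less_Suc2 bex_UNIV ex_bool_eq) blast
  finally show ?thesis .
qed (use assms in \<open>auto simp: plain_def\<close>)

text \<open>Two members of \<open>layer_below\<close> can differ only at inserted entries, and these
  lie within the width. So a labelling agrees with at most one of them, which makes the union in
  \<open>state_1\<close> disjoint.\<close>

lemma layer_below_unique:
  assumes "layer_fits x w" "(l, r) \<in> layer_below x l0 r0" "(l', r') \<in> layer_below x l0 r0"
    and "agrees w a l r" "agrees w a l' r'"
  shows "(l, r) = (l', r')"
proof (cases x)
  case (Off e f)
  then show ?thesis
    using assms event_below_unique[of e "w Lft" l l0 l'] event_below_unique[of f "w Rgt" r r0 r']
    by (auto simp: agrees_def)
next
  case Ax_cap
  then have "l 0 = l' 0" using assms by (auto simp: agrees_def)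
  then show ?thesis using assms(2,3) Ax_cap by auto
next
  case Ax_turn
  then have "l 0 = l' 0" using assms by (auto simp: agrees_def)
  then show ?thesis using assms(2,3) Ax_turn by (auto split: if_splits)
qed (use assms in \<open>auto split: if_splits\<close>)

section \<open>Counting orientations with prescribed values on the top line\<close>

definition top_labelings :: "diagram \<Rightarrow> config \<Rightarrow> config \<Rightarrow> point set set" where
  "top_labelings D l r = {U \<in> labelings D. agrees (top_width D) (\<lambda>p. (length D, p) \<in> U) l r}"

lemma finite_labelings: "finite (labelings D)"
  by (rule finite_subset[of _ "Pow (points D)"]) (auto simp: labelings_def finite_points)

lemma points_snoc:
  "points (D @ [x]) = points D \<union> {(Suc (length D), p) | p. snd p < top_width (D @ [x]) (fst p)}"
  by (auto simp: points_def width_append top_width_def le_Suc_eq)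

lemma orientation_snoc:
  "orientation (D @ [x]) u \<longleftrightarrow> orientation D u \<and>
    compatible x (top_width D) (\<lambda>p. u (length D, p)) (\<lambda>p. u (Suc (length D), p))"
proof -
  have "(k, p) \<in> points (D @ [x]) \<longleftrightarrow> (k, p) \<in> points D" if "k \<le> length D" for k p
    using that by (cases p) (auto simp: mem_points width_append)
  moreover have "(length D, p) \<in> points D \<longleftrightarrow> snd p < top_width D (fst p)" for p
    by (cases p) (auto simp: mem_points top_width_def)
  ultimately show ?thesis
    by (simp add: orientation_def compatible_def nth_append All_less_Suc conj_commute)
qed

text \<open>The values on the new line are forced by \<open>l\<close> and \<open>r\<close> and form
  the set \<open>V\<close>; what varies is the orientation of the layers below, subject to
  compatibility with the new layer.\<close>

lemma top_labelings_snoc: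
  fixes D x l r
  defines "V \<equiv> {(Suc (length D), p) | p. snd p < top_width (D @ [x]) (fst p) \<and>
    (case p of (Lft, i) \<Rightarrow> l i | (Rgt, i) \<Rightarrow> \<not> r i)}"
  assumes "fits (D @ [x])" "plain x"
  shows "top_labelings (D @ [x]) l r =
    (\<lambda>U. U \<union> V) ` (\<Union>(l', r')\<in>layer_below x l r. top_labelings D l' r')"
proof -
  have fits: "fits D" "layer_fits x (top_width D)" using assms by (auto simp: fits_snoc)
  have V: "(k, p) \<in> V \<Longrightarrow> k = Suc (length D)" for k p by (auto simp: V_def)
  have pts: "(k, p) \<in> points D \<Longrightarrow> k \<le> length D" for k p by (auto simp: points_def)
  have key: "U \<union> V \<in> top_labelings (D @ [x]) l r \<longleftrightarrow>
      (\<exists>(l', r')\<in>layer_below x l r. U \<in> top_labelings D l' r')" if U: "U \<subseteq> points D" for U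
  proof -
    have "(Suc (length D), p) \<in> U \<union> V \<longleftrightarrow> (Suc (length D), p) \<in> V" for p
      using U pts by fastforce
    then have agrees: "agrees (layer_width x (top_width D)) (\<lambda>p. (Suc (length D), p) \<in> U \<union> V) l r"
      by (auto simp: agrees_def V_def top_width_snoc)
    have lower: "(k, p) \<in> U \<union> V \<longleftrightarrow> (k, p) \<in> U" if "k \<le> length D" for k p
      using that V by fastforce
    have "orientation D (\<lambda>p. p \<in> U \<union> V) \<longleftrightarrow> orientation D (\<lambda>p. p \<in> U)"
      using orientation_cong[OF fits(1), of "\<lambda>p. p \<in> U \<union> V" "\<lambda>p. p \<in> U"]
        orientation_cong[OF fits(1), of "\<lambda>p. p \<in> U" "\<lambda>p. p \<in> U \<union> V"] lower pts by force
    moreover have "compatible x (top_width D) (\<lambda>p. (length D, p) \<in> U \<union> V)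
        (\<lambda>p. (Suc (length D), p) \<in> U \<union> V) \<longleftrightarrow>
      (\<exists>(l', r')\<in>layer_below x l r. agrees (top_width D) (\<lambda>p. (length D, p) \<in> U) l' r')"
      using compatible_iff[OF fits(2) assms(3) agrees] lower by simp
    moreover have "U \<union> V \<subseteq> points (D @ [x])"
      using U by (auto simp: points_snoc V_def)
    ultimately show ?thesis
      using agrees U by (auto simp: top_labelings_def labelings_def orientation_snoc top_width_snoc)
  qed
  show ?thesis
  proof (intro equalityI subsetI)
    fix U assume U: "U \<in> top_labelings (D @ [x]) l r"
    have "U = (U \<inter> points D) \<union> V"
    proof -
      have "i < top_width (D @ [x]) s" if "(Suc (length D), s, i) \<in> U" for s i
        using that U by (auto simp: top_labelings_def labelings_def points_def top_width_def)
      then have "(Suc (length D), s, i) \<in> U \<longleftrightarrow> (Suc (length D), s, i) \<in> V" for s i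
        using U by (cases s) (auto simp: top_labelings_def agrees_def V_def)
      moreover have "U \<subseteq> points (D @ [x])" using U by (auto simp: top_labelings_def labelings_def)
      ultimately show ?thesis using V by (fastforce simp: points_snoc)
    qed
    with key[of "U \<inter> points D"] U show "U \<in> (\<lambda>U. U \<union> V) `
        (\<Union>(l', r')\<in>layer_below x l r. top_labelings D l' r')"
      by auto
  next
    fix U assume "U \<in> (\<lambda>U. U \<union> V) ` (\<Union>(l', r')\<in>layer_below x l r. top_labelings D l' r')"
    then obtain U0 c where U0: "U = U0 \<union> V" "c \<in> layer_below x l r"
      "U0 \<in> top_labelings D (fst c) (snd c)" by auto
    then have "U0 \<subseteq> points D" by (auto simp: top_labelings_def labelings_def)
    from key[OF this] U0 show "U \<in> top_labelings (D @ [x]) l r" by (cases c) auto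
  qed
qed

lemma state_1:
  assumes "fits D" "\<forall>x\<in>set D. plain x"
  shows "state 1 D l r = of_nat (card (top_labelings D l r))"
  using assms
proof (induction D arbitrary: l r rule: rev_induct)
  case Nil
  have "top_labelings [] l r = {{}}"
    by (auto simp: top_labelings_def labelings_def points_def width_def orientation_def agrees_def)
  then show ?case by simp
next
  case (snoc x D)
  then have D: "fits D" "layer_fits x (top_width D)" "plain x" "\<forall>x\<in>set D. plain x"
    by (auto simp: fits_snoc)
  define V where "V = {(Suc (length D), p) | p. snd p < top_width (D @ [x]) (fst p) \<and>
    (case p of (Lft, i) \<Rightarrow> l i | (Rgt, i) \<Rightarrow> \<not> r i)}"
  have "inj_on (\<lambda>U. U \<union> V) (\<Union>(l', r')\<in>layer_below x l r. top_labelings D l' r')"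
  proof (rule inj_on_subset)
    have "points D \<inter> V = {}" by (auto simp: V_def points_def)
    then show "inj_on (\<lambda>U. U \<union> V) (Pow (points D))" by (auto simp: inj_on_def)
    show "(\<Union>(l', r')\<in>layer_below x l r. top_labelings D l' r') \<subseteq> Pow (points D)"
      by (auto simp: top_labelings_def labelings_def)
  qed
  then have "card (top_labelings (D @ [x]) l r) =
      card (\<Union>(l', r')\<in>layer_below x l r. top_labelings D l' r')"
    using top_labelings_snoc[OF snoc.prems(1) D(3), of l r] by (simp add: card_image V_def)
  also have "\<dots> = (\<Sum>c\<in>layer_below x l r. card (case c of (l', r') \<Rightarrow> top_labelings D l' r'))"
  proof (rule card_UN_disjoint)
    show "\<forall>c\<in>layer_below x l r. finite (case c of (l', r') \<Rightarrow> top_labelings D l' r')"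
      by (auto simp: top_labelings_def finite_labelings)
    show "\<forall>c\<in>layer_below x l r. \<forall>c'\<in>layer_below x l r. c \<noteq> c' \<longrightarrow>
        (case c of (l', r') \<Rightarrow> top_labelings D l' r') \<inter> (case c' of (l', r') \<Rightarrow> top_labelings D l' r') = {}"
      using layer_below_unique[OF D(2)] by (fastforce simp: top_labelings_def)
  qed (rule finite_layer_below)
  finally show ?case
    using snoc.IH[OF D(1,4)] by (simp add: layer_op_1[OF D(3)] split_def)
qed

text \<open>The exponent \<open>N\<close> is common to all \<open>q\<close>. At \<open>q = 1\<close>
  the state counts orientations, so \<open>2 ^ N\<close> is \<open>2\<close> to the number of
  components.\<close>

lemma state_components:
  assumes "link_diagram D" "\<forall>x\<in>set D. plain x" "q \<noteq> 0"
  shows "state q D l r = (q + inverse q) ^ card (link_components D)"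
proof -
  obtain N where N: "\<And>q. q \<noteq> 0 \<Longrightarrow> state q D = (\<lambda>l r. (q + inverse q) ^ N)"
    using closed_state[OF assms(1,2)] by blast
  have D: "fits D" "\<And>s. top_width D s = 0" using assms(1) by (auto simp: link_diagram_iff)
  have "top_labelings D l r = labelings D"
    using D(2) by (auto simp: top_labelings_def agrees_def)
  then have "of_nat (card (labelings D)) = (2 ^ N :: ratfun)"
    using state_1[OF D(1) assms(2), of l r] N[of 1] by simp
  then have 2: "card (labelings D) = 2 ^ N"
    by (metis of_nat_eq_iff of_nat_numeral of_nat_power)
  \<comment> \<open>A power of two is positive, which provides the orientation that
    \<open>card_labelings\<close> starts from.\<close>
  then have "labelings D \<noteq> {}" by auto
  then have "card (labelings D) = 2 ^ card (link_components D)"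
    using card_labelings[OF D(1)] by blast
  with 2 have "N = card (link_components D)" by simp
  with N[OF assms(3)] show ?thesis by simp
qed

section \<open>The bracket of a symmetric diagram\<close>

lemma fold_layer_op_linear:
  "fold (layer_op q) D (\<lambda>l r. a * F l r + b * G l r) =
    (\<lambda>l r. a * fold (layer_op q) D F l r + b * fold (layer_op q) D G l r)"
proof (induction D arbitrary: F G)
  case (Cons x D)
  have "layer_op q x (\<lambda>l r. a * F l r + b * G l r) =
      (\<lambda>l r. a * layer_op q x F l r + b * layer_op q x G l r)"
    by (cases x) (auto simp: event_op_linear axis_cup_def axis_cap_def fun_eq_iff algebra_simps)
  with Cons show ?case by simp
qed simp

lemma state_left_crossing:
  "state q (U @ Off (Cross i x) f # V) l r =
    coeff_idle x * state q (U @ Off Idle f # V) l r + coeff_turn x * state q (U @ Off (Turn i) f # V) l r"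
  using fold_layer_op_linear[of q V "coeff_idle x" "layer_op q (Off Idle f) (state q U)" "coeff_turn x"
      "layer_op q (Off (Turn i) f) (state q U)"]
  by simp

lemma state_right_crossing:
  "state q (U @ Off e (Cross i x) # V) l r =
    coeff_idle x * state q (U @ Off e Idle # V) l r + coeff_turn x * state q (U @ Off e (Turn i) # V) l r"
  using fold_layer_op_linear[of q V "coeff_idle x" "layer_op q (Off e Idle) (state q U)" "coeff_turn x"
      "layer_op q (Off e (Turn i)) (state q U)"]
  by (simp add: event_op_linear)

lemma link_diagram_replace:
  assumes "link_diagram (U @ x # V)" "\<And>w. layer_fits x w \<Longrightarrow> layer_fits y w"
    and "layer_width y = layer_width x"
  shows "link_diagram (U @ y # V)"
proof -
  have "width (U @ y # V) k = width (U @ x # V) k" for k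
    using assms(3) by (simp add: width_def take_Cons' )
  note width = this
  have "layer_fits ((U @ y # V) ! k) (width (U @ y # V) k)" if "k < length (U @ y # V)" for k
  proof -
    have "layer_fits ((U @ x # V) ! k) (width (U @ x # V) k)"
      using assms(1) that by (simp add: link_diagram_def)
    then show ?thesis
      using assms(2) by (cases "k = length U") (auto simp: nth_append nth_Cons' width)
  qed
  then show ?thesis
    using assms(1) by (simp add: link_diagram_def width)
qed

definition half_axis_points :: "diagram \<Rightarrow> int" where
  "half_axis_points D = int (sum_list (map axis_points D) div 2)"

definition resolvable :: "diagram \<Rightarrow> bool" where
  "resolvable D \<longleftrightarrow> link_diagram D \<and> (\<forall>x\<in>set D. (\<forall>s. x \<noteq> Ax_pass s) \<and> (\<forall>y. x \<noteq> Ax_cross y))"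

text \<open>Rule (C) with the closed state in place of \<open>circle_A\<close> to the number of
  circles. This form makes sense for diagrams with crossings off the axis.\<close>

definition state_value :: "diagram \<Rightarrow> ratfun" where
  "state_value D = circle_A powi (- half_axis_points D) * circle_B powi (half_axis_points D - 1) *
     state q0 D (\<lambda>_. False) (\<lambda>_. False)"

lemma layer_width_event:
  "layer_width (Off (Cross i x) f) = layer_width (Off Idle f)"
  "layer_width (Off (Turn i) f) = layer_width (Off Idle f)"
  "layer_width (Off e (Cross i x)) = layer_width (Off e Idle)"
  "layer_width (Off e (Turn i)) = layer_width (Off e Idle)"
  by (auto simp: fun_eq_iff split: side.split)

lemma resolvable_crossing:
  "resolvable (U @ Off (Cross i x) f # V) \<Longrightarrow> resolvable (U @ Off Idle f # V)"
  "resolvable (U @ Off (Cross i x) f # V) \<Longrightarrow> resolvable (U @ Off (Turn i) f # V)"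
  "resolvable (U @ Off e (Cross i x) # V) \<Longrightarrow> resolvable (U @ Off e Idle # V)"
  "resolvable (U @ Off e (Cross i x) # V) \<Longrightarrow> resolvable (U @ Off e (Turn i) # V)"
  by (auto simp: resolvable_def layer_width_event elim!: link_diagram_replace)

lemma state_value_crossing:
  "state_value (U @ Off (Cross i x) f # V) =
    coeff_idle x * state_value (U @ Off Idle f # V) + coeff_turn x * state_value (U @ Off (Turn i) f # V)"
  "state_value (U @ Off e (Cross i x) # V) =
    coeff_idle x * state_value (U @ Off e Idle # V) + coeff_turn x * state_value (U @ Off e (Turn i) # V)"
  by (simp_all add: state_value_def half_axis_points_def state_left_crossing state_right_crossing
      algebra_simps del: state_append)

lemma circles_value_state:
  assumes "resolvable D" "\<forall>x\<in>set D. plain x"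
  shows "circles_value D = state_value D"
proof -
  have "q0 + inverse q0 = circle_A" by (simp add: circle_A_def)
  then have "state q0 D (\<lambda>_. False) (\<lambda>_. False) = circle_A ^ card (link_components D)"
    using state_components[of D q0 "\<lambda>_. False" "\<lambda>_. False"] assms by (simp add: resolvable_def)
  then show ?thesis
    by (simp add: circles_value_def state_value_def half_axis_points_def Let_def
        power_int_diff power_int_minus divide_inverse)
qed

lemma not_resolvable [simp]: "\<not> resolvable (U @ Ax_pass s # V)" "\<not> resolvable (U @ Ax_cross y # V)"
  by (auto simp: resolvable_def)

text \<open>\<open>state_value\<close> obeys rule (A): smoothing off the axis keeps the axis points,
  and states are linear in each layer. Without crossings it is rule (C).\<close>

lemma resolve_state:
  "resolvable (P @ Q) \<Longrightarrow> \<forall>x\<in>set P. plain x \<Longrightarrow> resolve P Q = state_value (P @ Q)"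
proof (induction P Q rule: resolve.induct)
qed (simp_all add: circles_value_state state_value_crossing plain_def, (metis resolvable_crossing)+)

lemma bracket_state: "resolvable D \<Longrightarrow> bracket D = state_value D"
  using resolve_state[of "[]" D] by (simp add: bracket_def)

section \<open>Removing the crossings on the axis\<close>

lemma symmetric_iff:
  "symmetric D \<longleftrightarrow> link_diagram D \<and> (\<forall>x\<in>set D. symmetric_layer x)"
  by (auto simp: symmetric_def reflect_def symmetric_layer_def list_eq_iff_nth_eq all_set_conv_all_nth)

text \<open>When the two strands of an axis crossing are directed oppositely in height, as in a
  symmetric union, the type of the crossing determines its sign; these are the signs summed
  here.\<close>

definition axis_writhe :: "diagram \<Rightarrow> int" where
  "axis_writhe D = (\<Sum>x\<leftarrow>D. case x of Ax_cross Desc \<Rightarrow> 1 | Ax_cross Asc \<Rightarrow> -1 | _ \<Rightarrow> 0)"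

text \<open>The power of \<open>B\<close> is the one cancelled, up to sign, by the normalising
  factor of \<open>W\<close> when \<open>b\<close> is the sum of signs on the axis.\<close>

definition in_bracket_module :: "int \<Rightarrow> int \<Rightarrow> ratfun \<Rightarrow> bool" where
  "in_bracket_module b m z \<longleftrightarrow>
    (\<exists>f\<in>laurent_polys. z = var_B powi (3 * b) * circle_B powi (m - 1) * f)"

lemma in_bracket_module_add:
  "in_bracket_module b m y \<Longrightarrow> in_bracket_module b m z \<Longrightarrow> in_bracket_module b m (y + z)"
  unfolding in_bracket_module_def by (metis distrib_left laurent_add)

lemma bracket_no_axis_crossings:
  assumes "symmetric D" "\<forall>x\<in>set D. \<forall>y. x \<noteq> Ax_cross y"
  shows "in_bracket_module 0 (half_axis_points D) (bracket D)"
proof -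
  have D: "link_diagram D" "\<forall>x\<in>set D. symmetric_layer x" using assms(1) by (auto simp: symmetric_iff)
  have "x \<noteq> Ax_pass s" if "x \<in> set D" for x s
    using D(2) that by (auto simp: symmetric_layer_def)
  then have "resolvable D" using D(1) assms(2) by (auto simp: resolvable_def)
  then have "bracket D = state_value D" by (rule bracket_state)
  moreover obtain E where "2 * E = int (sum_list (map axis_points D))"
    "\<forall>l r. circle_A powi (- E) * state q0 D l r \<in> laurent_polys"
    using lat_state[of D] D assms(2) by (auto simp: link_diagram_iff)
  \<comment> \<open>The top line is empty, so \<open>E\<close> is half the number of axis
    points.\<close>
  moreover from this have "half_axis_points D = E"
    by (simp add: half_axis_points_def flip: zdiv_int)
  ultimately show ?thesis
    unfolding in_bracket_module_def state_value_def
    by (intro bexI[of _ "circle_A powi (- E) * state q0 D (\<lambda>_. False) (\<lambda>_. False)"])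
       (simp_all add: mult.assoc mult.left_commute)
qed

text \<open>The terms of rule (B), the first two for \<open>X_o\<close> and the last two for
  \<open>X_u\<close>. For \<open>X_o\<close>, \<open>B\<close> times \<open>circle_B\<close> is
  \<open>-B^3 (1 + B^-4)\<close> and \<open>B^-1\<close> is \<open>B^3 B^-4\<close>, so both terms
  are \<open>B^3\<close> times Laurent polynomials; \<open>X_u\<close> is the same with
  \<open>B\<close> inverted.\<close>

lemma in_bracket_module_step:
  fixes b m :: int
  shows "in_bracket_module b (m + 1) z \<Longrightarrow> in_bracket_module (b + 1) m (var_B * z)"
    "in_bracket_module b m z \<Longrightarrow> in_bracket_module (b + 1) m (inverse var_B * z)"
    "in_bracket_module b (m + 1) z \<Longrightarrow> in_bracket_module (b - 1) m (inverse var_B * z)"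
    "in_bracket_module b m z \<Longrightarrow> in_bracket_module (b - 1) m (var_B * z)"
proof -
  have B3: "var_B powi (3 * (b + 1)) = var_B powi (3 * b) * var_B ^ 3"
    "var_B powi (3 * (b - 1)) = var_B powi (3 * b) * inverse (var_B ^ 3)"
    by (simp_all add: power_int_add power_int_diff divide_inverse algebra_simps)
  have circle: "circle_B powi (m + 1 - 1) = circle_B powi (m - 1) * circle_B"
    by (simp add: power_int_diff)
  have B4: "inverse (var_B ^ 4) = inverse var_B * inverse (var_B ^ 3)" "var_B ^ 4 = var_B * var_B ^ 3"
    by (simp_all add: field_simps power_numeral_reduce)
  {
    assume "in_bracket_module b (m + 1) z"
    then obtain f where f: "f \<in> laurent_polys"
      "z = var_B powi (3 * b) * (circle_B powi (m - 1) * circle_B) * f"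
      unfolding in_bracket_module_def circle by blast
    show "in_bracket_module (b + 1) m (var_B * z)"
      unfolding in_bracket_module_def B3 f(2)
      by (rule bexI[of _ "- (1 + inverse (var_B ^ 4)) * f"])
         (simp add: circle_B_def field_simps power_numeral_reduce, intro laurent_intros f(1))
    show "in_bracket_module (b - 1) m (inverse var_B * z)"
      unfolding in_bracket_module_def B3 f(2)
      by (rule bexI[of _ "- (1 + var_B ^ 4) * f"])
         (simp add: circle_B_def field_simps power_numeral_reduce, intro laurent_intros f(1))
  next
    assume "in_bracket_module b m z"
    then obtain f where f: "f \<in> laurent_polys"
      "z = var_B powi (3 * b) * circle_B powi (m - 1) * f"
      unfolding in_bracket_module_def by blast
    show "in_bracket_module (b + 1) m (inverse var_B * z)"
      unfolding in_bracket_module_def B3 f(2)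
      by (rule bexI[of _ "inverse (var_B ^ 4) * f"])
         (simp add: B4, intro laurent_intros f(1))
    show "in_bracket_module (b - 1) m (var_B * z)"
      unfolding in_bracket_module_def B3 f(2)
      by (rule bexI[of _ "var_B ^ 4 * f"])
         (simp add: B4, intro laurent_intros f(1))
  }
qed

text \<open>Smoothing an axis crossing keeps the diagram symmetric but need not keep it a symmetric
  union. Therefore the induction runs over symmetric diagrams and measures \<open>m\<close> by axis
  points instead of components.\<close>

lemma bracket_module:
  "symmetric (P @ Q) \<Longrightarrow> \<forall>x\<in>set P. \<forall>y. x \<noteq> Ax_cross y \<Longrightarrow>
    in_bracket_module (axis_writhe Q) (half_axis_points (P @ Q)) (bracket (P @ Q))"
proof (induction Q arbitrary: P)
  case Nil
  then show ?case using bracket_no_axis_crossings[of P] by (simp add: axis_writhe_def)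
next
  case (Cons x Q)
  show ?case
  proof (cases "\<exists>y. x = Ax_cross y")
    case True
    then obtain y where x: "x = Ax_cross y" by blast
    have "link_diagram (P @ Ax_turn # Q)" "link_diagram (P @ Off Idle Idle # Q)"
      using Cons.prems(1) unfolding x symmetric_iff
      by (auto simp: fun_eq_iff split: side.split elim!: link_diagram_replace)
    then have "symmetric ((P @ [Ax_turn]) @ Q)" "symmetric ((P @ [Off Idle Idle]) @ Q)"
      using Cons.prems(1) unfolding symmetric_iff by (auto simp: symmetric_layer_def)
    then have IH: "in_bracket_module (axis_writhe Q) (half_axis_points (P @ Ax_turn # Q)) (bracket (P @ Ax_turn # Q))"
      "in_bracket_module (axis_writhe Q) (half_axis_points (P @ Off Idle Idle # Q)) (bracket (P @ Off Idle Idle # Q))"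
      using Cons.IH[of "P @ [Ax_turn]"] Cons.IH[of "P @ [Off Idle Idle]"] Cons.prems(2) by auto
    \<comment> \<open>The smoothing \<open>h\<close> creates a maximum and a minimum on the axis,
      that is, two axis points.\<close>
    have "half_axis_points (P @ Ax_turn # Q) = half_axis_points (P @ x # Q) + 1"
      "half_axis_points (P @ Off Idle Idle # Q) = half_axis_points (P @ x # Q)"
      by (simp_all add: half_axis_points_def x)
    then show ?thesis
      using IH unfolding x bracket_on_axis
      by (cases y) (auto simp: axis_writhe_def add.commute[of 1] intro!: in_bracket_module_add
          in_bracket_module_step in_bracket_module_step(3,4)[where b = "axis_writhe Q", unfolded axis_writhe_def])
  next
    case False
    then have "axis_writhe (x # Q) = axis_writhe Q"
      by (cases x) (auto simp: axis_writhe_def)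
    then show ?thesis using Cons.IH[of "P @ [x]"] Cons.prems False by auto
  qed
qed

section \<open>Symmetric unions\<close>

text \<open>
  On a cycle \<open>f\<close> acts as \<open>x \<mapsto> x + 1\<close> and \<open>r\<close> as \<open>x \<mapsto> a - x\<close> modulo the length \<open>N\<close>. As \<open>r\<close> has no fixed point,
  \<open>N\<close> is even and \<open>a\<close> is odd, so that \<open>2 x + 1 = a\<close> has exactly two solutions.
\<close>

lemma reversed_orbit:
  fixes f r :: "'a \<Rightarrow> 'a"
  assumes f: "inj f" and C: "C = range (\<lambda>n. (f ^^ n) p)" "finite C"
    and r: "\<And>x. x \<in> C \<Longrightarrow> r x \<in> C" "\<And>x. x \<in> C \<Longrightarrow> r x \<noteq> x" "\<And>x. x \<in> C \<Longrightarrow> f (r (f x)) = r x"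
  shows "card {x \<in> C. f x = r x} = 2"
proof -
  have "{y. \<exists>n. y = (f ^^ n) p} = C" using C(1) by auto
  then obtain n where "n > 0" "(f ^^ n) p = p"
    using funpow_inj_finite[OF f, of p] C(2) by auto
  define N where "N = (LEAST n. n > 0 \<and> (f ^^ n) p = p)"
  have N: "N > 0" "(f ^^ N) p = p" and least: "\<And>n. 0 < n \<Longrightarrow> n < N \<Longrightarrow> (f ^^ n) p \<noteq> p"
    using LeastI[of "\<lambda>n. n > 0 \<and> (f ^^ n) p = p" n] \<open>n > 0\<close> \<open>(f ^^ n) p = p\<close>
      not_less_Least[of _ "\<lambda>n. n > 0 \<and> (f ^^ n) p = p"] unfolding N_def by auto
  have lt: "i = j" if "(f ^^ i) p = (f ^^ j) p" "i < N" "j < N" for i j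
  proof -
    have "\<not> i < j" if eq: "(f ^^ i) p = (f ^^ j) p" and "j < N" for i j
    proof
      assume "i < j"
      then have "(f ^^ i) ((f ^^ (j - i)) p) = (f ^^ i) p"
        using eq by (simp flip: funpow_add comp_apply[of "f ^^ i"])
      then have "(f ^^ (j - i)) p = p" using inj_fn[OF f, of i] by (simp add: inj_eq)
      moreover have "0 < j - i" "j - i < N" using \<open>i < j\<close> \<open>j < N\<close> by linarith+
      ultimately show False using least by blast
    qed
    from this[of i j] this[of j i] that show ?thesis by simp
  qed
  have idx: "(f ^^ i) p = (f ^^ j) p \<longleftrightarrow> i mod N = j mod N" for i j
  proof -
    have "(f ^^ (i mod N)) p = (f ^^ i) p" "(f ^^ (j mod N)) p = (f ^^ j) p"
      by (simp_all add: funpow_mod_eq[OF N(2)])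
    moreover have "i mod N < N" "j mod N < N" using N(1) by simp_all
    ultimately show ?thesis using lt[of "i mod N" "j mod N"] by auto
  qed
  have mem: "(f ^^ j) p \<in> C" for j using C(1) by auto
  have "r p \<in> range (\<lambda>n. (f ^^ n) p)" using r(1)[OF mem[of 0]] C(1) by simp
  then obtain a where a: "r p = (f ^^ a) p" by blast
  \<comment> \<open>Since \<open>f\<close>, then \<open>r\<close>, then \<open>f\<close> again has
    the effect of \<open>r\<close>, the map \<open>r\<close> runs through the cycle backwards and
    sends index \<open>j\<close> to \<open>a - j\<close>.\<close>
  have r_add: "(f ^^ j) (r ((f ^^ j) p)) = (f ^^ a) p" for j
  proof (induction j)
    case (Suc j)
    have "(f ^^ Suc j) (r ((f ^^ Suc j) p)) = (f ^^ j) (f (r (f ((f ^^ j) p))))"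
      by (simp add: funpow_swap1)
    also have "\<dots> = (f ^^ j) (r ((f ^^ j) p))" using r(3)[OF mem] by simp
    finally show ?case using Suc by simp
  qed (simp add: a)
  have r_eq: "r ((f ^^ j) p) = (f ^^ i) p \<longleftrightarrow> (i + j) mod N = a mod N" for i j
  proof -
    have "r ((f ^^ j) p) = (f ^^ i) p \<longleftrightarrow> (f ^^ j) (r ((f ^^ j) p)) = (f ^^ j) ((f ^^ i) p)"
      using inj_fn[OF f, of j] by (simp add: inj_eq)
    also have "\<dots> \<longleftrightarrow> (f ^^ a) p = (f ^^ (i + j)) p"
      by (simp add: r_add funpow_add add.commute[of i])
    finally show ?thesis using idx[of a "i + j"] by auto
  qed
  have no_fix: "(2 * j) mod N \<noteq> a mod N" for j
    using r(2)[OF mem[of j]] r_eq[of j j] by (auto simp: mult_2)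
  have "even N"
  proof (rule ccontr)
    assume "odd N"
    then obtain M where M: "N = 2 * M + 1" by (elim oddE)
    \<comment> \<open>For odd \<open>N\<close> the factor \<open>M + 1\<close> inverts 2 modulo
      \<open>N\<close>, so \<open>r\<close> would fix the point of index
      \<open>a * (M + 1)\<close>.\<close>
    have "2 * (a * (M + 1)) = a + a * N" using M by (simp add: algebra_simps)
    then have "(2 * (a * (M + 1))) mod N = (a + a * N) mod N" by (simp only:)
    also have "\<dots> = a mod N" by simp
    finally have "(2 * (a * (M + 1))) mod N = a mod N" .
    with no_fix show False by blast
  qed
  then obtain M where M: "N = 2 * M" by (elim evenE)
  \<comment> \<open>For even \<open>a\<close> the point of index \<open>a div 2\<close> would be
    fixed.\<close>
  have "odd a" using no_fix[of "a div 2"] by (metis dvd_mult_div_cancel)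
  then obtain b where b: "a = 2 * b + 1" by (elim oddE)
  have "M > 0" using M N by simp
  have fix_iff: "f ((f ^^ j) p) = r ((f ^^ j) p) \<longleftrightarrow> j mod M = b mod M" for j
  proof -
    have "f ((f ^^ j) p) = r ((f ^^ j) p) \<longleftrightarrow> (2 * j + 1) mod N = (2 * b + 1) mod N"
      using r_eq[of j "Suc j"] b by (auto simp: mult_2)
    also have "\<dots> \<longleftrightarrow> int N dvd 2 * int j - 2 * int b"
      using mod_eq_dvd_iff[of "int (2 * j + 1)" "int N" "int (2 * b + 1)"]
      unfolding zmod_int[symmetric] of_nat_eq_iff by simp
    also have "\<dots> \<longleftrightarrow> int M dvd int j - int b"
      unfolding M by (metis dvd_mult_cancel_left of_nat_mult of_nat_numeral right_diff_distrib zero_neq_numeral)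
    also have "\<dots> \<longleftrightarrow> j mod M = b mod M"
      using mod_eq_dvd_iff[of "int j" "int M" "int b"]
      unfolding zmod_int[symmetric] of_nat_eq_iff by simp
    finally show ?thesis .
  qed
  \<comment> \<open>As \<open>N = 2 * M\<close>, a residue class modulo \<open>M\<close> has exactly
    two representatives below \<open>N\<close>.\<close>
  have "{x \<in> C. f x = r x} = {(f ^^ (b mod M)) p, (f ^^ (b mod M + M)) p}"
  proof (intro equalityI subsetI)
    fix x assume "x \<in> {x \<in> C. f x = r x}"
    then obtain j where j: "x = (f ^^ j) p" "j mod M = b mod M"
      using C(1) fix_iff by auto
    have "x = (f ^^ (j mod N)) p" using j(1) N(2) by (simp add: funpow_mod_eq)
    moreover have "(j mod N) mod M = b mod M" using j(2) M by (simp add: mod_mod_cancel)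
    moreover have "j mod N < 2 * M" using N M by simp
    ultimately show "x \<in> {(f ^^ (b mod M)) p, (f ^^ (b mod M + M)) p}"
      by (metis add.commute insert_iff le_mod_geq mod_less mult_2 nat_add_left_cancel_less
          not_le le_add_diff_inverse)
  next
    fix x assume "x \<in> {(f ^^ (b mod M)) p, (f ^^ (b mod M + M)) p}"
    then show "x \<in> {x \<in> C. f x = r x}" using mem fix_iff by auto
  qed
  moreover have "(f ^^ (b mod M)) p \<noteq> (f ^^ (b mod M + M)) p"
    using lt[of "b mod M" "b mod M + M"] \<open>M > 0\<close> M by auto
  ultimately show ?thesis by simp
qed

text \<open>
  Following an arc upwards (downwards) from a point below (above) an event or layer leads to a point
  on the other cutting line (\<open>Inl\<close>) or back to the same one (\<open>Inr\<close>). Only symmetric layers matter, so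
  the value on \<open>Ax_pass\<close> is arbitrary.
\<close>

fun event_up :: "event \<Rightarrow> nat \<Rightarrow> nat + nat" where
  "event_up Idle i = Inl i"
| "event_up (Cup c) i = Inl (if i < c then i else i + 2)"
| "event_up (Cap c) i =
    (if i < c then Inl i else if i = c then Inr (c + 1) else if i = c + 1 then Inr c else Inl (i - 2))"
| "event_up (Turn c) i = (if i = c then Inr (c + 1) else if i = c + 1 then Inr c else Inl i)"
| "event_up (Cross c x) i = Inl (if i = c then c + 1 else if i = c + 1 then c else i)"

fun event_down :: "event \<Rightarrow> nat \<Rightarrow> nat + nat" where
  "event_down (Cup c) i =
    (if i < c then Inl i else if i = c then Inr (c + 1) else if i = c + 1 then Inr c else Inl (i - 2))"
| "event_down (Cap c) i = Inl (if i < c then i else i + 2)"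
| "event_down e i = event_up e i"

fun layer_up :: "layer \<Rightarrow> pos \<Rightarrow> pos + pos" where
  "layer_up (Off e f) (s, i) = map_sum (Pair s) (Pair s) (event_up (case s of Lft \<Rightarrow> e | Rgt \<Rightarrow> f) i)"
| "layer_up Ax_cup (s, i) = Inl (s, i + 1)"
| "layer_up Ax_cap (s, i) = (if i = 0 then Inr (other s, 0) else Inl (s, i - 1))"
| "layer_up Ax_turn (s, i) = (if i = 0 then Inr (other s, 0) else Inl (s, i))"
| "layer_up (Ax_cross x) (s, i) = Inl (if i = 0 then other s else s, i)"
| "layer_up (Ax_pass t) p = Inl p"

fun layer_down :: "layer \<Rightarrow> pos \<Rightarrow> pos + pos" where
  "layer_down (Off e f) (s, i) = map_sum (Pair s) (Pair s) (event_down (case s of Lft \<Rightarrow> e | Rgt \<Rightarrow> f) i)"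
| "layer_down Ax_cup (s, i) = (if i = 0 then Inr (other s, 0) else Inl (s, i - 1))"
| "layer_down Ax_cap (s, i) = Inl (s, i + 1)"
| "layer_down x p = layer_up x p"

definition mirror :: "pos \<Rightarrow> pos" where
  "mirror p = (other (fst p), snd p)"

lemma other_other [simp]: "other (other s) = s"
  by (cases s) auto

lemma map_sum_eq_iff:
  "map_sum f g z = Inl y \<longleftrightarrow> (\<exists>x. z = Inl x \<and> y = f x)"
  "map_sum f g z = Inr y' \<longleftrightarrow> (\<exists>x. z = Inr x \<and> y' = g x)"
  by (cases z; auto)+

lemma event_up_iff:
  "event_up e i = Inl j \<longleftrightarrow> event_runs e i j"
  "event_up e i = Inr j \<longleftrightarrow> j = i + 1 \<and> e \<in> {Cap i, Turn i} \<or> i = j + 1 \<and> e \<in> {Cap j, Turn j}"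
  by (cases e; auto)+

lemma event_down_iff:
  "event_down e j = Inl i \<longleftrightarrow> event_runs e i j"
  "event_down e i = Inr j \<longleftrightarrow> j = i + 1 \<and> e \<in> {Cup i, Turn i} \<or> i = j + 1 \<and> e \<in> {Cup j, Turn j}"
  by (cases e; auto)+

lemma layer_up_iff:
  assumes "symmetric_layer x"
  shows "layer_up x p = Inl q \<longleftrightarrow> runs x p q"
    "layer_up x p = Inr q \<longleftrightarrow> caps x p q \<or> caps x q p"
proof -
  obtain s i s' j where p: "p = (s, i)" "q = (s', j)" by fastforce
  have "(layer_up x p = Inl q \<longleftrightarrow> runs x p q) \<and>
      (layer_up x p = Inr q \<longleftrightarrow> caps x p q \<or> caps x q p)"
  proof (cases x)
    case (Off e f)
    then show ?thesis by (cases s; cases s') (auto simp: p map_sum_eq_iff event_up_iff)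
  qed (use assms in \<open>cases s; cases s'; auto simp: p symmetric_layer_def\<close>)+
  then show "layer_up x p = Inl q \<longleftrightarrow> runs x p q"
    "layer_up x p = Inr q \<longleftrightarrow> caps x p q \<or> caps x q p" by auto
qed

lemma layer_down_iff:
  assumes "symmetric_layer x"
  shows "layer_down x q = Inl p \<longleftrightarrow> runs x p q"
    "layer_down x p = Inr q \<longleftrightarrow> cups x p q \<or> cups x q p"
proof -
  obtain s i s' j where p: "p = (s, i)" "q = (s', j)" by fastforce
  have "(layer_down x q = Inl p \<longleftrightarrow> runs x p q) \<and>
      (layer_down x p = Inr q \<longleftrightarrow> cups x p q \<or> cups x q p)"
  proof (cases x)
    case (Off e f)
    then show ?thesis by (cases s; cases s') (auto simp: p map_sum_eq_iff event_down_iff)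
  qed (use assms in \<open>cases s; cases s'; auto simp: p symmetric_layer_def\<close>)+
  then show "layer_down x q = Inl p \<longleftrightarrow> runs x p q"
    "layer_down x p = Inr q \<longleftrightarrow> cups x p q \<or> cups x q p" by auto
qed

text \<open>Arcs over the axis are listed from left to right only, so cups and caps are compared
  with their mirror images up to the order of the ends.\<close>

lemma mirror_arcs:
  assumes "symmetric_layer x"
  shows "runs x (mirror p) (mirror q) \<longleftrightarrow> runs x p q"
    "caps x (mirror p) (mirror q) \<or> caps x (mirror q) (mirror p) \<longleftrightarrow> caps x p q \<or> caps x q p"
    "cups x (mirror p) (mirror q) \<or> cups x (mirror q) (mirror p) \<longleftrightarrow> cups x p q \<or> cups x q p"
proof -
  obtain s i s' j where [simp]: "p = (s, i)" "q = (s', j)" by fastforce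
  show "runs x (mirror p) (mirror q) \<longleftrightarrow> runs x p q"
    "caps x (mirror p) (mirror q) \<or> caps x (mirror q) (mirror p) \<longleftrightarrow> caps x p q \<or> caps x q p"
    "cups x (mirror p) (mirror q) \<or> cups x (mirror q) (mirror p) \<longleftrightarrow> cups x p q \<or> cups x q p"
    using assms
    by (cases rule: symmetric_layer_cases; cases s; cases s'; auto simp: mirror_def crossing_pair_def)+
qed

lemma runs_in_range_down:
  assumes "symmetric_layer x" "layer_fits x w" "runs x (s, i) (s', j)" "j < layer_width x w s'"
    and "w Lft = w Rgt"
  shows "i < w s"
  using assms(1)
  by (cases rule: symmetric_layer_cases; cases s; cases s')
     (use assms(2-) in \<open>auto simp: crossing_pair_def split: if_splits\<close>)

lemma layer_width_symmetric:
  "symmetric_layer x \<Longrightarrow> w Rgt = w Lft \<Longrightarrow> layer_width x w Rgt = layer_width x w Lft"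
  by (cases rule: symmetric_layer_cases) (auto simp: crossing_pair_def)

lemma reflect_point_eq: "reflect_point (k, p) = (k, mirror p)"
  by (cases p) (simp add: mirror_def)

lemma reflect_reflect [simp]: "reflect_point (reflect_point p) = p"
  by (cases p) simp

section \<open>Traversing a diagram whose orientation is reversed by the reflection\<close>

locale reversing_orientation =
  fixes D :: diagram and up :: "point \<Rightarrow> bool"
  assumes symmetric: "symmetric D" and orientation: "orientation D up"
    and reversing: "\<And>p. p \<in> points D \<Longrightarrow> up (reflect_point p) \<longleftrightarrow> \<not> up p"
begin

lemma layers:
  assumes "k < length D"
  shows "symmetric_layer (D ! k)" "layer_fits (D ! k) (width D k)"
  using symmetric assms by (auto simp: symmetric_iff link_diagram_def)

lemma fits: "fits D"
  using symmetric by (simp add: symmetric_iff link_diagram_iff)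

lemma width_symmetric: "k \<le> length D \<Longrightarrow> width D k Rgt = width D k Lft"
  by (induction k) (auto simp: width_Suc layers layer_width_symmetric, simp add: width_def)

lemma reflect_in_points: "p \<in> points D \<Longrightarrow> reflect_point p \<in> points D"
proof -
  assume p: "p \<in> points D"
  obtain k s i where "p = (k, s, i)" by (cases p)
  with p width_symmetric[of k] show ?thesis by (cases s) (auto simp: mem_points)
qed

lemma orientation_rules:
  assumes "k < length D"
  shows "runs (D ! k) a b \<Longrightarrow> (k, a) \<in> points D \<Longrightarrow> up (Suc k, b) \<longleftrightarrow> up (k, a)"
    "cups (D ! k) a b \<Longrightarrow> up (Suc k, b) \<longleftrightarrow> \<not> up (Suc k, a)"
    "caps (D ! k) a b \<Longrightarrow> up (k, b) \<longleftrightarrow> \<not> up (k, a)"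
  using orientation[unfolded orientation_def, rule_format, OF assms, of a b] by blast+

lemma arcs_in_points:
  assumes "k < length D"
  shows "runs (D ! k) a b \<Longrightarrow> (k, a) \<in> points D \<longleftrightarrow> (Suc k, b) \<in> points D"
    "cups (D ! k) a b \<Longrightarrow> (Suc k, a) \<in> points D \<and> (Suc k, b) \<in> points D"
    "caps (D ! k) a b \<Longrightarrow> (k, a) \<in> points D \<and> (k, b) \<in> points D"
proof -
  show "cups (D ! k) a b \<Longrightarrow> (Suc k, a) \<in> points D \<and> (Suc k, b) \<in> points D"
    "caps (D ! k) a b \<Longrightarrow> (k, a) \<in> points D \<and> (k, b) \<in> points D"
    using adjacent_points[OF fits adjacent_cup[OF assms]] adjacent_points[OF fits adjacent_cap[OF assms]]
    by blast+
  obtain s i s' j where "a = (s, i)" "b = (s', j)" by fastforce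
  then show "runs (D ! k) a b \<Longrightarrow> (k, a) \<in> points D \<longleftrightarrow> (Suc k, b) \<in> points D"
    using adjacent_points[OF fits adjacent_run[OF assms]] assms layers[OF assms]
      width_symmetric[of k] runs_in_range_down[of "D ! k" "width D k" s i s' j]
    by (auto simp: mem_points width_Suc)
qed

text \<open>The next point along the oriented strand. Going down from line \<open>k\<close> leads
  into layer \<open>k - 1\<close>. Points outside the diagram are fixed, which makes
  \<open>succ\<close> injective on the whole type.\<close>

definition succ :: "point \<Rightarrow> point" where
  "succ = (\<lambda>(k, p). if (k, p) \<notin> points D then (k, p)
    else if up (k, p) then (case layer_up (D ! k) p of Inl q \<Rightarrow> (Suc k, q) | Inr q \<Rightarrow> (k, q))
    else (case layer_down (D ! (k - 1)) p of Inl q \<Rightarrow> (k - 1, q) | Inr q \<Rightarrow> (k, q)))"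

lemma succ_intros:
  assumes "k < length D"
  shows "runs (D ! k) a b \<Longrightarrow> (k, a) \<in> points D \<Longrightarrow> up (k, a) \<Longrightarrow> succ (k, a) = (Suc k, b)"
    "caps (D ! k) a b \<or> caps (D ! k) b a \<Longrightarrow> up (k, a) \<Longrightarrow> succ (k, a) = (k, b)"
    "runs (D ! k) a b \<Longrightarrow> (k, a) \<in> points D \<Longrightarrow> \<not> up (Suc k, b) \<Longrightarrow> succ (Suc k, b) = (k, a)"
    "cups (D ! k) a b \<or> cups (D ! k) b a \<Longrightarrow> \<not> up (Suc k, a) \<Longrightarrow> succ (Suc k, a) = (Suc k, b)"
proof -
  note iffs = layer_up_iff[OF layers(1)[OF assms]] layer_down_iff[OF layers(1)[OF assms]]
  show "runs (D ! k) a b \<Longrightarrow> (k, a) \<in> points D \<Longrightarrow> up (k, a) \<Longrightarrow> succ (k, a) = (Suc k, b)"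
    using iffs(1)[of a b] by (simp add: succ_def)
  show "caps (D ! k) a b \<or> caps (D ! k) b a \<Longrightarrow> up (k, a) \<Longrightarrow> succ (k, a) = (k, b)"
    using iffs(2)[of a b] arcs_in_points(3)[OF assms, of a b] arcs_in_points(3)[OF assms, of b a] by (auto simp: succ_def)
  show "runs (D ! k) a b \<Longrightarrow> (k, a) \<in> points D \<Longrightarrow> \<not> up (Suc k, b) \<Longrightarrow> succ (Suc k, b) = (k, a)"
    using iffs(3)[of b a] arcs_in_points(1)[OF assms] by (simp add: succ_def)
  show "cups (D ! k) a b \<or> cups (D ! k) b a \<Longrightarrow> \<not> up (Suc k, a) \<Longrightarrow> succ (Suc k, a) = (Suc k, b)"
    using iffs(4)[of a b] arcs_in_points(2)[OF assms, of a b] arcs_in_points(2)[OF assms, of b a] by (auto simp: succ_def)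
qed

lemma succ_cases:
  assumes "p \<in> points D"
  obtains (run_up) k a b where "k < length D" "runs (D ! k) a b" "p = (k, a)" "succ p = (Suc k, b)" "up p"
    | (cap) k a b where "k < length D" "caps (D ! k) a b \<or> caps (D ! k) b a" "p = (k, a)"
      "succ p = (k, b)" "up p"
    | (run_down) k a b where "k < length D" "runs (D ! k) a b" "p = (Suc k, b)" "succ p = (k, a)"
      "\<not> up p" "(k, a) \<in> points D"
    | (cup) k a b where "k < length D" "cups (D ! k) a b \<or> cups (D ! k) b a" "p = (Suc k, a)"
      "succ p = (Suc k, b)" "\<not> up p"
proof -
  obtain k a where p: "p = (k, a)" by (cases p)
  obtain s i where a: "a = (s, i)" by (cases a)
  show ?thesis
  proof (cases "up p")
    case True
    \<comment> \<open>No point lies on the top line, so there is a layer above \<open>p\<close>;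
      likewise for the bottom line in the other case.\<close>
    have "k < length D"
      using assms symmetric unfolding p a mem_points symmetric_iff link_diagram_def
      by (metis le_neq_implies_less not_less_zero)
    note iffs = layer_up_iff[OF layers(1)[OF this]]
    show ?thesis
    proof (cases "layer_up (D ! k) a")
      case (Inl b)
      then show ?thesis using run_up[of k a b] iffs(1)[of a b] \<open>k < length D\<close> True assms p
        by (simp add: succ_def)
    next
      case (Inr b)
      then show ?thesis using cap[of k a b] iffs(2)[of a b] \<open>k < length D\<close> True assms p
        by (simp add: succ_def)
    qed
  next
    case False
    have "width D 0 s = 0" by (simp add: width_def)
    then have "k \<noteq> 0" using assms by (cases k) (auto simp: p a mem_points)
    then obtain k' where k: "k = Suc k'" by (cases k) auto
    then have "k' < length D" using assms by (auto simp: p a mem_points)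
    note iffs = layer_down_iff[OF layers(1)[OF this]]
    show ?thesis
    proof (cases "layer_down (D ! k') a")
      case (Inl b)
      then show ?thesis
        using run_down[of k' b a] iffs(1)[of a b] \<open>k' < length D\<close> False assms p k
          arcs_in_points(1)[of k' b a]
        by (simp add: succ_def)
    next
      case (Inr b)
      then show ?thesis using cup[of k' a b] iffs(2)[of a b] \<open>k' < length D\<close> False assms p k
        by (simp add: succ_def)
    qed
  qed
qed

lemma succ_adjacent:
  assumes "p \<in> points D"
  shows "symclp (adjacent D) p (succ p)"
  using assms
proof (cases rule: succ_cases)
  case (run_up k a b)
  then show ?thesis using adjacent_run[of k D a b] assms by (auto simp: symclp_def)
next
  case (cap k a b)
  then show ?thesis using adjacent_cap[of k D a b] adjacent_cap[of k D b a] by (auto simp: symclp_def)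
next
  case (run_down k a b)
  then show ?thesis using adjacent_run[of k D a b] by (auto simp: symclp_def)
next
  case (cup k a b)
  then show ?thesis using adjacent_cup[of k D a b] adjacent_cup[of k D b a] by (auto simp: symclp_def)
qed

lemma succ_in_points: "p \<in> points D \<Longrightarrow> succ p \<in> points D"
  using succ_adjacent[of p] adjacent_points[OF fits] unfolding symclp_def by blast

lemma adjacent_succ:
  assumes "adjacent D p q"
  shows "q = succ p \<or> p = succ q"
  using assms
proof cases
  case (adjacent_run k a b)
  then show ?thesis
    using succ_intros(1,3)[of k a b] orientation_rules(1)[of k a b] by (cases "up p") auto
next
  case (adjacent_cup k a b)
  then show ?thesis
    using succ_intros(4)[of k a b] succ_intros(4)[of k b a] orientation_rules(2)[of k a b] by auto
next
  case (adjacent_cap k a b)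
  then show ?thesis
    using succ_intros(2)[of k a b] succ_intros(2)[of k b a] orientation_rules(3)[of k a b] by auto
qed

text \<open>The reflection reverses the orientation, so the step from \<open>p\<close> to
  \<open>succ p\<close> is mirrored to a step from the image of \<open>succ p\<close> to the image
  of \<open>p\<close>. Injectivity of \<open>succ\<close> follows as well, since \<open>p\<close> is
  recovered from \<open>succ p\<close>.\<close>

lemma succ_reflect:
  assumes "p \<in> points D"
  shows "succ (reflect_point (succ p)) = reflect_point p"
proof -
  have up: "up (reflect_point (succ p)) \<longleftrightarrow> \<not> up (succ p)"
    by (rule reversing[OF succ_in_points[OF assms]])
  have refl: "reflect_point p \<in> points D" by (rule reflect_in_points[OF assms])
  from assms show ?thesis
  proof (cases rule: succ_cases)
    case (run_up k a b)
    note m = mirror_arcs[OF layers(1)[OF run_up(1)]]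
    from run_up assms show ?thesis
      using succ_intros(3)[OF run_up(1), of "mirror a" "mirror b"] m(1)[of a b] up refl
        orientation_rules(1)[OF run_up(1), of a b] by (simp add: reflect_point_eq)
  next
    case (cap k a b)
    note m = mirror_arcs[OF layers(1)[OF cap(1)]]
    from cap show ?thesis
      using succ_intros(2)[OF cap(1), of "mirror b" "mirror a"] m(2)[of a b] up
        orientation_rules(3)[OF cap(1), of a b] orientation_rules(3)[OF cap(1), of b a]
      by (auto simp: reflect_point_eq)
  next
    case (run_down k a b)
    note m = mirror_arcs[OF layers(1)[OF run_down(1)]]
    have "(k, mirror a) \<in> points D"
      using reflect_in_points[OF run_down(6)] by (simp add: reflect_point_eq)
    with run_down show ?thesis
      using succ_intros(1)[OF run_down(1), of "mirror a" "mirror b"] m(1)[of a b] up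
        orientation_rules(1)[OF run_down(1), of a b] by (simp add: reflect_point_eq)
  next
    case (cup k a b)
    note m = mirror_arcs[OF layers(1)[OF cup(1)]]
    from cup show ?thesis
      using succ_intros(4)[OF cup(1), of "mirror b" "mirror a"] m(3)[of a b] up
        orientation_rules(2)[OF cup(1), of a b] orientation_rules(2)[OF cup(1), of b a]
      by (auto simp: reflect_point_eq)
  qed
qed

lemma inj_succ: "inj succ"
proof (rule injI)
  have outside: "succ p = p" if "p \<notin> points D" for p
    using that by (cases p) (simp add: succ_def)
  fix p q assume eq: "succ p = succ q"
  show "p = q"
  proof (cases "p \<in> points D"; cases "q \<in> points D")
    assume "p \<in> points D" "q \<in> points D"
    then have "reflect_point p = reflect_point q"
      using succ_reflect eq by metis
    then show "p = q" by (metis reflect_reflect)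
  qed (use eq outside succ_in_points in metis)+
qed

lemma joined_funpow:
  assumes "(symclp (adjacent D))\<^sup>*\<^sup>* p q" "p \<in> points D"
  shows "\<exists>n. q = (succ ^^ n) p"
  using assms(1)
proof (induction rule: rtranclp_induct)
  case base
  show ?case by (rule exI[of _ 0]) simp
next
  case (step q r)
  then obtain n where n: "q = (succ ^^ n) p" by blast
  have orbit: "(succ ^^ m) p \<in> points D" for m
    by (induction m) (auto simp: assms(2) succ_in_points)
  have "r = succ q \<or> q = succ r"
    using step.hyps(2) adjacent_succ unfolding symclp_def by blast
  then show ?case
  proof
    assume "r = succ q"
    then show ?thesis using n by (intro exI[of _ "Suc n"]) simp
  next
    assume q: "q = succ r"
    \<comment> \<open>The orbit is a finite cycle, so one step back equals \<open>N - 1\<close>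
      steps forward.\<close>
    have "finite {y. \<exists>n. y = (succ ^^ n) p}"
      by (rule finite_subset[OF _ finite_points[of D]]) (use orbit in auto)
    then obtain N where N: "N > 0" "(succ ^^ N) p = p"
      using funpow_inj_finite[OF inj_succ, of p] by auto
    have "succ r = succ ((succ ^^ (n + (N - 1))) p)"
    proof -
      have "(succ ^^ n) p = (succ ^^ n) ((succ ^^ N) p)" using N by simp
      also have "\<dots> = (succ ^^ Suc (n + (N - 1))) p" using N(1) by (simp flip: funpow_add comp_apply[of "succ ^^ n"])
      finally show ?thesis using q n by simp
    qed
    then show ?thesis using inj_succ by (metis injD)
  qed
qed

lemma component_orbit:
  assumes "C \<in> link_components D" "p \<in> C"
  shows "C = range (\<lambda>n. (succ ^^ n) p)"
proof (intro equalityI subsetI)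
  have p: "p \<in> points D" using assms Union_components[of D] by blast
  fix q assume "q \<in> C"
  from joined_funpow[OF component_joined[OF assms this] p] show "q \<in> range (\<lambda>n. (succ ^^ n) p)" by auto
next
  have "(succ ^^ n) p \<in> C" for n
  proof (induction n)
    case (Suc n)
    then have "(succ ^^ n) p \<in> points D" using assms(1) Union_components[of D] by blast
    then have "symclp (adjacent D) ((succ ^^ n) p) (succ ((succ ^^ n) p))" by (rule succ_adjacent)
    then show ?case
      using component_closed[OF fits assms(1), of "(succ ^^ n) p" "succ ((succ ^^ n) p)"]
        component_closed[OF fits assms(1), of "succ ((succ ^^ n) p)" "(succ ^^ n) p"] Suc
      by (auto simp: symclp_def)
  qed (simp add: assms(2))
  then show "q \<in> C" if "q \<in> range (\<lambda>n. (succ ^^ n) p)" for q using that by auto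
qed

text \<open>The points at which an oriented cup or cap over the axis begins. A strand through an
  axis crossing moves to another cutting line and is thus not counted.\<close>

definition axis_starts :: "point set" where
  "axis_starts = {p \<in> points D. succ p = reflect_point p}"

text \<open>On each component \<open>succ\<close> is a cycle reversed by the reflection without
  fixed points, so \<open>reversed_orbit\<close> gives two axis points per component.\<close>

lemma card_axis_starts_components:
  assumes "\<forall>C\<in>link_components D. reflect_point ` C = C"
  shows "card axis_starts = 2 * card (link_components D)"
proof -
  have sub: "C \<subseteq> points D" if "C \<in> link_components D" for C
    using that Union_components[of D] by blast
  have two: "card {p \<in> C. succ p = reflect_point p} = 2" if C: "C \<in> link_components D" for C
  proof -
    obtain p where p: "p \<in> C" using component_nonempty[OF C] by blast
    show ?thesis
    proof (rule reversed_orbit[OF inj_succ component_orbit[OF C p]])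
      show "finite C" using sub[OF C] finite_points finite_subset by blast
      show "reflect_point x \<in> C" if "x \<in> C" for x using that assms C by blast
      show "reflect_point x \<noteq> x" for x by (cases x rule: reflect_point.cases) simp
      show "succ (reflect_point (succ x)) = reflect_point x" if "x \<in> C" for x
        using that sub[OF C] succ_reflect by blast
    qed
  qed
  have "axis_starts = (\<Union>C\<in>link_components D. {p \<in> C. succ p = reflect_point p})"
    using Union_components[of D] by (auto simp: axis_starts_def)
  then have "card axis_starts = (\<Sum>C\<in>link_components D. card {p \<in> C. succ p = reflect_point p})"
  proof (simp only:, intro card_UN_disjoint)
    show "finite (link_components D)"
      unfolding link_components_def
      by (rule finite_quotient) (use finite_points equiv_joined in \<open>auto simp: equiv_def\<close>)
    show "\<forall>C\<in>link_components D. finite {p \<in> C. succ p = reflect_point p}"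
    proof
      fix C assume "C \<in> link_components D"
      from sub[OF this] show "finite {p \<in> C. succ p = reflect_point p}"
        by (intro finite_subset[OF _ finite_points[of D]]) blast
    qed
    show "\<forall>C\<in>link_components D. \<forall>C'\<in>link_components D. C \<noteq> C' \<longrightarrow>
        {p \<in> C. succ p = reflect_point p} \<inter> {p \<in> C'. succ p = reflect_point p} = {}"
      using components_disjoint by blast
  qed
  then show ?thesis using two by simp
qed

lemma card_axis_starts: "card axis_starts = sum_list (map axis_points D)"
proof -
  define K where "K = {k. k < length D \<and> (D ! k = Ax_cap \<or> D ! k = Ax_turn)}"
  define K' where "K' = {k. k < length D \<and> (D ! k = Ax_cup \<or> D ! k = Ax_turn)}"
  \<comment> \<open>A cap is entered at its end directed upwards, a cup at its end directed
    downwards. An \<open>Ax_turn\<close> belongs to both \<open>K\<close> and \<open>K'\<close> and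
    contributes one point on each of its two lines.\<close>
  define g where "g k = (k, if up (k, Lft, 0) then Lft else Rgt, 0 :: nat)" for k
  define g' where "g' k = (Suc k, if up (Suc k, Lft, 0) then Rgt else Lft, 0 :: nat)" for k
  have K: "caps (D ! k) (Lft, 0) (Rgt, 0)" "k < length D" if "k \<in> K" for k
    using that by (auto simp: K_def)
  have K': "cups (D ! k) (Lft, 0) (Rgt, 0)" "k < length D" if "k \<in> K'" for k
    using that by (auto simp: K'_def)
  have g: "up (g k)" "g k \<in> axis_starts" if "k \<in> K" for k
  proof -
    note k = K(2)[OF that] and c = K(1)[OF that]
    show "up (g k)" using orientation_rules(3)[OF k c] by (auto simp: g_def)
    then show "g k \<in> axis_starts"
      using succ_intros(2)[OF k, of "(Lft, 0)" "(Rgt, 0)"] succ_intros(2)[OF k, of "(Rgt, 0)" "(Lft, 0)"]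
        arcs_in_points(3)[OF k c] c
      by (auto simp: g_def axis_starts_def)
  qed
  have g': "\<not> up (g' k)" "g' k \<in> axis_starts" if "k \<in> K'" for k
  proof -
    note k = K'(2)[OF that] and c = K'(1)[OF that]
    show "\<not> up (g' k)" using orientation_rules(2)[OF k c] by (auto simp: g'_def)
    then show "g' k \<in> axis_starts"
      using succ_intros(4)[OF k, of "(Lft, 0)" "(Rgt, 0)"] succ_intros(4)[OF k, of "(Rgt, 0)" "(Lft, 0)"]
        arcs_in_points(2)[OF k c] c
      by (auto simp: g'_def axis_starts_def)
  qed
  have across: "i = 0 \<and> (x = Ax_cap \<or> x = Ax_turn)"
    if "caps x (s, i) (other s, i) \<or> caps x (other s, i) (s, i)" for x s i
    using that by (cases x; cases s) auto
  have across': "i = 0 \<and> (x = Ax_cup \<or> x = Ax_turn)"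
    if "cups x (s, i) (other s, i) \<or> cups x (other s, i) (s, i)" for x s i
    using that by (cases x; cases s) auto
  have "axis_starts \<subseteq> g ` K \<union> g' ` K'"
  proof
    fix p assume "p \<in> axis_starts"
    then have p: "p \<in> points D" "succ p = reflect_point p" by (auto simp: axis_starts_def)
    obtain k s i where ksi: "p = (k, s, i)" by (cases p)
    from p(1) show "p \<in> g ` K \<union> g' ` K'"
    proof (cases rule: succ_cases)
      case (cap k' a b)
      then have "i = 0 \<and> (D ! k = Ax_cap \<or> D ! k = Ax_turn)" "k < length D"
        using p(2) ksi across[of "D ! k" s i] by auto
      then have "k \<in> K" "i = 0" by (auto simp: K_def)
      moreover have "p = g k"
        using \<open>up p\<close> \<open>i = 0\<close> orientation_rules(3)[OF K(2,1)[OF \<open>k \<in> K\<close>]]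
        by (cases s) (auto simp: g_def ksi)
      ultimately show ?thesis by blast
    next
      case (cup k' a b)
      then have k: "k = Suc k'" and "i = 0 \<and> (D ! k' = Ax_cup \<or> D ! k' = Ax_turn)" "k' < length D"
        using p(2) ksi across'[of "D ! k'" s i] by auto
      then have "k' \<in> K'" "i = 0" by (auto simp: K'_def)
      moreover have "p = g' k'"
        using \<open>\<not> up p\<close> \<open>i = 0\<close> orientation_rules(2)[OF K'(2,1)[OF \<open>k' \<in> K'\<close>]]
        by (cases s) (auto simp: g'_def ksi k)
      ultimately show ?thesis by blast
    qed (use p(2) ksi in auto)
  qed
  with g g' have "axis_starts = g ` K \<union> g' ` K'" by blast
  moreover have "g ` K \<inter> g' ` K' = {}" using g(1) g'(1) by fastforce
  moreover have "inj_on g K" "inj_on g' K'" by (auto simp: inj_on_def g_def g'_def)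
  moreover have "finite K" "finite K'" by (auto simp: K_def K'_def)
  ultimately have "card axis_starts = card K + card K'"
    by (simp add: card_Un_disjoint card_image)
  also have "\<dots> = (\<Sum>k<length D. of_bool (D ! k = Ax_cap \<or> D ! k = Ax_turn) +
      of_bool (D ! k = Ax_cup \<or> D ! k = Ax_turn))"
    by (simp add: sum.distrib K_def K'_def Collect_conj_eq lessThan_def del: of_bool_or_iff)
  also have "\<dots> = (\<Sum>k<length D. axis_points (D ! k))"
  proof (rule sum.cong)
    fix k assume "k \<in> {..<length D}"
    then have "symmetric_layer (D ! k)" using layers by simp
    then show "of_bool (D ! k = Ax_cap \<or> D ! k = Ax_turn) +
        of_bool (D ! k = Ax_cup \<or> D ! k = Ax_turn) = axis_points (D ! k)"
      by (cases "D ! k") (auto simp: symmetric_layer_def)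
  qed simp
  also have "\<dots> = sum_list (map axis_points D)"
    by (simp add: sum_list_sum_nth atLeast0LessThan)
  finally show ?thesis .
qed

text \<open>At the mirror image of a crossing both strands have the opposite vertical direction,
  which does not affect the sign, while the over label is reversed. So the signs cancel in
  pairs.\<close>

lemma alpha_0: "alpha D up = 0"
  unfolding alpha_def
proof (rule sum.neutral, rule ballI)
  fix k assume "k \<in> {..<length D}"
  then have k: "k < length D" by simp
  from layers(1)[OF k] show "off_axis_sign (D ! k) (\<lambda>p. up (k, p)) = 0"
  proof (cases rule: symmetric_layer_cases)
    case (5 i y)
    then have "up (k, Rgt, j) \<longleftrightarrow> \<not> up (k, Lft, j)" if "j < i + 2" for j
      using that reversing[of "(k, Lft, j)"] layers(2)[OF k] k
      by (simp add: mem_points crossing_pair_def)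
    from this[of i] this[of "Suc i"] show ?thesis
      by (cases y) (auto simp: 5 crossing_pair_def crossing_sign_def)
  qed auto
qed

text \<open>The lower ends of an axis crossing are mirror images, hence one strand is directed
  upwards and the other downwards.\<close>

lemma beta_axis_writhe: "beta D up = axis_writhe D"
proof -
  have "on_axis_sign (D ! k) (\<lambda>p. up (k, p)) =
      (case D ! k of Ax_cross Desc \<Rightarrow> 1 | Ax_cross Asc \<Rightarrow> -1 | _ \<Rightarrow> 0)" if k: "k < length D" for k
    using layers(1)[OF k]
  proof (cases rule: symmetric_layer_cases)
    case (9 y)
    then have "up (k, Rgt, 0) \<longleftrightarrow> \<not> up (k, Lft, 0)"
      using reversing[of "(k, Lft, 0)"] layers(2)[OF k] k by (simp add: mem_points)
    then show ?thesis by (cases y) (auto simp: 9 crossing_sign_def)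
  qed (auto simp: crossing_pair_def)
  then show ?thesis
    by (simp add: beta_def axis_writhe_def sum_list_sum_nth atLeast0LessThan)
qed

end

text \<open>The definition provides only some reversed orientation \<open>u\<close>. A point and its
  mirror image lie on the same component, where \<open>up\<close> agrees with \<open>u\<close> or
  opposes it throughout; so \<open>up\<close> is reversed too.\<close>

lemma symmetric_union_reversing:
  assumes "symmetric_union D" "orientation D up"
  shows "reversing_orientation D up"
proof
  show sym: "symmetric D" and "orientation D up" using assms by (auto simp: symmetric_union_def)
  have fits: "fits D" using sym by (simp add: symmetric_iff link_diagram_iff)
  obtain u where u: "orientation D u" "\<And>p. p \<in> points D \<Longrightarrow> u (reflect_point p) \<longleftrightarrow> \<not> u p"
    using assms(1) by (auto simp: symmetric_union_def)
  fix p assume p: "p \<in> points D"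
  then obtain C where C: "C \<in> link_components D" "p \<in> C" using Union_components[of D] by blast
  moreover have "reflect_point p \<in> C"
    using assms(1) C by (auto simp: symmetric_union_def)
  ultimately have "(symclp (adjacent D))\<^sup>*\<^sup>* p (reflect_point p)" by (blast intro: component_joined)
  from orientation_adjacent[OF fits assms(2) u(1) this] u(2)[OF p]
  show "up (reflect_point p) \<longleftrightarrow> \<not> up p" by blast
qed

theorem proposition1p8:
  fixes D :: diagram and up :: "point \<Rightarrow> bool" and n :: nat
  assumes "symmetric_union D" and "orientation D up"
  shows "(card (link_components D) = 1 \<longrightarrow> W D up \<in> laurent_polys) \<and>
         (card (link_components D) = n \<longrightarrow>
            (\<exists>f\<in>laurent_polys. W D up = f * (sqrt_s + inverse sqrt_s) powi (int n - 1)))"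
proof -
  interpret reversing_orientation D up by (rule symmetric_union_reversing[OF assms])
  define N where "N = int (card (link_components D))"
  have "sum_list (map axis_points D) = 2 * card (link_components D)"
    using card_axis_starts card_axis_starts_components assms(1) by (simp add: symmetric_union_def)
  then have N: "half_axis_points D = N" by (simp add: half_axis_points_def N_def)
  obtain f where f: "f \<in> laurent_polys"
    "bracket D = var_B powi (3 * axis_writhe D) * circle_B powi (N - 1) * f"
    using bracket_module[of "[]" D] symmetric by (auto simp: in_bracket_module_def N)
  have B: "(- (var_B powi - 3)) powi b = (-1) powi b * var_B powi (- (3 * b))" for b
  proof -
    have "- (var_B powi - 3) = -1 * var_B powi - 3" by simp
    then show ?thesis by (simp only: power_int_mult_distrib flip: power_int_mult) simp
  qed
  have circle: "circle_B powi (N - 1) = (-1) powi (N - 1) * (sqrt_s + inverse sqrt_s) powi (N - 1)"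
  proof -
    have "circle_B = -1 * (sqrt_s + inverse sqrt_s)"
      by (simp add: circle_B_def sqrt_s_def power_int_minus)
    then show ?thesis by (metis power_int_mult_distrib)
  qed
  \<comment> \<open>The signs coming from \<open>circle_B\<close> and from the normalising factor
    are absorbed into the Laurent polynomial.\<close>
  define g where "g = (-1) powi axis_writhe D * ((-1) powi (N - 1) * f)"
  have sign: "(-1) powi i \<in> laurent_polys" for i :: int
    by (cases "even i") (auto simp: laurent_intros)
  have g: "g \<in> laurent_polys" unfolding g_def by (intro laurent_mult sign f(1))
  have "var_B powi (3 * axis_writhe D) * var_B powi (- (3 * axis_writhe D)) = 1"
    by (simp flip: power_int_add)
  then have W: "W D up = g * (sqrt_s + inverse sqrt_s) powi (N - 1)"
    by (simp add: W_def alpha_0 beta_axis_writhe f(2) B circle g_def mult_ac)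
  \<comment> \<open>For one component the exponent is zero, which gives the first claim.\<close>
  show ?thesis
    using g W by (auto simp: N_def)
qed

end
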